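(* Let $\theta\in\mathbb{C}$ and let $f=p_{h(\theta)}$, where $h(\theta)$ is the functional on $\operatorname{Sym}\mathbb{C}^{2}\otimes\Lambda\mathbb{C}^{2}$ defined in the context. Then the dimension pairs of the models of $f$ are exactly the pairs $(2+2r,\,2+2r)$ with $r\in\mathbb{N}$: the model $h(\theta)$ on $\mathbb{C}^{2|2}$ is minimal (it has the least total number of colours of any model of $f$), the growth base $R_f=\sup_{t\ge1}(\operatorname{rk}M_{f,t})^{1/t}$ equals $4$, and $(\operatorname{rk}M_{f,2n})^{1/2n}\to4$ as $n\to\infty$.
   Context: $\mathbb{N}=\mathbb{Z}_{\ge 0}$ and $[n]=\{1,\dots,n\}$. Graphs. A graph is a finite multigraph in which loops, parallel edges and free circles are permitted: formally, a finite vertex set, a finite set of half-edges, an incidence map from half-edges to vertices, a perfect matching of the half-edges into edges, and a nonnegative integer counting the free circles (closed edges incident with no vertex, carrying no half-edges). The two half-edges of a loop are distinct and lie at the same vertex; $\deg(v)$ counts half-edges at $v$. $\bigcirc$ is a single free circle. A graph parameter is a function from isomorphism classes of graphs to $\mathbb{C}$. Fragments and connection matrices. A $t$-fragment is a graph with exactly $t$ distinguished vertices of degree one, labelled $1,\dots,t$; the edge at the $i$-th labelled vertex is the open end $i$ (one edge may join two labelled vertices). $\mathfrak{F}_t$ is the set of isomorphism classes (preserving labels) of $t$-fragments. To glue two open ends, delete the two labelled vertices and unify their edges into a single edge; closed chains of edges arising this way become free circles. For $F,G\in\mathfrak{F}_t$, $F\ast G\in\mathfrak{F}_0$ is obtained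 by gluing the $i$-th open end of $F$ to the $i$-th open end of $G$ for every $i$. $M_{f,t}$ is the $\mathfrak{F}_t\times\mathfrak{F}_t$ matrix with entries $f(F\ast G)$; $\operatorname{rk}M_{f,t}$ is the supremum of the ranks of its finite submatrices. Models. Let $k,\ell\in\mathbb{N}$, let $e_1,\dots,e_k$ be the standard basis of $V_0=\mathbb{C}^k$ and $\xi_1,\dots,\xi_{2\ell}$ that of $V_1=\mathbb{C}^{2\ell}$, and put $\eta_i=-\xi_{i+\ell}$ for $i\le\ell$, $\eta_i=\xi_{i-\ell}$ for $i>\ell$. Let $h\in(\operatorname{Sym}V_0\otimes\Lambda V_1)^{*}$. For a graph $G$ without free circles, with edge set $E$, and $F\subseteq E$, let $\delta_F(v)$ be the set of half-edges at $v$ belonging to edges of $F$. $F$ is Eulerian if $|\delta_F(v)|$ is even for all $v$. For Eulerian $F$ choose an orientation of the edges of $F$ with, at each vertex, equally many incoming as outgoing half-edges of $F$, and a local pairing $\kappa=(\kappa_v)_v$, pairing at each $v$ each incoming half-edge of $\delta_F(v)$ with an outgoing one; pairs are written $(a_1,a_2)$ with $a_1$ incoming. Following pairs from edge to edge decomposes $F$ into directed circuits, whose number is $c(\kappa)$. Then $$p_h(G)=\sum_{F\subseteq E\ \text{Eulerian}}(-1)^{c(\kappa)}\sum_{\psi\colon E\setminus F\to[k]}\ \sum_{\varphi\colon F\to[2\ell]}\ \prod_{v\in V(G)}h\Bigl(\bigodot_{a\in\delta_{E\setminus F}(v)}e_{\psi(a)}\otimes\bigwedge_{(a_1,a_2)\in\kappa_v}\xi_{\varphi(a_1)}\wedge\eta_{\varphi(a_2)}\Bigr),$$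 each half-edge inheriting the colour of its edge (the value is independent of the chosen orientations and pairings); $p_h$ is extended to all graphs by $p_h(\bigcirc)=k-2\ell$ and multiplicativity over disjoint union. A model of a graph parameter $f$ is a triple $(k',\ell',h')$ with $k',\ell'\in\mathbb{N}$, $h'\in(\operatorname{Sym}\mathbb{C}^{k'}\otimes\Lambda\mathbb{C}^{2\ell'})^{*}$ and $f=p_{h'}$; its dimension pair is $(k',2\ell')$ and its total number of colours is $k'+2\ell'$. The functional $h(\theta)$. Here $k=2$, $\ell=1$, and $h=h(\theta)$ is determined by $$h(e_1^{\odot i})=\theta,\qquad h(e_1^{\odot i}\odot e_2)=\sqrt{-1},\qquad h(e_1^{\odot i}\otimes\xi_1\wedge\eta_1)=1\qquad(i\ge0),$$ and by $h=0$ on all monomial basis elements of $\operatorname{Sym}\mathbb{C}^2\otimes\Lambda\mathbb{C}^2$ outside the span of these (note $\xi_1\wedge\eta_1=-\xi_1\wedge\xi_2$). It is known that on graphs without free circles $p_{h(\theta)}(G)=\det(\theta I-A_G)$, where the adjacency matrix $A_G$ counts a loop twice on the diagonal; $p_{h(\theta)}$ vanishes on graphs with a free circle. *)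

theory Defs
  imports
    Complex_Main
    "HOL-Library.Multiset"
    "HOL-Library.FuncSet"
    "HOL-Library.Disjoint_Sets"
    "HOL-Library.Nat_Bijection"
    "HOL-Library.Extended_Nat"
    "HOL-Library.Extended_Real"
    "HOL-Combinatorics.Orbits"
    "Jordan_Normal_Form.DL_Rank"
begin

section \<open>Graphs\<close>

text \<open>
  Vertices and half-edges are natural numbers, so that every isomorphism class of finite graphs
  has a representative. An edge is the two-element set of its half-edges; \<open>circles\<close> is the number
  of free circles. Values of \<open>inc\<close> outside \<open>halves\<close> carry no meaning.
\<close>

record mgraph =
  verts :: "nat set"
  halves :: "nat set"
  inc :: "nat \<Rightarrow> nat"
  edges :: "nat set set"
  circles :: nat

definition is_graph :: "mgraph \<Rightarrow> bool" where
  "is_graph G \<longleftrightarrow>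
     finite (verts G) \<and> finite (halves G) \<and> inc G \<in> halves G \<rightarrow> verts G \<and>
     partition_on (halves G) (edges G) \<and> (\<forall>e\<in>edges G. card e = 2)"

definition halves_at :: "mgraph \<Rightarrow> nat \<Rightarrow> nat set" where
  "halves_at G v = {a \<in> halves G. inc G a = v}"

definition deg :: "mgraph \<Rightarrow> nat \<Rightarrow> nat" where
  "deg G v = card (halves_at G v)"

definition edge_of :: "mgraph \<Rightarrow> nat \<Rightarrow> nat set" where
  "edge_of G a = (THE e. e \<in> edges G \<and> a \<in> e)"

definition mate :: "mgraph \<Rightarrow> nat \<Rightarrow> nat" where
  "mate G a = (THE b. edge_of G a = {a, b} \<and> b \<noteq> a)"

definition disjoint_union :: "mgraph \<Rightarrow> mgraph \<Rightarrow> mgraph" where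
  "disjoint_union G H =
    \<lparr> verts = sum_encode ` (verts G <+> verts H),
      halves = sum_encode ` (halves G <+> halves H),
      inc = (\<lambda>a. case sum_decode a of
               Inl x \<Rightarrow> sum_encode (Inl (inc G x)) | Inr y \<Rightarrow> sum_encode (Inr (inc H y))),
      edges = (\<lambda>e. (\<lambda>x. sum_encode (Inl x)) ` e) ` edges G \<union>
              (\<lambda>e. (\<lambda>y. sum_encode (Inr y)) ` e) ` edges H,
      circles = circles G + circles H \<rparr>"


section \<open>Fragments, gluing and connection matrices\<close>

text \<open>
  A fragment is a graph together with the list of its labelled vertices; label \<open>i\<close> of the usual
  numbering \<open>1, \<dots>, t\<close> sits at list position \<open>i - 1\<close>.
\<close>

type_synonym fragment = "mgraph \<times> nat list"

definition fragments :: "nat \<Rightarrow> fragment set" where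
  "fragments t = {(G, us). is_graph G \<and> length us = t \<and> distinct us \<and>
                           set us \<subseteq> verts G \<and> (\<forall>u\<in>set us. deg G u = 1)}"

text \<open>
  Gluing the open ends at the degree-one vertices \<open>u\<close> and \<open>v\<close>, with half-edges \<open>a\<close> and \<open>b\<close>. If
  \<open>a\<close> and \<open>b\<close> lie on the same edge, that edge closes up to a free circle; otherwise the two other
  half-edges of their edges form the unified edge.
\<close>

definition glue_ends :: "nat \<Rightarrow> nat \<Rightarrow> mgraph \<Rightarrow> mgraph" where
  "glue_ends u v G =
    (let a = (THE a. a \<in> halves_at G u); b = (THE b. b \<in> halves_at G v);
         d = edge_of G a; e = edge_of G b
     in \<lparr> verts = verts G - {u, v},
          halves = halves G - {a, b},
          inc = inc G,
          edges = (edges G - {d, e}) \<union> (if d = e then {} else {(d \<union> e) - {a, b}}),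
          circles = circles G + (if d = e then 1 else 0) \<rparr>)"

definition glue :: "fragment \<Rightarrow> fragment \<Rightarrow> mgraph" where
  "glue F G =
    fold (\<lambda>(u, v). glue_ends (sum_encode (Inl u)) (sum_encode (Inr v)))
      (zip (snd F) (snd G)) (disjoint_union (fst F) (fst G))"

definition connection_submatrix ::
  "(mgraph \<Rightarrow> complex) \<Rightarrow> fragment list \<Rightarrow> fragment list \<Rightarrow> complex mat" where
  "connection_submatrix f Fs Gs =
    mat (length Fs) (length Gs) (\<lambda>(i, j). f (glue (Fs ! i) (Gs ! j)))"

text \<open>
  Rows and columns are indexed by representatives instead of isomorphism classes of fragments.
  For an isomorphism-invariant \<open>f\<close> this only repeats rows and columns, as do repetitions in the
  lists, and so does not change the supremum of the ranks.
\<close>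

definition connection_rank :: "(mgraph \<Rightarrow> complex) \<Rightarrow> nat \<Rightarrow> enat" where
  "connection_rank f t =
    (SUP (Fs, Gs) \<in> lists (fragments t) \<times> lists (fragments t).
       enat (vec_space.rank (length Fs) (connection_submatrix f Fs Gs)))"

definition connection_rank_root :: "(mgraph \<Rightarrow> complex) \<Rightarrow> nat \<Rightarrow> ereal" where
  "connection_rank_root f t =
    (case connection_rank f t of enat m \<Rightarrow> ereal (root t (real m)) | \<infinity> \<Rightarrow> \<infinity>)"

definition growth_base :: "(mgraph \<Rightarrow> complex) \<Rightarrow> ereal" where
  "growth_base f = (SUP t \<in> {1..}. connection_rank_root f t)"


section \<open>Functionals on the symmetric tensor exterior algebra\<close>

text \<open>
  A linear functional on \<open>Sym \<complex>\<^sup>k \<otimes> \<Lambda> \<complex>\<^bsup>2l\<^esup>\<close> is given by its arbitrary values on the monomial basis: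
  \<open>h M S\<close> is the value at the product of the \<open>e\<^sub>i\<close>, \<open>i \<in># M\<close>, tensored with
  \<open>\<xi>\<^bsub>s\<^sub>1\<^esub> \<and> \<dots> \<and> \<xi>\<^bsub>s\<^sub>m\<^esub>\<close> where \<open>S = {s\<^sub>1 < \<dots> < s\<^sub>m}\<close>. Only \<open>M\<close> over \<open>{1..k}\<close> and
  \<open>S \<subseteq> {1..2l}\<close> matter.
\<close>

type_synonym functional = "nat multiset \<Rightarrow> nat set \<Rightarrow> complex"

definition inversions :: "nat list \<Rightarrow> (nat \<times> nat) set" where
  "inversions js = {(p, q). p < q \<and> q < length js \<and> js ! q < js ! p}"

text \<open>The value at the monomial of \<open>M\<close> tensored with \<open>\<xi>\<^bsub>j\<^sub>1\<^esub> \<and> \<dots> \<and> \<xi>\<^bsub>j\<^sub>m\<^esub>\<close>, \<open>js = [j\<^sub>1, \<dots>, j\<^sub>m]\<close> in any order.\<close>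

definition wedge_value :: "functional \<Rightarrow> nat multiset \<Rightarrow> nat list \<Rightarrow> complex" where
  "wedge_value h M js =
    (if distinct js then (-1) ^ card (inversions js) * h M (set js) else 0)"

text \<open>\<open>\<eta>\<^sub>j = eta_sign l j \<cdot> \<xi>\<^bsub>eta_index l j\<^esub>\<close>.\<close>

definition eta_index :: "nat \<Rightarrow> nat \<Rightarrow> nat" where
  "eta_index l j = (if j \<le> l then j + l else j - l)"

definition eta_sign :: "nat \<Rightarrow> nat \<Rightarrow> complex" where
  "eta_sign l j = (if j \<le> l then -1 else 1)"

text \<open>The value at the monomial of \<open>M\<close> tensored with the wedge of \<open>\<xi>\<^sub>i \<and> \<eta>\<^sub>j\<close> over the pairs \<open>(i, j)\<close> of the list.\<close>

definition pairs_value :: "nat \<Rightarrow> functional \<Rightarrow> nat multiset \<Rightarrow> (nat \<times> nat) list \<Rightarrow> complex" where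
  "pairs_value l h M ps =
    (\<Prod>(i, j)\<leftarrow>ps. eta_sign l j) *
    wedge_value h M (concat (map (\<lambda>(i, j). [i, eta_index l j]) ps))"


section \<open>The partition function and its models\<close>

definition eulerian :: "mgraph \<Rightarrow> nat set set \<Rightarrow> bool" where
  "eulerian G F \<longleftrightarrow> F \<subseteq> edges G \<and> (\<forall>v\<in>verts G. even (card (halves_at G v \<inter> \<Union>F)))"

text \<open>
  An orientation of the edges of \<open>F\<close> is encoded by the set \<open>I\<close> of incoming half-edges: a directed
  edge leaves the vertex of its half-edge outside \<open>I\<close> and enters the vertex of its half-edge in \<open>I\<close>.
\<close>

definition balanced_orientation :: "mgraph \<Rightarrow> nat set set \<Rightarrow> nat set \<Rightarrow> bool" where
  "balanced_orientation G F I \<longleftrightarrow>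
     I \<subseteq> \<Union>F \<and> (\<forall>e\<in>F. card (e \<inter> I) = 1) \<and>
     (\<forall>v\<in>verts G. card (halves_at G v \<inter> I) = card (halves_at G v \<inter> (\<Union>F - I)))"

text \<open>All pairings \<open>\<kappa>\<^sub>v\<close> at once: \<open>\<kappa>\<close> maps each incoming half-edge to its outgoing partner at the same vertex.\<close>

definition local_pairing :: "mgraph \<Rightarrow> nat set set \<Rightarrow> nat set \<Rightarrow> (nat \<Rightarrow> nat) \<Rightarrow> bool" where
  "local_pairing G F I \<kappa> \<longleftrightarrow> bij_betw \<kappa> I (\<Union>F - I) \<and> (\<forall>a\<in>I. inc G (\<kappa> a) = inc G a)"

definition chosen_pairing :: "mgraph \<Rightarrow> nat set set \<Rightarrow> nat set \<times> (nat \<Rightarrow> nat)" where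
  "chosen_pairing G F =
    (SOME (I, \<kappa>). balanced_orientation G F I \<and> local_pairing G F I \<kappa>)"

text \<open>
  From an incoming half-edge \<open>a\<close> a circuit continues along the edge of \<open>\<kappa> a\<close>, arriving at the
  incoming half-edge \<open>mate G (\<kappa> a)\<close>; circuits are the orbits of this permutation of \<open>I\<close>.
\<close>

definition num_circuits :: "mgraph \<Rightarrow> nat set \<Rightarrow> (nat \<Rightarrow> nat) \<Rightarrow> nat" where
  "num_circuits G I \<kappa> = card (orbit (mate G \<circ> \<kappa>) ` I)"

text \<open>
  The pairs at \<open>v\<close> are listed by increasing incoming half-edge. The order is immaterial, as the
  elements \<open>\<xi>\<^sub>i \<and> \<eta>\<^sub>j\<close> of even degree commute.
\<close>

definition vertex_weight ::
  "nat \<Rightarrow> functional \<Rightarrow> mgraph \<Rightarrow> nat set set \<Rightarrow> nat set \<Rightarrow> (nat \<Rightarrow> nat) \<Rightarrow>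
   (nat set \<Rightarrow> nat) \<Rightarrow> (nat set \<Rightarrow> nat) \<Rightarrow> nat \<Rightarrow> complex" where
  "vertex_weight l h G F I \<kappa> \<psi> \<phi> v =
    pairs_value l h
      (image_mset (\<lambda>a. \<psi> (edge_of G a)) (mset_set (halves_at G v - \<Union>F)))
      (map (\<lambda>a. (\<phi> (edge_of G a), \<phi> (edge_of G (\<kappa> a))))
        (sorted_list_of_set (halves_at G v \<inter> I)))"

text \<open>
  The factor for the free circles is forced by the value \<open>k - 2l\<close> at a single free circle and
  multiplicativity over disjoint unions.
\<close>

definition partition_function :: "nat \<Rightarrow> nat \<Rightarrow> functional \<Rightarrow> mgraph \<Rightarrow> complex" where
  "partition_function k l h G =
    (of_nat k - of_nat (2 * l)) ^ circles G *
    (\<Sum>F | eulerian G F.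
       let (I, \<kappa>) = chosen_pairing G F in
       (-1) ^ num_circuits G I \<kappa> *
       (\<Sum>\<psi> \<in> (edges G - F) \<rightarrow>\<^sub>E {1..k}. \<Sum>\<phi> \<in> F \<rightarrow>\<^sub>E {1..2 * l}.
          \<Prod>v\<in>verts G. vertex_weight l h G F I \<kappa> \<psi> \<phi> v))"

definition is_model :: "(mgraph \<Rightarrow> complex) \<Rightarrow> nat \<Rightarrow> nat \<Rightarrow> functional \<Rightarrow> bool" where
  "is_model f k l h \<longleftrightarrow> (\<forall>G. is_graph G \<longrightarrow> f G = partition_function k l h G)"

definition dimension_pairs :: "(mgraph \<Rightarrow> complex) \<Rightarrow> (nat \<times> nat) set" where
  "dimension_pairs f = {(k, 2 * l) | k l. \<exists>h. is_model f k l h}"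

definition is_minimal_model :: "(mgraph \<Rightarrow> complex) \<Rightarrow> nat \<Rightarrow> nat \<Rightarrow> functional \<Rightarrow> bool" where
  "is_minimal_model f k l h \<longleftrightarrow>
     is_model f k l h \<and> (\<forall>k' l' h'. is_model f k' l' h' \<longrightarrow> k + 2 * l \<le> k' + 2 * l')"


section \<open>The functional of the characteristic polynomial\<close>

text \<open>The value \<open>-1\<close> at \<open>\<xi>\<^sub>1 \<and> \<xi>\<^sub>2\<close> means the value \<open>1\<close> at \<open>\<xi>\<^sub>1 \<and> \<eta>\<^sub>1 = - \<xi>\<^sub>1 \<and> \<xi>\<^sub>2\<close>.\<close>

definition h_theta :: "complex \<Rightarrow> functional" where
  "h_theta \<theta> M S =
    (if S = {} \<and> (\<exists>i. M = replicate_mset i 1) then \<theta>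
     else if S = {} \<and> (\<exists>i. M = replicate_mset i 1 + {#2#}) then \<i>
     else if S = {1, 2} \<and> (\<exists>i. M = replicate_mset i 1) then -1
     else 0)"

lemma h_theta_values:
  "pairs_value 1 (h_theta \<theta>) (replicate_mset i 1) [] = \<theta>"
  "pairs_value 1 (h_theta \<theta>) (replicate_mset i 1 + {#2#}) [] = \<i>"
  "pairs_value 1 (h_theta \<theta>) (replicate_mset i 1) [(1, 1)] = 1"
proof -
  have no2: "replicate_mset i 1 + {#2#} \<noteq> replicate_mset j (1::nat)" for j
  proof
    assume "replicate_mset i 1 + {#2#} = replicate_mset j (1::nat)"
    from arg_cong[OF this, of "\<lambda>M. count M 2"] show False by (simp add: count_replicate_mset)
  qed
  have inv0: "inversions [] = {}" and inv2: "inversions [1, 2] = {}"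
    by (auto simp: inversions_def less_Suc_eq nth_Cons')
  show "pairs_value 1 (h_theta \<theta>) (replicate_mset i 1) [] = \<theta>"
    by (auto simp: pairs_value_def wedge_value_def h_theta_def inv0)
  show "pairs_value 1 (h_theta \<theta>) (replicate_mset i 1 + {#2#}) [] = \<i>"
    using no2 by (auto simp: pairs_value_def wedge_value_def h_theta_def inv0)
  show "pairs_value 1 (h_theta \<theta>) (replicate_mset i 1) [(1, 1)] = 1"
    using inv2 by (auto simp: pairs_value_def wedge_value_def h_theta_def eta_sign_def
        eta_index_def numeral_2_eq_2)
qed

end

theory Submission
  imports Defs "HOL-Real_Asymp.Real_Asymp"
begin

text \<open>
  The proof rests on the identity that the partition function of \<open>h(\<theta>)\<close> is \<open>det(\<theta>I - A)\<close> on graphs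
  without free circles and 0 on the others (\<open>partition_function_char_det\<close>). Expanding the determinant
  by rows gives a sum over sets of arcs, an arc being an edge with a direction, in which at each vertex
  as many arcs arrive as leave, and at most one. An edge carries no arc, both arcs, or one of its
  two arcs; these four possibilities are the even colours 1 and 2 and the two odd colours, and the terms
  agree one by one. The same holds when \<open>h(\<theta>)\<close> is transported to \<open>\<complex>\<^sup>k\<close> and \<open>\<complex>\<^bsub>2l\<^esub>\<close> with value zero on all
  further colours, except that a free circle then has value \<open>k - 2l\<close>. With \<open>k = 2l\<close> this is a
  model of \<open>f\<close>, so all pairs \<open>(2 + 2r, 2 + 2r)\<close> occur. Conversely the value 0 of the free circle forces \<open>k = 2l\<close>,
  and a model without colours is excluded by the values at a loop and at an edge
  (\<open>model_dimensions\<close>). Minimality follows.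

  For the upper bound on the connection ranks, the vertices at the open ends are kept in the determinant of the
  disjoint union of two fragments, linked by additional entries. Gluing two open ends is an
  elimination step in this determinant (\<open>link_det_glue_ends\<close>). Multilinearity in the labelled rows then writes
  \<open>f(F * G)\<close> as a sum over states \<open>(S, T)\<close>, pairs of equally large sets of labels, of
  \<open>\<plusminus>(-1) ^ card S\<close> times a minor of \<open>F\<close> times the corresponding minor of \<open>G\<close> (\<open>glue_state_sum\<close>). There are at most
  \<open>4\<^sup>t\<close> states, so the rank is at most \<open>4\<^sup>t\<close>.

  For the lower bound, the minors are computed for fragments in which some labels are joined in pairs by edges and every
  other label hangs on a vertex with or without a loop (\<open>state_value_matching\<close>). A state is a word with the
  letters \<open>(i \<in> S, i \<in> T)\<close>: two parentheses and two neutral letters. For every word of length \<open>n\<close> with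
  balanced parentheses, some linear combination of such fragments is supported on the states that arise from
  this word by interchanging the parentheses within matched pairs (\<open>spanned_word_vector\<close>). An interchange moves
  an opening parenthesis to the right, so these vectors are triangular and hence independent
  (\<open>word_vector_triangular\<close>). They are real, and \<open>card S\<close> is constant on the support of each, so the
  diagonal form with entries \<open>\<plusminus>(-1) ^ card S\<close> is nondegenerate on their span and the rank is at least the
  number of words (\<open>connection_rank_ge\<close>). This number is \<open>C(2n,n) - C(2n,n+2)\<close>, which is \<open>4\<^sup>n\<close>
  up to a polynomial factor, so the roots of the ranks tend to 4, and 4 is also their supremum.
\<close>

section \<open>Determinants over finite index sets\<close>

text \<open>
  Rows and columns are indexed by a finite set rather than by an initial segment of the naturals, so
  that vertices of a graph can be deleted, relabelled and split into two sides without renumbering.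
\<close>

definition det_on :: "'a set \<Rightarrow> ('a \<Rightarrow> 'a \<Rightarrow> complex) \<Rightarrow> complex" where
  "det_on V A = (\<Sum>p | p permutes V. of_int (sign p) * (\<Prod>x\<in>V. A x (p x)))"

lemma det_on_cong:
  assumes "\<And>x y. x \<in> V \<Longrightarrow> y \<in> V \<Longrightarrow> A x y = B x y"
  shows "det_on V A = det_on V B"
  unfolding det_on_def
  by (intro sum.cong refl arg_cong2[where f = "(*)"] prod.cong)
     (use assms in \<open>auto simp: permutes_in_image\<close>)

lemma det_on_image:
  assumes "finite V" "inj_on g V"
  shows "det_on (g ` V) A = det_on V (\<lambda>x y. A (g x) (g y))"
  unfolding det_on_def
proof (rule sum.reindex_bij_witness[of _ "map_permutation V g" "map_permutation (g ` V) (inv_into V g)"])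
  fix p assume p: "p \<in> {p. p permutes g ` V}"
  have bij: "bij_betw (inv_into V g) (g ` V) V" "bij_betw g V (g ` V)"
    using assms(2) by (auto intro: bij_betw_inv_into inj_on_imp_bij_betw)
  define q where "q = map_permutation (g ` V) (inv_into V g) p"
  have q: "q permutes V"
    unfolding q_def by (rule map_permutation_permutes[OF bij(1)]) (use p in auto)
  show eq: "map_permutation V g (map_permutation (g ` V) (inv_into V g) p) = p"
    by (rule map_permutation_compose_inv[OF bij(1)]) (use p in \<open>auto simp: f_inv_into_f\<close>)
  show "map_permutation (g ` V) (inv_into V g) p \<in> {p. p permutes V}"
    using q by (simp add: q_def)
  have "sign p = sign q"
    using sign_map_permutation[OF assms(2) q assms(1)] eq by (simp add: q_def)
  moreover have "p (g x) = g (q x)" if "x \<in> V" for x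
    using map_permutation_apply[OF assms(2) that, of q] eq by (simp add: q_def)
  ultimately show "of_int (sign (map_permutation (g ` V) (inv_into V g) p)) *
      (\<Prod>x\<in>V. A (g x) (g (map_permutation (g ` V) (inv_into V g) p x))) =
      of_int (sign p) * (\<Prod>x\<in>g ` V. A x (p x))"
    by (simp add: prod.reindex[OF assms(2)] flip: q_def)
next
  fix p assume p: "p \<in> {p. p permutes V}"
  have bij: "bij_betw (inv_into V g) (g ` V) V" "bij_betw g V (g ` V)"
    using assms(2) by (auto intro: bij_betw_inv_into inj_on_imp_bij_betw)
  show "map_permutation V g p \<in> {p. p permutes g ` V}"
    using map_permutation_permutes[OF bij(2)] p by simp
  show "map_permutation (g ` V) (inv_into V g) (map_permutation V g p) = p"
    by (rule map_permutation_compose_inv[OF bij(2)]) (use p assms in auto)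
qed

lemma det_on_permute_rows:
  assumes "finite V" "q permutes V"
  shows "det_on V (\<lambda>x. A (q x)) = of_int (sign q) * det_on V A"
proof -
  have "det_on V (\<lambda>x. A (q x)) =
      (\<Sum>p | p permutes V. of_int (sign (p \<circ> q)) * (\<Prod>x\<in>V. A (q x) ((p \<circ> q) x)))"
    unfolding det_on_def by (rule sum_permutations_compose_right[OF assms(2)])
  also have "\<dots> = (\<Sum>p | p permutes V. of_int (sign q) * (of_int (sign p) * (\<Prod>x\<in>V. A x (p x))))"
  proof (rule sum.cong, goal_cases)
    case (2 p)
    have "(\<Prod>x\<in>V. A (q x) ((p \<circ> q) x)) = (\<Prod>x\<in>V. A x (p x))"
      using prod.permute[OF assms(2), of "\<lambda>x. A x (p x)"] by (simp add: o_def)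
    moreover have "sign (p \<circ> q) = sign p * sign q"
      using 2 assms by (intro sign_compose permutes_imp_permutation[of V]) auto
    ultimately show ?case by simp
  qed simp
  finally show ?thesis by (simp add: det_on_def sum_distrib_left)
qed

lemma det_on_equal_rows:
  assumes "finite V" "u \<in> V" "v \<in> V" "u \<noteq> v" "\<And>y. y \<in> V \<Longrightarrow> A u y = A v y"
  shows "det_on V A = 0"
proof -
  have "det_on V A = det_on V (\<lambda>x. A (transpose u v x))"
    by (rule det_on_cong) (use assms(5) in \<open>auto simp: transpose_def\<close>)
  also have "\<dots> = - det_on V A"
    using assms by (subst det_on_permute_rows) (auto simp: permutes_swap_id sign_swap_id)
  finally show ?thesis by simp
qed

lemma det_on_zero_row:
  assumes "finite V" "u \<in> V" "\<And>y. y \<in> V \<Longrightarrow> A u y = 0"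
  shows "det_on V A = 0"
  unfolding det_on_def
proof (intro sum.neutral ballI)
  fix p assume "p \<in> {p. p permutes V}"
  then have "A u (p u) = 0" using assms by (simp add: permutes_in_image)
  then show "of_int (sign p) * (\<Prod>x\<in>V. A x (p x)) = 0"
    using assms by (auto intro!: prod_zero)
qed

text \<open>
  A sum of two matrices is expanded in all rows at once; \<open>W\<close> collects the rows in which the first
  summand is taken.
\<close>

lemma det_on_add:
  assumes "finite V"
  shows "det_on V (\<lambda>x y. A x y + B x y) =
    (\<Sum>W\<in>Pow V. det_on V (\<lambda>x y. if x \<in> W then A x y else B x y))"
proof -
  have "det_on V (\<lambda>x y. A x y + B x y) = (\<Sum>p | p permutes V. \<Sum>W\<in>Pow V.
      of_int (sign p) * ((\<Prod>x\<in>W. A x (p x)) * (\<Prod>x\<in>V - W. B x (p x))))"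
    unfolding det_on_def by (simp add: prod_add[OF assms] sum_distrib_left)
  also have "\<dots> = (\<Sum>W\<in>Pow V. \<Sum>p | p permutes V.
      of_int (sign p) * ((\<Prod>x\<in>W. A x (p x)) * (\<Prod>x\<in>V - W. B x (p x))))"
    by (rule sum.swap)
  also have "\<dots> = (\<Sum>W\<in>Pow V. det_on V (\<lambda>x y. if x \<in> W then A x y else B x y))"
    unfolding det_on_def
  proof (intro sum.cong refl arg_cong2[where f = "(*)"])
    fix W p assume "W \<in> Pow V"
    then have V: "W \<union> (V - W) = V" and W: "finite W" using assms finite_subset by auto
    then have "(\<Prod>x\<in>V. if x \<in> W then A x (p x) else B x (p x)) =
        (\<Prod>x\<in>W. if x \<in> W then A x (p x) else B x (p x)) *
        (\<Prod>x\<in>V - W. if x \<in> W then A x (p x) else B x (p x))"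
      by (subst V[symmetric], subst prod.union_disjoint) (use W assms in auto)
    then show "(\<Prod>x\<in>W. A x (p x)) * (\<Prod>x\<in>V - W. B x (p x)) =
        (\<Prod>x\<in>V. if x \<in> W then A x (p x) else B x (p x))" by simp
  qed
  finally show ?thesis .
qed

lemma det_on_row_add:
  assumes "finite V" "w \<in> V"
  shows "det_on V (\<lambda>x y. if x = w then B y + C y else A x y) =
    det_on V (\<lambda>x y. if x = w then B y else A x y) + det_on V (\<lambda>x y. if x = w then C y else A x y)"
proof -
  have *: "(\<Prod>x\<in>V. if x = w then D (p x) else A x (p x)) = D (p w) * (\<Prod>x\<in>V - {w}. A x (p x))" for D p
    using assms by (subst prod.remove[of _ w]) (auto intro!: prod.cong)
  show ?thesis
    unfolding det_on_def using *[of "\<lambda>y. B y + C y"] *[of B] *[of C]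
    by (simp add: algebra_simps sum.distrib)
qed

lemma det_on_add_row:
  assumes "finite V" "w \<in> V" "v \<in> V" "v \<noteq> w"
  shows "det_on V (\<lambda>x y. if x = w then A w y + A v y else A x y) = det_on V A"
proof -
  have "det_on V (\<lambda>x y. if x = w then A v y else A x y) = 0"
    by (rule det_on_equal_rows[OF assms(1,2,3)]) (use assms in auto)
  moreover have "det_on V (\<lambda>x y. if x = w then A w y else A x y) = det_on V A"
    by (rule det_on_cong) simp
  ultimately show ?thesis using det_on_row_add[OF assms(1,2), of "A w" "A v" A] by simp
qed

lemma det_on_transpose:
  assumes "finite V"
  shows "det_on V (\<lambda>x y. A y x) = det_on V A"
proof -
  have "det_on V (\<lambda>x y. A y x) = (\<Sum>p | p permutes V. of_int (sign (Hilbert_Choice.inv p)) * (\<Prod>x\<in>V. A (Hilbert_Choice.inv p x) x))"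
    unfolding det_on_def by (rule sum_permutations_inverse)
  also have "\<dots> = det_on V A"
    unfolding det_on_def
  proof (intro sum.cong refl arg_cong2[where f = "(*)"], goal_cases)
    case (1 p)
    then have "permutation p" using assms by (auto intro: permutes_imp_permutation)
    then show ?case by (simp add: sign_inverse)
  next
    case (2 p)
    then have p: "p permutes V" by simp
    show ?case
      using prod.permute[OF p, of "\<lambda>x. A (Hilbert_Choice.inv p x) x"] p by (simp add: o_def permutes_inverses)
  qed
  finally show ?thesis .
qed

text \<open>
  A permutation with a nonzero product sends no point of \<open>V\<close> into \<open>W\<close>, hence maps \<open>V\<close> to itself by
  finiteness and is a product of a permutation of \<open>V\<close> and one of \<open>W\<close>.
\<close>

lemma det_on_block:
  assumes fin: "finite V" "finite W" and disj: "V \<inter> W = {}"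
    and zero: "\<And>x y. x \<in> V \<Longrightarrow> y \<in> W \<Longrightarrow> A x y = 0"
  shows "det_on (V \<union> W) A = det_on V A * det_on W A"
proof -
  define f where "f = (\<lambda>p. of_int (sign p) * (\<Prod>x\<in>V \<union> W. A x (p x)))"
  define P where "P = {p. p permutes V} \<times> {q. q permutes W}"
  define h :: "('a \<Rightarrow> 'a) \<times> ('a \<Rightarrow> 'a) \<Rightarrow> 'a \<Rightarrow> 'a" where "h = (\<lambda>(p, q). p \<circ> q)"
  have val: "(p \<circ> q) x = (if x \<in> W then q x else p x)" if "p permutes V" "q permutes W" for p q x
  proof (cases "x \<in> W")
    case True
    then have "q x \<notin> V" using permutes_in_image[OF that(2), of x] disj by auto
    then show ?thesis using that True by (simp add: permutes_not_in)
  next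
    case False
    then show ?thesis using that by (simp add: permutes_not_in)
  qed
  have inj: "inj_on h P"
  proof (rule inj_onI)
    fix a b assume ab: "a \<in> P" "b \<in> P" "h a = h b"
    obtain p q p' q' where eq: "a = (p, q)" "b = (p', q')" by fastforce
    have perm: "p permutes V" "q permutes W" "p' permutes V" "q' permutes W"
      using ab eq by (auto simp: P_def)
    have e: "(p \<circ> q) x = (p' \<circ> q') x" for x using ab eq by (simp add: h_def)
    have "q x = q' x" for x
      using e[of x] val[OF perm(1,2), of x] val[OF perm(3,4), of x] perm by (cases "x \<in> W") (auto simp: permutes_not_in)
    moreover have "p x = p' x" for x
    proof (cases "x \<in> W")
      case True
      then have "x \<notin> V" using disj by auto
      then show ?thesis using perm by (simp add: permutes_not_in)
    next
      case False
      then show ?thesis using e[of x] val[OF perm(1,2), of x] val[OF perm(3,4), of x] by simp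
    qed
    ultimately show "a = b" using eq by auto
  qed
  have sub: "h ` P \<subseteq> {p. p permutes V \<union> W}"
  proof clarify
    fix p q assume "(p, q) \<in> P"
    then have "p permutes V \<union> W" "q permutes V \<union> W"
      using permutes_subset[of p V "V \<union> W"] permutes_subset[of q W "V \<union> W"] by (auto simp: P_def)
    then show "h (p, q) permutes V \<union> W" unfolding h_def by (simp add: permutes_compose)
  qed
  have out: "f p = 0" if p: "p permutes V \<union> W" "p \<notin> h ` P" for p
  proof (cases "\<exists>x\<in>V. p x \<in> W")
    case True
    then obtain x where "x \<in> V" "A x (p x) = 0" using zero by blast
    then have "(\<Prod>x\<in>V \<union> W. A x (p x)) = 0" using fin by (intro prod_zero) auto
    then show ?thesis by (simp add: f_def)
  next
    case False
    have pV: "p ` V \<subseteq> V"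
    proof clarify
      fix x assume x: "x \<in> V"
      then have "p x \<in> V \<union> W" using permutes_in_image[OF p(1), of x] by blast
      then show "p x \<in> V" using False x by auto
    qed
    have inj': "inj p" using p(1) permutes_inj by blast
    have pV': "p ` V = V" by (rule endo_inj_surj[OF fin(1) pV]) (use inj' in \<open>auto simp: inj_on_def inj_def\<close>)
    have W: "W = (V \<union> W) - V" using disj by auto
    have "p ` W = p ` (V \<union> W) - p ` V" by (subst W) (rule image_set_diff[OF inj'])
    then have pW: "p ` W = W" using pV' permutes_image[OF p(1)] W by simp
    define p1 where "p1 = (\<lambda>x. if x \<in> V then p x else x)"
    define p2 where "p2 = (\<lambda>x. if x \<in> W then p x else x)"
    have "p1 permutes V" "p2 permutes W"
      unfolding p1_def p2_def using pV' pW inj' fin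
      by (auto intro!: bij_imp_permutes simp: bij_betw_def inj_on_def inj_def)
    moreover have "p = p1 \<circ> p2"
    proof
      fix x show "p x = (p1 \<circ> p2) x"
        using val[OF \<open>p1 permutes V\<close> \<open>p2 permutes W\<close>, of x] p(1)
        by (auto simp: p1_def p2_def permutes_not_in)
    qed
    ultimately have "p \<in> h ` P" by (auto simp: h_def P_def image_iff)
    then show ?thesis using p by simp
  qed
  have "det_on (V \<union> W) A = sum f (h ` P)"
    unfolding det_on_def f_def[symmetric]
    by (rule sum.mono_neutral_right) (use sub out fin in \<open>auto simp: finite_permutations\<close>)
  also have "\<dots> = (\<Sum>a\<in>P. f (h a))" using inj by (simp add: sum.reindex)
  also have "\<dots> = (\<Sum>(p, q)\<in>P. (of_int (sign p) * (\<Prod>x\<in>V. A x (p x))) * (of_int (sign q) * (\<Prod>x\<in>W. A x (q x))))"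
  proof (rule sum.cong[OF refl], clarify)
    fix p q assume "(p, q) \<in> P"
    then have pq: "p permutes V" "q permutes W" by (auto simp: P_def)
    have "sign (p \<circ> q) = sign p * sign q"
      by (intro sign_compose permutes_imp_permutation[OF fin(1) pq(1)] permutes_imp_permutation[OF fin(2) pq(2)])
    moreover have "(\<Prod>x\<in>V \<union> W. A x ((p \<circ> q) x)) = (\<Prod>x\<in>V. A x (p x)) * (\<Prod>x\<in>W. A x (q x))"
      unfolding prod.union_disjoint[OF fin disj]
      by (intro arg_cong2[where f = "(*)"] prod.cong refl) (use val[OF pq] disj in auto)
    ultimately show "f (h (p, q)) = (of_int (sign p) * (\<Prod>x\<in>V. A x (p x))) * (of_int (sign q) * (\<Prod>x\<in>W. A x (q x)))"
      by (simp add: f_def h_def)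
  qed
  also have "\<dots> = det_on V A * det_on W A"
    unfolding det_on_def P_def by (simp add: sum_product sum.cartesian_product)
  finally show ?thesis .
qed

text \<open>
  Each row allows a single column, so the only permutation that can contribute is \<open>g\<close> itself.
\<close>

lemma det_on_monomial:
  assumes "finite V"
  shows "det_on V (\<lambda>x y. if y = g x then w x else 0) =
    (\<Prod>x\<in>V. w x) * (if bij_betw g V V then of_int (sign_on V g) else 0)"
proof -
  define q where "q = restrict_id g V"
  have eq: "p = q" if "p permutes V" "\<forall>x\<in>V. p x = g x" for p
    using that by (auto simp: q_def restrict_id_def fun_eq_iff permutes_not_in)
  have z: "(\<Prod>x\<in>V. if p x = g x then w x else 0) = 0" if "p permutes V" "p \<noteq> q" for p
    using eq[OF that(1)] that(2) assms by (auto intro!: prod_zero)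
  show ?thesis
  proof (cases "bij_betw g V V")
    case True
    then have q: "q permutes V" by (simp add: q_def permutes_restrict_id)
    have "det_on V (\<lambda>x y. if y = g x then w x else 0) =
        (\<Sum>p\<in>{q}. of_int (sign p) * (\<Prod>x\<in>V. if p x = g x then w x else 0))"
      unfolding det_on_def
      by (rule sum.mono_neutral_right) (use q z assms in \<open>auto simp: finite_permutations\<close>)
    also have "\<dots> = of_int (sign_on V g) * (\<Prod>x\<in>V. w x)"
      by (simp add: q_def sign_on_def)
    finally show ?thesis using True by simp
  next
    case False
    have "\<not> q permutes V"
    proof
      assume "q permutes V"
      then have "bij_betw q V V" by (rule permutes_imp_bij)
      then have "bij_betw g V V" by (subst bij_betw_cong[of _ _ q]) (auto simp: q_def)
      with False show False by simp
    qed
    then have "det_on V (\<lambda>x y. if y = g x then w x else 0) = 0"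
      unfolding det_on_def by (intro sum.neutral) (use z in auto)
    then show ?thesis using False by simp
  qed
qed

text \<open>
  Here every row is a sum of multiples of unit vectors, and multilinearity turns the determinant into
  a sum over the choices of one summand in each row. This is how determinants become sums over
  combinatorial configurations below.
\<close>

lemma det_on_choice:
  assumes "finite V" "\<And>x. x \<in> V \<Longrightarrow> finite (C x)"
  shows "det_on V (\<lambda>x y. \<Sum>c\<in>C x. if y = g x c then w x c else 0) =
    (\<Sum>c\<in>PiE V C. (\<Prod>x\<in>V. w x (c x)) *
       (if bij_betw (\<lambda>x. g x (c x)) V V then of_int (sign_on V (\<lambda>x. g x (c x))) else 0))"
proof -
  have "det_on V (\<lambda>x y. \<Sum>c\<in>C x. if y = g x c then w x c else 0) =
    (\<Sum>p | p permutes V. \<Sum>c\<in>PiE V C. of_int (sign p) * (\<Prod>x\<in>V. if p x = g x (c x) then w x (c x) else 0))"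
    unfolding det_on_def by (simp add: prod_sum_PiE[OF assms] sum_distrib_left)
  also have "\<dots> = (\<Sum>c\<in>PiE V C. det_on V (\<lambda>x y. if y = g x (c x) then w x (c x) else 0))"
    unfolding det_on_def by (rule sum.swap)
  finally show ?thesis by (simp add: det_on_monomial[OF assms(1)])
qed

text \<open>
  Interchanging rows \<open>u\<close> and \<open>v\<close> puts an identity block on \<open>{u, v}\<close>; the interchange is the sign.
\<close>

lemma det_on_eliminate_pair:
  assumes fin: "finite V" and uv: "u \<in> V" "v \<in> V" "u \<noteq> v"
    and colu: "\<And>x. x \<in> V \<Longrightarrow> A u x = (if x = v then 1 else 0)"
    and colv: "\<And>x. x \<in> V \<Longrightarrow> A v x = (if x = u then 1 else 0)"
  shows "det_on V A = - det_on (V - {u, v}) A"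
proof -
  define B where "B = (\<lambda>x. A (transpose u v x))"
  have Bu: "B u x = (if x = u then 1 else 0)" "B v x = (if x = v then 1 else 0)" if "x \<in> V" for x
    using colu[OF that] colv[OF that] by (auto simp: B_def)
  have V: "{u, v} \<union> (V - {u, v}) = V" using uv by auto
  have "- det_on V A = det_on V B"
    unfolding B_def using assms by (subst det_on_permute_rows) (auto simp: permutes_swap_id sign_swap_id)
  also have "\<dots> = det_on ({u, v} \<union> (V - {u, v})) B" using V by simp
  also have "\<dots> = det_on {u, v} B * det_on (V - {u, v}) B"
    by (rule det_on_block) (use fin Bu uv in auto)
  also have "det_on {u, v} B = det_on {u, v} (\<lambda>x y. if y = x then 1 else 0)"
    by (rule det_on_cong) (use Bu uv in auto)
  also have "\<dots> = 1" by (subst det_on_monomial) (auto simp: bij_betw_def)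
  also have "det_on (V - {u, v}) B = det_on (V - {u, v}) A"
    by (rule det_on_cong) (auto simp: B_def transpose_def)
  finally have "- det_on V A = det_on (V - {u, v}) A" by simp
  then show ?thesis unfolding minus_equation_iff[of "det_on V A"] by (rule sym)
qed

section \<open>Signs of permutations\<close>

text \<open>
  Cutting one point \<open>a\<close> out of its cycle is multiplication by the transposition of \<open>a\<close> and \<open>p a\<close>.
  If \<open>a\<close> is fixed, both the point and its orbit disappear; otherwise the sign and the number of
  points change while the orbits only lose the point \<open>a\<close>.
\<close>

lemma sign_orbits:
  assumes "finite V" "p permutes V"
  shows "sign p = (-1) ^ (card V + card (orbit p ` V))"
  using assms
proof (induction V arbitrary: p rule: finite_induct)
  case empty
  then show ?case by simp
next
  case (insert a S)
  define q where "q = transpose a (p a) \<circ> p"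
  have q: "q permutes S" using permutes_insert_lemma[OF insert.prems] by (simp add: q_def)
  have fin: "finite (insert a S)" using insert by simp
  have pp: "permutation p" by (rule permutes_imp_permutation[OF fin insert.prems])
  have pq: "permutation q" by (rule permutes_imp_permutation[OF insert.hyps(1) q])
  have p_eq: "p = transpose a (p a) \<circ> q" by (auto simp: q_def fun_eq_iff)
  have sgn: "sign p = (if p a = a then 1 else -1) * sign q"
    by (subst p_eq) (use pq in \<open>simp add: sign_compose permutation_swap_id sign_swap_id\<close>)
  have inj: "inj p" by (rule permutes_inj[OF insert.prems])
  show ?case
  proof (cases "p a = a")
    case True
    then have "q = p" by (simp add: q_def)
    have "orbit p a = {a}" using True by (simp add: orbit_eq_singleton_iff)
    moreover have "orbit p a \<notin> orbit p ` S"
    proof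
      assume "orbit p a \<in> orbit p ` S"
      then obtain s where "s \<in> S" "orbit p s = {a}" using \<open>orbit p a = {a}\<close> by auto
      moreover have "s \<in> orbit p s" by (rule permutation_self_in_orbit[OF pp])
      ultimately show False using insert.hyps by auto
    qed
    ultimately show ?thesis
      using insert.IH[OF q] insert.hyps unfolding \<open>q = p\<close> by simp
  next
    case False
    have paS: "p a \<in> S" using permutes_in_image[OF insert.prems, of a] False by auto
    have qz: "q z = (if p z = a then p a else p z)" if "z \<noteq> a" for z
    proof -
      have "p z \<noteq> p a" using that inj by (simp add: inj_eq)
      then show ?thesis by (simp add: q_def transpose_def)
    qed
    \<comment> \<open>\<open>q\<close> follows \<open>p\<close> but skips \<open>a\<close>, so its orbits are those of \<open>p\<close> with \<open>a\<close> removed.\<close>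
    have orb: "orbit p y \<inter> S = orbit q y" if y: "y \<in> S" for y
    proof
      have ya: "y \<noteq> a" using y insert.hyps by auto
      have "z \<in> orbit p y \<Longrightarrow> (z \<noteq> a \<longrightarrow> z \<in> orbit q y) \<and> (z = a \<longrightarrow> p a \<in> orbit q y)" for z
      proof (induction rule: orbit.induct)
        case base
        then show ?case using qz[OF ya] orbit.base[of q y] by auto
      next
        case (step z)
        show ?case
        proof (cases "z = a")
          case True
          then show ?thesis using step False by auto
        next
          case F: False
          then have "q z \<in> orbit q y" using step by (auto intro: orbit.step)
          then show ?thesis using qz[OF F] by auto
        qed
      qed
      then show "orbit p y \<inter> S \<subseteq> orbit q y" using insert.hyps by auto
      have "z \<in> orbit q y \<Longrightarrow> z \<in> S \<and> z \<in> orbit p y" for z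
      proof (induction rule: orbit.induct)
        case base
        have "q y \<in> S" using y q by (simp add: permutes_in_image)
        moreover have "q y \<in> orbit p y" using qz[OF ya]
          orbit.base[of p y] orbit.step[OF orbit.base, of p y] by (cases "p y = a") auto
        ultimately show ?case by simp
      next
        case (step z)
        then have "z \<noteq> a" using insert.hyps by auto
        moreover have "q z \<in> S" using step q by (simp add: permutes_in_image)
        moreover have "q z \<in> orbit p y" using qz[OF \<open>z \<noteq> a\<close>] step
          orbit.step[of z p y] orbit.step[of "p z" p y] by (cases "p z = a") auto
        ultimately show ?case by simp
      qed
      then show "orbit q y \<subseteq> orbit p y \<inter> S" by auto
    qed
    have "orbit p a = orbit p (p a)" using permutation_orbit_step[OF pp] by simp
    then have im: "orbit p ` insert a S = orbit p ` S" using paS by auto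
    have "inj_on (\<lambda>X. X \<inter> S) (orbit p ` S)"
    proof (rule inj_onI, clarify)
      fix y z assume yz: "y \<in> S" "z \<in> S" "orbit p y \<inter> S = orbit p z \<inter> S"
      have "y \<in> orbit p y" by (rule permutation_self_in_orbit[OF pp])
      then have "y \<in> orbit p z" using yz by auto
      then show "orbit p y = orbit p z"
        using orbit_cyclic_eq3[OF cyclic_on_orbit[OF insert.prems fin], of y z] by simp
    qed
    then have "card (orbit p ` S) = card ((\<lambda>X. X \<inter> S) ` orbit p ` S)" by (simp add: card_image)
    also have "(\<lambda>X. X \<inter> S) ` orbit p ` S = orbit q ` S" unfolding image_image by (rule image_cong) (use orb in auto)
    finally show ?thesis using insert.IH[OF q] insert.hyps sgn False im by simp
  qed
qed

lemma sign_involution: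
  assumes "finite V" "p permutes V" "\<And>x. x \<in> V \<Longrightarrow> p (p x) = x \<and> p x \<noteq> x"
  shows "even (card V) \<and> sign p = (-1) ^ (card V div 2)"
  using assms
proof (induction "card V" arbitrary: V p rule: less_induct)
  case less
  show ?case
  proof (cases "V = {}")
    case True
    then show ?thesis using less by simp
  next
    case False
    then obtain a where a: "a \<in> V" by auto
    define b where "b = p a"
    have b: "b \<in> V" "b \<noteq> a" "p b = a" using a less.prems by (auto simp: b_def permutes_in_image)
    define W where "W = V - {a, b}"
    define q where "q = p \<circ> transpose a b"
    have q: "q permutes W"
    proof (rule inj_imp_permutes)
      have inj: "inj p" using less.prems permutes_inj by blast
      then show "inj_on q W" by (auto simp: q_def W_def inj_on_def transpose_def dest: injD)
      show "finite W" using less.prems by (simp add: W_def)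
      show "q x \<in> W" if "x \<in> W" for x
        using that less.prems b inj by (auto simp: q_def W_def b_def permutes_in_image dest: injD)
      show "q x = x" if "x \<notin> W" for x
      proof (cases "x \<in> V")
        case True
        then show ?thesis using that b by (auto simp: q_def W_def b_def)
      next
        case False
        then have "x \<noteq> a" "x \<noteq> b" using a b by auto
        then show ?thesis using False less.prems(2) by (simp add: q_def permutes_not_in)
      qed
    qed
    have "card {a, b} = 2" using b by simp
    moreover have "card {a, b} \<le> card V" using a b less.prems(1) by (intro card_mono) auto
    ultimately have card: "card V = card W + 2" using a b by (simp add: W_def card_Diff_subset)
    have IH: "even (card W) \<and> sign q = (-1) ^ (card W div 2)"
    proof (rule less.hyps)
      show "card W < card V" using card by simp
      show "finite W" using less.prems by (simp add: W_def)
      show "q permutes W" by (rule q)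
      fix x assume x: "x \<in> W"
      have qx: "q x = p x" using x by (simp add: q_def W_def transpose_def)
      have "q x \<in> W" using x q by (simp add: permutes_in_image)
      then have "q (q x) = p (q x)" by (simp add: q_def W_def transpose_def)
      then show "q (q x) = x \<and> q x \<noteq> x" using qx less.prems(3)[of x] x by (simp add: W_def)
    qed
    have "p = q \<circ> transpose a b" by (auto simp: q_def fun_eq_iff)
    moreover have "permutation q" using q less.prems permutes_imp_permutation[of W q] by (simp add: W_def)
    ultimately have "sign p = - sign q" using b
      by (simp add: sign_compose permutation_swap_id sign_swap_id)
    then show ?thesis using IH card by simp
  qed
qed

section \<open>Graphs as involutions of half-edges\<close>

lemma edges_disjoint: "is_graph G \<Longrightarrow> disjoint (edges G)"
  and Union_edges: "is_graph G \<Longrightarrow> \<Union>(edges G) = halves G"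
  and card_edge: "is_graph G \<Longrightarrow> e \<in> edges G \<Longrightarrow> card e = 2"
  unfolding is_graph_def partition_on_def by blast+

lemma edge_of_eq:
  assumes "is_graph G" "e \<in> edges G" "a \<in> e"
  shows "edge_of G a = e"
  unfolding edge_of_def
proof (rule the_equality)
  fix d assume d: "d \<in> edges G \<and> a \<in> d"
  show "d = e"
  proof (rule ccontr)
    assume "d \<noteq> e"
    then have "d \<inter> e = {}" using disjointD[OF edges_disjoint[OF assms(1)]] d assms(2) by blast
    then show False using d assms(3) by blast
  qed
next
  show "e \<in> edges G \<and> a \<in> e" using assms by blast
qed

lemma edge_of_in:
  assumes "is_graph G" "a \<in> halves G"
  shows "edge_of G a \<in> edges G" "a \<in> edge_of G a"
proof -
  obtain e where e: "e \<in> edges G" "a \<in> e"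
    using assms(2) unfolding Union_edges[OF assms(1), symmetric] by blast
  then have "edge_of G a = e" using edge_of_eq[OF assms(1)] by blast
  then show "edge_of G a \<in> edges G" "a \<in> edge_of G a" using e by simp_all
qed

lemma edge_of_mate:
  assumes "is_graph G" "a \<in> halves G"
  shows "edge_of G a = {a, mate G a}" "mate G a \<noteq> a"
proof -
  have "card (edge_of G a) = 2" by (rule card_edge[OF assms(1) edge_of_in(1)[OF assms]])
  then obtain x y where xy: "edge_of G a = {x, y}" "x \<noteq> y" by (auto simp: card_2_iff)
  define b where "b = (if a = x then y else x)"
  have b: "edge_of G a = {a, b}" "b \<noteq> a" using xy edge_of_in(2)[OF assms] by (auto simp: b_def)
  have "mate G a = b" unfolding mate_def using b by (intro the_equality) (auto simp: doubleton_eq_iff)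
  then show "edge_of G a = {a, mate G a}" "mate G a \<noteq> a" using b by auto
qed

lemma edges_subset:
  assumes "is_graph G" "e \<in> edges G"
  shows "e \<subseteq> halves G" "e \<noteq> {}"
  using assms Union_edges[OF assms(1)] card_edge[OF assms] by auto

lemma mate_in:
  assumes "is_graph G" "a \<in> halves G"
  shows "mate G a \<in> halves G"
  using edges_subset[OF assms(1) edge_of_in(1)[OF assms]] edge_of_mate[OF assms] by auto

lemma edge_of_mate_eq:
  assumes "is_graph G" "a \<in> halves G"
  shows "edge_of G (mate G a) = edge_of G a"
  by (rule edge_of_eq[OF assms(1) edge_of_in(1)[OF assms]]) (simp add: edge_of_mate(1)[OF assms])

lemma mate_mate:
  assumes "is_graph G" "a \<in> halves G"
  shows "mate G (mate G a) = a"
  using edge_of_mate[OF assms] edge_of_mate[OF assms(1) mate_in[OF assms]] edge_of_mate_eq[OF assms]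
  by (auto simp: doubleton_eq_iff)

lemma edges_image:
  assumes "is_graph G"
  shows "edges G = (\<lambda>a. {a, mate G a}) ` halves G"
proof
  show "edges G \<subseteq> (\<lambda>a. {a, mate G a}) ` halves G"
  proof
    fix e assume e: "e \<in> edges G"
    then obtain a where a: "a \<in> e" "a \<in> halves G" using edges_subset[OF assms] by fastforce
    then have "e = {a, mate G a}" using edge_of_eq[OF assms e a(1)] edge_of_mate(1)[OF assms a(2)] by metis
    then show "e \<in> (\<lambda>a. {a, mate G a}) ` halves G" using a by auto
  qed
  show "(\<lambda>a. {a, mate G a}) ` halves G \<subseteq> edges G"
    using edge_of_in[OF assms] edge_of_mate[OF assms] by auto
qed

lemma finite_graph:
  assumes "is_graph G"
  shows "finite (verts G)" "finite (halves G)" "finite (edges G)"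
proof -
  show "finite (verts G)" "finite (halves G)" using assms by (auto simp: is_graph_def)
  then show "finite (edges G)" by (simp add: edges_image[OF assms])
qed

lemma inc_in: "is_graph G \<Longrightarrow> a \<in> halves G \<Longrightarrow> inc G a \<in> verts G"
  by (auto simp: is_graph_def)

text \<open>
  The edges of a graph are the orbits of a fixed-point-free involution of its half-edges. Building
  graphs from such an involution yields the well-formedness and the function \<open>mate\<close> at once.
\<close>

lemma graph_of_involution:
  assumes "finite (verts G)" "finite (halves G)" "\<And>a. a \<in> halves G \<Longrightarrow> inc G a \<in> verts G"
    and inv: "\<And>a. a \<in> halves G \<Longrightarrow> \<mu> a \<in> halves G \<and> \<mu> a \<noteq> a \<and> \<mu> (\<mu> a) = a"
    and E: "edges G = (\<lambda>a. {a, \<mu> a}) ` halves G"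
  shows "is_graph G" "\<And>a. a \<in> halves G \<Longrightarrow> mate G a = \<mu> a"
proof -
  have "partition_on (halves G) (edges G)"
  proof (rule partition_onI)
    fix p q assume pq: "p \<in> edges G" "q \<in> edges G" "p \<noteq> q"
    then obtain a b where "p = {a, \<mu> a}" "q = {b, \<mu> b}" "a \<in> halves G" "b \<in> halves G"
      using E by auto
    then show "disjnt p q" using pq(3) inv[of a] inv[of b] by (auto simp: disjnt_def)
  qed (use E inv in auto)
  then show G: "is_graph G"
    using assms by (auto simp: is_graph_def card_2_iff)
  fix a assume a: "a \<in> halves G"
  then have "{a, \<mu> a} \<in> edges G" using E by auto
  then have "edge_of G a = {a, \<mu> a}" by (rule edge_of_eq[OF G]) simp
  then show "mate G a = \<mu> a" using edge_of_mate[OF G a] inv[OF a] by (auto simp: doubleton_eq_iff)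
qed

text \<open>
  Half-edges are counted, not edges: a loop contributes 2 to the diagonal entry of its vertex.
\<close>

definition adj :: "mgraph \<Rightarrow> nat \<Rightarrow> nat \<Rightarrow> nat" where
  "adj G x y = card {a \<in> halves G. inc G a = x \<and> inc G (mate G a) = y}"

definition char_det :: "complex \<Rightarrow> mgraph \<Rightarrow> complex" where
  "char_det \<theta> G = det_on (verts G) (\<lambda>x y. (if x = y then \<theta> else 0) - of_nat (adj G x y))"

lemma adj_sym:
  assumes "is_graph G"
  shows "adj G x y = adj G y x"
proof -
  have "bij_betw (mate G) {a \<in> halves G. inc G a = x \<and> inc G (mate G a) = y}
      {a \<in> halves G. inc G a = y \<and> inc G (mate G a) = x}"
    by (rule bij_betw_byWitness[of _ "mate G"])
       (use mate_mate[OF assms] mate_in[OF assms] in auto)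
  then show ?thesis unfolding adj_def by (rule bij_betw_same_card)
qed

section \<open>Balanced orientations\<close>

lemma even_set_involution:
  assumes "finite A" "even (card A)"
  shows "\<exists>\<tau>. \<forall>a\<in>A. \<tau> a \<in> A \<and> \<tau> a \<noteq> a \<and> \<tau> (\<tau> a) = (a::'a)"
  using assms
proof (induction "card A" arbitrary: A rule: less_induct)
  case less
  show ?case
  proof (cases "A = {}")
    case False
    have "card A \<noteq> 0" "card A \<noteq> 1" using False less.prems by auto
    then have "card A \<ge> 2" by linarith
    then obtain C where "C \<subseteq> A" "card C = 2" using obtain_subset_with_card_n by metis
    then obtain a b where ab: "a \<in> A" "b \<in> A" "a \<noteq> b" by (auto simp: card_2_iff)
    define B where "B = A - {a, b}"
    have "card B = card A - 2" using ab less.prems(1) by (simp add: B_def card_Diff_subset)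
    then obtain \<tau> where \<tau>: "\<forall>x\<in>B. \<tau> x \<in> B \<and> \<tau> x \<noteq> x \<and> \<tau> (\<tau> x) = x"
      using less.hyps[of B] less.prems \<open>card A \<ge> 2\<close> by (auto simp: B_def)
    have "\<forall>x\<in>A. (\<tau>(a := b, b := a)) x \<in> A \<and> (\<tau>(a := b, b := a)) x \<noteq> x \<and>
        (\<tau>(a := b, b := a)) ((\<tau>(a := b, b := a)) x) = x"
    proof
      fix x assume "x \<in> A"
      show "(\<tau>(a := b, b := a)) x \<in> A \<and> (\<tau>(a := b, b := a)) x \<noteq> x \<and>
        (\<tau>(a := b, b := a)) ((\<tau>(a := b, b := a)) x) = x"
      proof (cases "x \<in> B")
        case True
        then show ?thesis using \<tau> by (auto simp: B_def)
      next
        case False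
        then show ?thesis using ab \<open>x \<in> A\<close> by (auto simp: B_def)
      qed
    qed
    then show ?thesis by blast
  qed simp
qed

text \<open>
  The edges of the two perfect matchings \<open>\<mu>\<close> and \<open>\<tau>\<close> form even closed walks, and colouring each of
  them alternately gives \<open>I\<close>. The induction avoids walks: it removes one \<open>\<mu>\<close>-edge \<open>{a, b}\<close> and
  reconnects the former \<open>\<tau>\<close>-partners \<open>c\<close> of \<open>a\<close> and \<open>d\<close> of \<open>b\<close> with each other.
\<close>

lemma alternating_colouring:
  assumes "finite S"
    and "\<forall>a\<in>S. \<mu> a \<in> S \<and> \<mu> a \<noteq> a \<and> \<mu> (\<mu> a) = (a::'a)"
    and "\<forall>a\<in>S. \<tau> a \<in> S \<and> \<tau> a \<noteq> a \<and> \<tau> (\<tau> a) = a"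
  shows "\<exists>I\<subseteq>S. \<forall>a\<in>S. (\<mu> a \<in> I \<longleftrightarrow> a \<notin> I) \<and> (\<tau> a \<in> I \<longleftrightarrow> a \<notin> I)"
  using assms
proof (induction "card S" arbitrary: S \<tau> rule: less_induct)
  case less
  show ?case
  proof (cases "S = {}")
    case False
    then obtain a where a: "a \<in> S" by auto
    define b where "b = \<mu> a"
    have b: "b \<in> S" "b \<noteq> a" "\<mu> b = a" using a less.prems by (auto simp: b_def)
    define S' where "S' = S - {a, b}"
    have card: "card S' < card S" unfolding S'_def using a less.prems(1) by (intro psubset_card_mono) auto
    have fin: "finite S'" using less.prems by (simp add: S'_def)
    have \<mu>': "\<forall>x\<in>S'. \<mu> x \<in> S' \<and> \<mu> x \<noteq> x \<and> \<mu> (\<mu> x) = x"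
    proof
      fix x assume x: "x \<in> S'"
      then have *: "\<mu> x \<in> S" "\<mu> x \<noteq> x" "\<mu> (\<mu> x) = x" using less.prems(2) by (auto simp: S'_def)
      then have "\<mu> x \<noteq> a" "\<mu> x \<noteq> b" using x b by (auto simp: S'_def b_def)
      then show "\<mu> x \<in> S' \<and> \<mu> x \<noteq> x \<and> \<mu> (\<mu> x) = x" using * by (simp add: S'_def)
    qed
    define c where "c = \<tau> a"
    define d where "d = \<tau> b"
    have cd: "c \<in> S" "c \<noteq> a" "\<tau> c = a" "d \<in> S" "d \<noteq> b" "\<tau> d = b"
      using a b less.prems(3) by (auto simp: c_def d_def)
    show ?thesis
    proof (cases "c = b")
      case True
      then have "d = a" using cd by (auto simp: d_def)
      have t1: "\<forall>x\<in>S'. \<tau> x \<in> S' \<and> \<tau> x \<noteq> x \<and> \<tau> (\<tau> x) = x"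
        using less.prems(3) True cd by (auto simp: S'_def)
      then obtain I where I: "I \<subseteq> S'" "\<forall>x\<in>S'. (\<mu> x \<in> I \<longleftrightarrow> x \<notin> I) \<and> (\<tau> x \<in> I \<longleftrightarrow> x \<notin> I)"
        using less.hyps[OF card fin \<mu>' t1] by (elim exE conjE)
      have "\<forall>x\<in>S. (\<mu> x \<in> insert a I \<longleftrightarrow> x \<notin> insert a I) \<and> (\<tau> x \<in> insert a I \<longleftrightarrow> x \<notin> insert a I)"
      proof
        fix x assume "x \<in> S"
        then consider "x = a" | "x = b" | "x \<in> S'" by (auto simp: S'_def)
        then show "(\<mu> x \<in> insert a I \<longleftrightarrow> x \<notin> insert a I) \<and> (\<tau> x \<in> insert a I \<longleftrightarrow> x \<notin> insert a I)"
        proof cases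
          case 1
          then have "\<mu> x = b" "\<tau> x = b" using True by (simp_all add: b_def c_def)
          then show ?thesis using I(1) b 1 by (auto simp: S'_def)
        next
          case 2
          then have "\<mu> x = a" "\<tau> x = a" using True b cd by simp_all
          then show ?thesis using I(1) b 2 by (auto simp: S'_def)
        next
          case 3
          have "\<mu> x \<in> S'" "\<tau> x \<in> S'" using bspec[OF \<mu>' 3] bspec[OF t1 3] by simp_all
          then have "\<mu> x \<noteq> a" "\<tau> x \<noteq> a" "x \<noteq> a" using 3 by (auto simp: S'_def)
          then show ?thesis using bspec[OF I(2) 3] by simp
        qed
      qed
      moreover have "insert a I \<subseteq> S" using I(1) a by (auto simp: S'_def)
      ultimately show ?thesis by (intro exI[of _ "insert a I"] conjI)
    next
      case False
      then have "d \<noteq> a" using cd by (auto simp: c_def)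
      have "c \<noteq> d" using cd b by auto
      have cdS: "c \<in> S'" "d \<in> S'" using cd False \<open>d \<noteq> a\<close> by (auto simp: S'_def)
      define \<tau>' where "\<tau>' = \<tau>(c := d, d := c)"
      have \<tau>S: "\<tau> x \<in> S'" if "x \<in> S'" "x \<noteq> c" "x \<noteq> d" for x
        using that less.prems(3) cd by (auto simp: S'_def c_def d_def)
      have \<tau>': "\<forall>x\<in>S'. \<tau>' x \<in> S' \<and> \<tau>' x \<noteq> x \<and> \<tau>' (\<tau>' x) = x"
      proof
        fix x assume x: "x \<in> S'"
        show "\<tau>' x \<in> S' \<and> \<tau>' x \<noteq> x \<and> \<tau>' (\<tau>' x) = x"
        proof (cases "x = c \<or> x = d")
          case True
          then show ?thesis using cdS \<open>c \<noteq> d\<close> by (auto simp: \<tau>'_def)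
        next
          case F: False
          have x': "x \<in> S" "x \<noteq> a" "x \<noteq> b" using x by (auto simp: S'_def)
          have "\<tau> x \<noteq> c" "\<tau> x \<noteq> d" using less.prems(3) x' cd by auto
          then show ?thesis using F \<tau>S[OF x] less.prems(3) x' by (auto simp: \<tau>'_def)
        qed
      qed
      obtain I where I: "I \<subseteq> S'" "\<forall>x\<in>S'. (\<mu> x \<in> I \<longleftrightarrow> x \<notin> I) \<and> (\<tau>' x \<in> I \<longleftrightarrow> x \<notin> I)"
        using less.hyps[OF card fin \<mu>' \<tau>'] by (elim exE conjE)
      have Icd: "d \<in> I \<longleftrightarrow> c \<notin> I" using bspec[OF I(2) cdS(1)] \<open>c \<noteq> d\<close> by (simp add: \<tau>'_def)
      define J where "J = (if c \<in> I then insert b I else insert a I)"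
      have ab: "a \<in> J \<longleftrightarrow> c \<notin> I" "b \<in> J \<longleftrightarrow> c \<in> I" using I(1) b by (auto simp: J_def S'_def)
      have J: "x \<in> J \<longleftrightarrow> x \<in> I" if "x \<in> S'" for x using that by (auto simp: J_def S'_def)
      have "\<forall>x\<in>S. (\<mu> x \<in> J \<longleftrightarrow> x \<notin> J) \<and> (\<tau> x \<in> J \<longleftrightarrow> x \<notin> J)"
      proof
        fix x assume "x \<in> S"
        then consider "x = a" | "x = b" | "x = c" | "x = d" | "x \<in> S'" "x \<noteq> c" "x \<noteq> d" by (auto simp: S'_def)
        then show "(\<mu> x \<in> J \<longleftrightarrow> x \<notin> J) \<and> (\<tau> x \<in> J \<longleftrightarrow> x \<notin> J)"
        proof cases
          case 1
          then have "\<mu> x = b" "\<tau> x = c" by (simp_all add: b_def c_def)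
          then show ?thesis using 1 ab J[OF cdS(1)] by simp
        next
          case 2
          then have "\<mu> x = a" "\<tau> x = d" using b by (simp_all add: d_def)
          then show ?thesis using 2 ab J[OF cdS(2)] Icd by simp
        next
          case 3
          have m: "\<mu> c \<in> S'" "\<mu> c \<in> I \<longleftrightarrow> c \<notin> I"
            using bspec[OF \<mu>' cdS(1)] bspec[OF I(2) cdS(1)] by simp_all
          show ?thesis unfolding 3 using J[OF cdS(1)] J[OF m(1)] m(2) ab cd(3) by simp
        next
          case 4
          have m: "\<mu> d \<in> S'" "\<mu> d \<in> I \<longleftrightarrow> d \<notin> I"
            using bspec[OF \<mu>' cdS(2)] bspec[OF I(2) cdS(2)] by simp_all
          show ?thesis unfolding 4 using J[OF cdS(2)] J[OF m(1)] m(2) ab cd(6) Icd by simp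
        next
          case 5
          then have "\<tau>' x = \<tau> x" by (simp add: \<tau>'_def)
          moreover have "\<mu> x \<in> S'" "\<mu> x \<in> I \<longleftrightarrow> x \<notin> I" "\<tau>' x \<in> I \<longleftrightarrow> x \<notin> I"
            using bspec[OF \<mu>' 5(1)] bspec[OF I(2) 5(1)] by simp_all
          ultimately show ?thesis using J[OF 5(1)] J[OF \<tau>S[OF 5]] J[of "\<mu> x"] by simp
        qed
      qed
      moreover have "J \<subseteq> S" using I(1) a b by (auto simp: S'_def J_def)
      ultimately show ?thesis by (intro exI[of _ J] conjI)
    qed
  next
    case True
    then show ?thesis by (intro exI[of _ "{}"]) simp
  qed
qed

text \<open>
  Evenness provides a pairing \<open>\<tau>\<close> of the half-edges of \<open>F\<close> at each vertex. A set \<open>I\<close> that alternates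
  along both \<open>mate\<close> and \<open>\<tau>\<close> contains one half of every edge and one half-edge of every local pair, so
  it is a balanced orientation and \<open>\<tau>\<close> is a local pairing for it.
\<close>

lemma eulerian_pairing_exists:
  assumes G: "is_graph G" and F: "eulerian G F"
  shows "\<exists>I \<kappa>. balanced_orientation G F I \<and> local_pairing G F I \<kappa>"
proof -
  define S where "S = \<Union>F"
  have FE: "F \<subseteq> edges G" using F by (simp add: eulerian_def)
  have Sh: "S \<subseteq> halves G" using FE edges_subset[OF G] by (auto simp: S_def)
  have finS: "finite S" using Sh finite_graph[OF G] finite_subset by blast
  have eF: "edge_of G a \<in> F" if "a \<in> S" for a
    using that edge_of_eq[OF G] FE by (auto simp: S_def)
  have mS: "mate G a \<in> S" if "a \<in> S" for a
    using eF[OF that] edge_of_mate[OF G, of a] that Sh by (auto simp: S_def)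
  have "\<forall>v\<in>verts G. \<exists>\<tau>. \<forall>a\<in>halves_at G v \<inter> S. \<tau> a \<in> halves_at G v \<inter> S \<and> \<tau> a \<noteq> a \<and> \<tau> (\<tau> a) = a"
  proof
    fix v assume "v \<in> verts G"
    then have "even (card (halves_at G v \<inter> S))" using F by (simp add: eulerian_def S_def)
    then show "\<exists>\<tau>. \<forall>a\<in>halves_at G v \<inter> S. \<tau> a \<in> halves_at G v \<inter> S \<and> \<tau> a \<noteq> a \<and> \<tau> (\<tau> a) = a"
      using finS by (intro even_set_involution) auto
  qed
  from bchoice[OF this] obtain T where T: "\<forall>v\<in>verts G. \<forall>a\<in>halves_at G v \<inter> S. T v a \<in> halves_at G v \<inter> S \<and> T v a \<noteq> a \<and> T v (T v a) = a"
    by (elim exE)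
  define \<tau> where "\<tau> = (\<lambda>a. T (inc G a) a)"
  have \<tau>: "\<tau> a \<in> S" "inc G (\<tau> a) = inc G a" "\<tau> a \<noteq> a" "\<tau> (\<tau> a) = a" if "a \<in> S" for a
  proof -
    have "inc G a \<in> verts G" "a \<in> halves_at G (inc G a) \<inter> S"
      using that Sh inc_in[OF G] by (auto simp: halves_at_def)
    then have *: "\<tau> a \<in> halves_at G (inc G a) \<inter> S" "\<tau> a \<noteq> a" "T (inc G a) (\<tau> a) = a"
      using T by (auto simp: \<tau>_def)
    then show "\<tau> a \<in> S" "inc G (\<tau> a) = inc G a" "\<tau> a \<noteq> a" by (auto simp: halves_at_def)
    then show "\<tau> (\<tau> a) = a" using * by (simp add: \<tau>_def)
  qed
  have mate_S: "\<forall>a\<in>S. mate G a \<in> S \<and> mate G a \<noteq> a \<and> mate G (mate G a) = a"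
    using mS edge_of_mate(2)[OF G] mate_mate[OF G] Sh by auto
  have \<tau>_S: "\<forall>a\<in>S. \<tau> a \<in> S \<and> \<tau> a \<noteq> a \<and> \<tau> (\<tau> a) = a" using \<tau> by auto
  obtain I where I: "I \<subseteq> S" "\<forall>a\<in>S. (mate G a \<in> I \<longleftrightarrow> a \<notin> I) \<and> (\<tau> a \<in> I \<longleftrightarrow> a \<notin> I)"
    using alternating_colouring[OF finS mate_S \<tau>_S] by blast
  have out: "\<tau> a \<in> S - I \<and> inc G (\<tau> a) = inc G a \<and> \<tau> a \<in> halves G \<and> \<tau> (\<tau> a) = a" if "a \<in> I" for a
  proof -
    have "a \<in> S" using that I(1) by blast
    then show ?thesis using bspec[OF I(2) \<open>a \<in> S\<close>] \<tau>[OF \<open>a \<in> S\<close>] that Sh by auto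
  qed
  have inw: "\<tau> a \<in> I \<and> inc G (\<tau> a) = inc G a \<and> \<tau> a \<in> halves G \<and> \<tau> (\<tau> a) = a" if "a \<in> S - I" for a
  proof -
    have "a \<in> S" using that by blast
    then show ?thesis using bspec[OF I(2) \<open>a \<in> S\<close>] \<tau>[OF \<open>a \<in> S\<close>] that Sh by auto
  qed
  have "balanced_orientation G F I"
    unfolding balanced_orientation_def
  proof (intro conjI ballI)
    show "I \<subseteq> \<Union>F" using I by (simp add: S_def)
    fix e assume e: "e \<in> F"
    then have "e \<noteq> {}" using edges_subset(2)[OF G] FE by auto
    then obtain a where a: "a \<in> e" by auto
    then have aS: "a \<in> S" using e by (auto simp: S_def)
    have "edge_of G a = e" by (rule edge_of_eq[OF G _ a]) (use e FE in auto)
    then have "e = {a, mate G a}"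
      using edge_of_mate(1)[OF G, of a] aS Sh by auto
    moreover have "mate G a \<in> I \<longleftrightarrow> a \<notin> I" using bspec[OF I(2) aS] by simp
    ultimately have "e \<inter> I = {if a \<in> I then a else mate G a}" by auto
    then show "card (e \<inter> I) = 1" by simp
  next
    fix v assume "v \<in> verts G"
    have "bij_betw \<tau> (halves_at G v \<inter> I) (halves_at G v \<inter> (S - I))"
      by (rule bij_betw_byWitness[of _ \<tau>])
         (use out inw in \<open>auto simp: halves_at_def\<close>)
    then show "card (halves_at G v \<inter> I) = card (halves_at G v \<inter> (\<Union>F - I))"
      unfolding S_def by (rule bij_betw_same_card)
  qed
  moreover have "local_pairing G F I \<tau>"
    unfolding local_pairing_def
  proof
    show "bij_betw \<tau> I (\<Union>F - I)"
      unfolding S_def[symmetric] by (rule bij_betw_byWitness[of _ \<tau>]) (use out inw in auto)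
  qed (use out in auto)
  ultimately show ?thesis by blast
qed

lemma chosen_pairing:
  assumes "is_graph G" "eulerian G F" "chosen_pairing G F = (I, \<kappa>)"
  shows "balanced_orientation G F I" "local_pairing G F I \<kappa>"
proof -
  have "case chosen_pairing G F of (I, \<kappa>) \<Rightarrow> balanced_orientation G F I \<and> local_pairing G F I \<kappa>"
    unfolding chosen_pairing_def
    by (rule someI_ex) (use eulerian_pairing_exists[OF assms(1,2)] in auto)
  then show "balanced_orientation G F I" "local_pairing G F I \<kappa>" using assms(3) by auto
qed

section \<open>The characteristic determinant as a sum over sets of arcs\<close>

text \<open>
  A half-edge \<open>a\<close> in \<open>X\<close> is read as an arc from \<open>inc G a\<close> to the other end of its edge. If no two
  arcs leave the same vertex, \<open>arc_map\<close> moves every vertex along the arc that leaves it and fixes the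
  vertices without such an arc.
\<close>

definition arc_map :: "mgraph \<Rightarrow> nat set \<Rightarrow> nat \<Rightarrow> nat" where
  "arc_map G X v = (if \<exists>a\<in>X. inc G a = v then inc G (mate G (THE a. a \<in> X \<and> inc G a = v)) else v)"

definition arc_term :: "complex \<Rightarrow> mgraph \<Rightarrow> nat set \<Rightarrow> complex" where
  "arc_term \<theta> G X =
    (if inj_on (inc G) X \<and> bij_betw (arc_map G X) (verts G) (verts G)
     then of_int (sign_on (verts G) (arc_map G X)) * (-1) ^ card X * \<theta> ^ (card (verts G) - card X) else 0)"

lemma the_arc:
  assumes "inj_on (inc G) X" "a \<in> X"
  shows "(THE b. b \<in> X \<and> inc G b = inc G a) = a"
  using assms by (auto simp: inj_on_def intro!: the_equality)

lemma arc_map_in: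
  assumes "inj_on (inc G) X" "a \<in> X"
  shows "arc_map G X (inc G a) = inc G (mate G a)"
  using the_arc[OF assms] assms(2) by (auto simp: arc_map_def)

lemma arc_map_out: "(\<And>a. a \<in> X \<Longrightarrow> inc G a \<noteq> v) \<Longrightarrow> arc_map G X v = v"
  by (auto simp: arc_map_def)

text \<open>
  Row \<open>v\<close> of \<open>\<theta>I - A\<close> is \<open>\<theta>\<close> times the unit vector at \<open>v\<close> minus one unit vector for each half-edge at
  \<open>v\<close>, at the other end of its edge. Choosing a half-edge in some of the rows is the same as choosing
  a set of arcs with distinct tails.
\<close>

lemma char_det_arcs:
  assumes G: "is_graph G"
  shows "char_det \<theta> G = (\<Sum>X\<in>Pow (halves G). arc_term \<theta> G X)"
proof -
  define V where "V = verts G"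
  \<comment> \<open>\<open>None\<close> stands for the diagonal summand \<open>\<theta>\<close>, \<open>Some a\<close> for the summand \<open>-1\<close> of the half-edge \<open>a\<close>.\<close>
  define C where "C = (\<lambda>v. insert None (Some ` halves_at G v))"
  define g where "g = (\<lambda>v c. case c of None \<Rightarrow> v | Some a \<Rightarrow> inc G (mate G a))"
  define w :: "nat \<Rightarrow> nat option \<Rightarrow> complex" where "w = (\<lambda>v c. case c of None \<Rightarrow> \<theta> | Some a \<Rightarrow> -1)"
  define S where "S = {X \<in> Pow (halves G). inj_on (inc G) X}"
  define ch where "ch = (\<lambda>X. \<lambda>v\<in>V. if \<exists>a\<in>X. inc G a = v then Some (THE a. a \<in> X \<and> inc G a = v) else None)"
  define T where "T = (\<lambda>c. (\<Prod>x\<in>V. w x (c x)) *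
       (if bij_betw (\<lambda>x. g x (c x)) V V then of_int (sign_on V (\<lambda>x. g x (c x))) else 0))"
  have finV: "finite V" and finH: "finite (halves G)" using finite_graph[OF G] by (auto simp: V_def)
  have finA: "finite (halves_at G v)" for v using finH by (simp add: halves_at_def)
  have row: "(if x = y then \<theta> else 0) - of_nat (adj G x y) = (\<Sum>c\<in>C x. if y = g x c then w x c else 0)" for x y
  proof -
    have "(\<Sum>c\<in>C x. if y = g x c then w x c else 0) =
        (if x = y then \<theta> else 0) + (\<Sum>a\<in>halves_at G x. if y = inc G (mate G a) then -1 else 0)"
      using finA unfolding C_def by (subst sum.insert) (auto simp: g_def w_def sum.reindex inj_on_def cong: if_cong)
    also have "(\<Sum>a\<in>halves_at G x. if y = inc G (mate G a) then -1 else 0) =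
        (\<Sum>a\<in>{a \<in> halves G. inc G a = x \<and> inc G (mate G a) = y}. (-1::complex))"
      using finA by (intro sum.mono_neutral_cong_right) (auto simp: halves_at_def)
    finally show ?thesis by (simp add: adj_def)
  qed
  have "char_det \<theta> G = (\<Sum>c\<in>PiE V C. T c)"
    unfolding char_det_def row V_def[symmetric] T_def
    by (rule det_on_choice[OF finV]) (simp add: C_def finA)
  also have "\<dots> = (\<Sum>X\<in>S. arc_term \<theta> G X)"
  proof (rule sum.reindex_bij_witness[of _ ch "\<lambda>c. {a \<in> halves G. c (inc G a) = Some a}"])
    fix c assume c: "c \<in> PiE V C"
    define X where "X = {a \<in> halves G. c (inc G a) = Some a}"
    have inj: "inj_on (inc G) X"
    proof (rule inj_onI)
      fix a b assume "a \<in> X" "b \<in> X" "inc G a = inc G b"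
      then have "Some a = Some b" unfolding X_def by (metis (mono_tags, lifting) mem_Collect_eq)
      then show "a = b" by simp
    qed
    moreover have "X \<subseteq> halves G" by (auto simp: X_def)
    ultimately show "{a \<in> halves G. c (inc G a) = Some a} \<in> S"
      unfolding X_def[symmetric] by (simp add: S_def)
    have chX: "ch X v = c v" for v
    proof (cases "v \<in> V")
      case True
      then have "c v \<in> C v" using c by auto
      then consider "c v = None" | a where "c v = Some a" "a \<in> halves G" "inc G a = v"
        by (auto simp: C_def halves_at_def)
      then show ?thesis
      proof cases
        case 1
        then show ?thesis using True by (auto simp: ch_def X_def)
      next
        case 2
        then have "a \<in> X" by (simp add: X_def)
        then show ?thesis using the_arc[OF inj, of a] 2 True by (auto simp: ch_def)
      qed
    next
      case False
      then show ?thesis using c by (auto simp: ch_def PiE_def extensional_def)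
    qed
    then show "ch {a \<in> halves G. c (inc G a) = Some a} = c" by (auto simp: X_def)
    have gc: "g v (c v) = arc_map G X v" if "v \<in> V" for v
      using that unfolding chX[symmetric] by (auto simp: ch_def g_def arc_map_def)
    have incX: "inc G ` X \<subseteq> V" using inc_in[OF G] by (auto simp: X_def V_def)
    have w1: "w v (c v) = (if v \<in> inc G ` X then -1 else \<theta>)" if "v \<in> V" for v
      using that unfolding chX[symmetric] by (auto simp: ch_def w_def)
    have "(\<Prod>x\<in>V. w x (c x)) = (\<Prod>x\<in>V. if x \<in> inc G ` X then -1 else \<theta>)"
      using w1 by (intro prod.cong) auto
    also have "\<dots> = (-1) ^ card (inc G ` X) * \<theta> ^ card (V - inc G ` X)"
      using finV incX by (simp add: prod.If_cases Int_absorb1 Diff_eq[symmetric])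
    also have "card (V - inc G ` X) = card V - card X"
      using finV incX card_image[OF inj] by (metis card_Diff_subset finite_subset)
    also have "card (inc G ` X) = card X" by (rule card_image[OF inj])
    finally have "(\<Prod>x\<in>V. w x (c x)) = (-1) ^ card X * \<theta> ^ (card V - card X)" .
    moreover have "bij_betw (\<lambda>x. g x (c x)) V V = bij_betw (arc_map G X) V V"
      using gc by (rule bij_betw_cong)
    moreover have "sign_on V (\<lambda>x. g x (c x)) = sign_on V (arc_map G X)"
      using gc by (rule sign_on_cong[OF refl])
    ultimately show "arc_term \<theta> G {a \<in> halves G. c (inc G a) = Some a} = T c"
      unfolding T_def arc_term_def V_def[symmetric] X_def[symmetric] using inj by simp
  next
    fix X assume "X \<in> S"
    then have X: "X \<subseteq> halves G" and inj: "inj_on (inc G) X" by (auto simp: S_def)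
    show "ch X \<in> PiE V C"
    proof
      fix v assume v: "v \<in> V"
      show "ch X v \<in> C v"
      proof (cases "\<exists>a\<in>X. inc G a = v")
        case True
        then obtain a where a: "a \<in> X" "inc G a = v" by auto
        then show ?thesis using the_arc[OF inj, of a] v X by (auto simp: ch_def C_def halves_at_def)
      qed (use v in \<open>auto simp: ch_def C_def\<close>)
    qed (auto simp: ch_def)
    show "{a \<in> halves G. ch X (inc G a) = Some a} = X"
    proof (intro Set.set_eqI iffI)
      fix a assume "a \<in> {a \<in> halves G. ch X (inc G a) = Some a}"
      then have a: "a \<in> halves G" "ch X (inc G a) = Some a" by auto
      then obtain b where b: "b \<in> X" "inc G b = inc G a" using inc_in[OF G a(1)]
        by (auto simp: ch_def V_def split: if_splits)
      then show "a \<in> X" using the_arc[OF inj b(1)] a inc_in[OF G a(1)]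
        by (auto simp: ch_def V_def split: if_splits)
    next
      fix a assume "a \<in> X"
      then show "a \<in> {a \<in> halves G. ch X (inc G a) = Some a}"
        using X inc_in[OF G, of a] the_arc[OF inj, of a] by (auto simp: ch_def V_def)
    qed
  qed
  also have "\<dots> = (\<Sum>X\<in>Pow (halves G). arc_term \<theta> G X)"
    using finH by (intro sum.mono_neutral_left) (auto simp: S_def arc_term_def)
  finally show ?thesis .
qed

definition arcs_out :: "mgraph \<Rightarrow> nat set \<Rightarrow> nat \<Rightarrow> nat set" where
  "arcs_out G X v = halves_at G v \<inter> X"

definition arcs_in :: "mgraph \<Rightarrow> nat set \<Rightarrow> nat \<Rightarrow> nat set" where
  "arcs_in G X v = {a \<in> halves_at G v. mate G a \<in> X}"

text \<open>
  The condition that a set of arcs contributes to the determinant is local: the arcs form vertex-disjoint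
  directed cycles, where an edge with both its arcs is a cycle of length two.
\<close>

lemma arc_map_bij_iff:
  assumes G: "is_graph G" and X: "X \<subseteq> halves G"
  shows "inj_on (inc G) X \<and> bij_betw (arc_map G X) (verts G) (verts G) \<longleftrightarrow>
    (\<forall>v\<in>verts G. card (arcs_out G X v) = card (arcs_in G X v) \<and> card (arcs_out G X v) \<le> 1)"
proof
  have fin: "finite (arcs_out G X v)" "finite (arcs_in G X v)" for v
    using finite_graph(2)[OF G] by (auto simp: arcs_out_def arcs_in_def halves_at_def)
  assume L: "inj_on (inc G) X \<and> bij_betw (arc_map G X) (verts G) (verts G)"
  then have inj: "inj_on (inc G) X" by simp
  have ginj: "inj_on (arc_map G X) (verts G)" and gsurj: "arc_map G X ` verts G = verts G"
    using L by (auto simp: bij_betw_def)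
  show "\<forall>v\<in>verts G. card (arcs_out G X v) = card (arcs_in G X v) \<and> card (arcs_out G X v) \<le> 1"
  proof
    fix v assume v: "v \<in> verts G"
    have o1: "a = b" if "a \<in> arcs_out G X v" "b \<in> arcs_out G X v" for a b
      using that inj by (auto simp: arcs_out_def halves_at_def inj_on_def)
    have i1: "a = b" if ab: "a \<in> arcs_in G X v" "b \<in> arcs_in G X v" for a b
    proof -
      have h: "a \<in> halves G" "b \<in> halves G" "mate G a \<in> X" "mate G b \<in> X" "inc G a = v" "inc G b = v"
        using ab by (auto simp: arcs_in_def halves_at_def)
      then have "arc_map G X (inc G (mate G a)) = arc_map G X (inc G (mate G b))"
        using arc_map_in[OF inj] mate_mate[OF G] by simp
      then have "inc G (mate G a) = inc G (mate G b)"
        using ginj inc_in[OF G] mate_in[OF G] h by (auto dest: inj_onD)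
      then have "mate G a = mate G b" using inj h by (auto dest: inj_onD)
      then show "a = b" using mate_mate[OF G] h by metis
    qed
    have eq: "arcs_out G X v = {} \<longleftrightarrow> arcs_in G X v = {}"
    proof
      assume o: "arcs_out G X v = {}"
      then have gv: "arc_map G X v = v" using X by (intro arc_map_out) (auto simp: arcs_out_def halves_at_def)
      show "arcs_in G X v = {}"
      proof (rule ccontr)
        assume "arcs_in G X v \<noteq> {}"
        then obtain a where a: "a \<in> halves G" "inc G a = v" "mate G a \<in> X" by (auto simp: arcs_in_def halves_at_def)
        then have "arc_map G X (inc G (mate G a)) = v" using arc_map_in[OF inj] mate_mate[OF G] by simp
        then have "inc G (mate G a) = v"
          using inj_onD[OF ginj, of "inc G (mate G a)" v] gv v inc_in[OF G mate_in[OF G a(1)]] by simp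
        then have "mate G a \<in> arcs_out G X v" using a mate_in[OF G a(1)] by (simp add: arcs_out_def halves_at_def)
        then show False using o by simp
      qed
    next
      assume i: "arcs_in G X v = {}"
      show "arcs_out G X v = {}"
      proof (rule ccontr)
        assume ne: "arcs_out G X v \<noteq> {}"
        have "v \<in> arc_map G X ` verts G" using gsurj v by simp
        then obtain w where w: "w \<in> verts G" "arc_map G X w = v" by (elim imageE) simp
        show False
        proof (cases "\<exists>a\<in>X. inc G a = w")
          case True
          then obtain a where a: "a \<in> X" "inc G a = w" by auto
          then have "inc G (mate G a) = v" using arc_map_in[OF inj] w by auto
          then have "mate G a \<in> arcs_in G X v"
            using a X mate_in[OF G] mate_mate[OF G] by (auto simp: arcs_in_def halves_at_def)
          then show False using i by auto
        next
          case False
          then have "arc_map G X w = w" by (intro arc_map_out) auto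
          then have "w = v" using w by simp
          then show False using False ne by (auto simp: arcs_out_def halves_at_def)
        qed
      qed
    qed
    have c: "card A = (if A = {} then 0 else 1)" if "finite A" "\<And>a b. a \<in> A \<Longrightarrow> b \<in> A \<Longrightarrow> a = b" for A :: "nat set"
    proof (cases "A = {}")
      case False
      then obtain x where "x \<in> A" by auto
      then have "A = {x}" using that(2) by blast
      then show ?thesis by simp
    qed simp
    show "card (arcs_out G X v) = card (arcs_in G X v) \<and> card (arcs_out G X v) \<le> 1"
      using c[OF fin(1) o1] c[OF fin(2) i1] eq by simp
  qed
next
  have fin: "finite (arcs_out G X v)" "finite (arcs_in G X v)" for v
    using finite_graph(2)[OF G] by (auto simp: arcs_out_def arcs_in_def halves_at_def)
  assume R: "\<forall>v\<in>verts G. card (arcs_out G X v) = card (arcs_in G X v) \<and> card (arcs_out G X v) \<le> 1"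
  have inj: "inj_on (inc G) X"
  proof (rule inj_onI)
    fix a b assume ab: "a \<in> X" "b \<in> X" "inc G a = inc G b"
    then have "a \<in> arcs_out G X (inc G a)" "b \<in> arcs_out G X (inc G a)" using X by (auto simp: arcs_out_def halves_at_def)
    moreover have "card (arcs_out G X (inc G a)) \<le> 1" using R inc_in[OF G] X ab by auto
    ultimately show "a = b" using fin by (metis card_le_Suc0_iff_eq One_nat_def)
  qed
  have "arc_map G X ` verts G = verts G"
  proof (intro subset_antisym subsetI)
    fix v assume "v \<in> arc_map G X ` verts G"
    then obtain w where w: "w \<in> verts G" "v = arc_map G X w" by auto
    show "v \<in> verts G"
    proof (cases "\<exists>a\<in>X. inc G a = w")
      case True
      then show ?thesis using w arc_map_in[OF inj] X inc_in[OF G] mate_in[OF G] by auto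
    next
      case False
      then show ?thesis using w arc_map_out[of X G w] by auto
    qed
  next
    fix v assume v: "v \<in> verts G"
    show "v \<in> arc_map G X ` verts G"
    proof (cases "arcs_out G X v = {}")
      case True
      then have "arc_map G X v = v" using X by (intro arc_map_out) (auto simp: arcs_out_def halves_at_def)
      then show ?thesis using v by force
    next
      case False
      then have "card (arcs_out G X v) \<noteq> 0" using fin by simp
      then have "card (arcs_in G X v) \<noteq> 0" using R v by auto
      then obtain a where a: "a \<in> arcs_in G X v" by fastforce
      then have "a \<in> halves G" "mate G a \<in> X" "inc G a = v" by (auto simp: arcs_in_def halves_at_def)
      then have "arc_map G X (inc G (mate G a)) = v" "inc G (mate G a) \<in> verts G"
        using arc_map_in[OF inj] mate_mate[OF G] mate_in[OF G] inc_in[OF G] by auto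
      then show ?thesis by force
    qed
  qed
  then show "inj_on (inc G) X \<and> bij_betw (arc_map G X) (verts G) (verts G)"
    using inj finite_graph(1)[OF G] by (simp add: bij_betw_def eq_card_imp_inj_on)
qed

text \<open>
  The edges traversed in exactly one direction. They form the part of \<open>X\<close> that is matched with the odd
  colours; an edge with both its arcs in \<open>X\<close> is matched with the even colour 2.
\<close>

definition split_edges :: "mgraph \<Rightarrow> nat set \<Rightarrow> nat set set" where
  "split_edges G X = {e \<in> edges G. e \<inter> X \<noteq> {} \<and> \<not> e \<subseteq> X}"

lemma edge_split_iff:
  assumes "is_graph G" "a \<in> halves G"
  shows "edge_of G a \<in> split_edges G X \<longleftrightarrow> (a \<in> X \<longleftrightarrow> mate G a \<notin> X)"
  using edge_of_in[OF assms] edge_of_mate[OF assms] by (auto simp: split_edges_def)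

lemma Union_split_iff:
  assumes "is_graph G"
  shows "a \<in> \<Union>(split_edges G X) \<longleftrightarrow> a \<in> halves G \<and> (a \<in> X \<longleftrightarrow> mate G a \<notin> X)"
proof
  assume "a \<in> \<Union>(split_edges G X)"
  then obtain e where e: "e \<in> split_edges G X" "a \<in> e" by auto
  then have eE: "e \<in> edges G" by (simp add: split_edges_def)
  then have "a \<in> halves G" "edge_of G a = e" using edges_subset[OF assms eE] edge_of_eq[OF assms eE] e by auto
  then show "a \<in> halves G \<and> (a \<in> X \<longleftrightarrow> mate G a \<notin> X)" using edge_split_iff[OF assms] e by auto
next
  assume a: "a \<in> halves G \<and> (a \<in> X \<longleftrightarrow> mate G a \<notin> X)"
  then show "a \<in> \<Union>(split_edges G X)" using edge_split_iff[OF assms, of a X] edge_of_in[OF assms, of a] by blast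
qed

definition doubles :: "mgraph \<Rightarrow> nat set \<Rightarrow> nat \<Rightarrow> nat set" where
  "doubles G X v = {a \<in> halves_at G v. a \<in> X \<and> mate G a \<in> X}"

lemma card_arcs_decomp:
  fixes X :: "nat set"
  assumes G: "is_graph G"
  defines "U \<equiv> \<Union>(split_edges G X)"
  shows "card (arcs_out G X v) = card (doubles G X v) + card (halves_at G v \<inter> U \<inter> X)"
    "card (arcs_in G X v) = card (doubles G X v) + card (halves_at G v \<inter> U - X)"
proof -
  have fin: "finite (halves_at G v)" using finite_graph(2)[OF G] by (simp add: halves_at_def)
  have h: "a \<in> halves G" if "a \<in> halves_at G v" for a using that by (simp add: halves_at_def)
  have U: "a \<in> U \<longleftrightarrow> a \<in> halves G \<and> (a \<in> X \<longleftrightarrow> mate G a \<notin> X)" for a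
    unfolding U_def by (rule Union_split_iff[OF G])
  have "arcs_out G X v = doubles G X v \<union> (halves_at G v \<inter> U \<inter> X)"
    using h by (auto simp: arcs_out_def doubles_def U)
  moreover have "doubles G X v \<inter> (halves_at G v \<inter> U \<inter> X) = {}" by (auto simp: doubles_def U)
  ultimately show "card (arcs_out G X v) = card (doubles G X v) + card (halves_at G v \<inter> U \<inter> X)"
    using fin by (simp add: card_Un_disjoint doubles_def)
  have "arcs_in G X v = doubles G X v \<union> (halves_at G v \<inter> U - X)"
    using h by (auto simp: arcs_in_def doubles_def U)
  moreover have "doubles G X v \<inter> (halves_at G v \<inter> U - X) = {}" by (auto simp: doubles_def U)
  ultimately show "card (arcs_in G X v) = card (doubles G X v) + card (halves_at G v \<inter> U - X)"
    using fin by (simp add: card_Un_disjoint doubles_def)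
qed

lemma arc_term_not_eulerian:
  assumes G: "is_graph G" and X: "X \<subseteq> halves G" and ne: "\<not> eulerian G (split_edges G X)"
  shows "arc_term \<theta> G X = 0"
proof (rule ccontr)
  assume "arc_term \<theta> G X \<noteq> 0"
  then have "inj_on (inc G) X \<and> bij_betw (arc_map G X) (verts G) (verts G)"
    by (auto simp: arc_term_def split: if_splits)
  then have R: "\<forall>v\<in>verts G. card (arcs_out G X v) = card (arcs_in G X v) \<and> card (arcs_out G X v) \<le> 1"
    using arc_map_bij_iff[OF G X] by blast
  have "even (card (halves_at G v \<inter> \<Union>(split_edges G X)))" if v: "v \<in> verts G" for v
  proof -
    define B where "B = halves_at G v \<inter> \<Union>(split_edges G X)"
    have fin: "finite B" using finite_graph(2)[OF G] by (simp add: B_def halves_at_def)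
    have "card B = card (B \<inter> X) + card (B - X)" using fin by (rule card_Int_Diff)
    moreover have "card (B \<inter> X) = card (B - X)"
      using card_arcs_decomp[OF G, of X v] R v by (simp add: B_def)
    ultimately show ?thesis by (simp add: B_def)
  qed
  then have "eulerian G (split_edges G X)" by (auto simp: eulerian_def split_edges_def)
  then show False using ne by simp
qed

section \<open>Local weights of the functional\<close>

text \<open>
  The functional \<open>h(\<theta>)\<close> transported to \<open>Sym \<complex>\<^sup>k \<otimes> \<Lambda> \<complex>\<^bsub>2l\<^esub>\<close>: the place of \<open>\<xi>\<^sub>1, \<xi>\<^sub>2\<close> is taken by
  \<open>\<xi>\<^sub>1\<close> and its partner \<open>\<xi>\<^bsub>l+1\<^esub>\<close>, and every monomial containing a further colour has value 0.
\<close>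

definition char_functional :: "nat \<Rightarrow> complex \<Rightarrow> functional" where
  "char_functional l \<theta> M S =
    (if S = {} \<and> (\<exists>i. M = replicate_mset i 1) then \<theta>
     else if S = {} \<and> (\<exists>i. M = replicate_mset i 1 + {#2#}) then \<i>
     else if S = {1, l + 1} \<and> (\<exists>i. M = replicate_mset i 1) then -1
     else 0)"

lemma char_functional_1: "char_functional 1 \<theta> = h_theta \<theta>"
  by (intro ext) (simp only: char_functional_def h_theta_def one_add_one)

lemma mset_two_colours:
  assumes "set_mset M \<subseteq> {1, 2::nat}"
  shows "M = replicate_mset (count M 1) 1 + replicate_mset (count M 2) 2"
proof (rule multiset_eqI)
  fix x
  show "count M x = count (replicate_mset (count M 1) 1 + replicate_mset (count M 2) 2) x"
  proof (cases "x = 1 \<or> x = 2")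
    case False
    then have "x \<notin># M" using assms by auto
    then show ?thesis using False by (auto simp: not_in_iff count_replicate_mset)
  qed (auto simp: count_replicate_mset)
qed

lemma only_ones_iff:
  assumes "set_mset M \<subseteq> {1, 2::nat}"
  shows "(\<exists>i. M = replicate_mset i 1) \<longleftrightarrow> count M 2 = 0"
    "(\<exists>i. M = replicate_mset i 1 + {#2#}) \<longleftrightarrow> count M 2 = 1"
proof -
  show "(\<exists>i. M = replicate_mset i 1) \<longleftrightarrow> count M 2 = 0"
  proof
    assume "count M 2 = 0"
    then show "\<exists>i. M = replicate_mset i 1" using mset_two_colours[OF assms] by auto
  qed (auto simp: count_replicate_mset)
  show "(\<exists>i. M = replicate_mset i 1 + {#2#}) \<longleftrightarrow> count M 2 = 1"
  proof
    assume "count M 2 = 1"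
    then have "M = replicate_mset (count M 1) 1 + {#2#}" using mset_two_colours[OF assms] by simp
    then show "\<exists>i. M = replicate_mset i 1 + {#2#}" by blast
  qed (auto simp: count_replicate_mset)
qed

lemma char_functional_nonzero:
  assumes "char_functional l \<theta> M S \<noteq> 0"
  shows "set_mset M \<subseteq> {1, 2}" "S = {} \<or> S = {1, l + 1}"
  using assms by (auto simp: char_functional_def split: if_splits dest: in_countE)

definition pair_word :: "nat \<Rightarrow> (nat \<times> nat) list \<Rightarrow> nat list" where
  "pair_word l ps = concat (map (\<lambda>(i, j). [i, eta_index l j]) ps)"

lemma length_pair_word: "length (pair_word l ps) = 2 * length ps"
  by (induction ps) (auto simp: pair_word_def)

lemma pair_word_mem: "(i, j) \<in> set ps \<Longrightarrow> i \<in> set (pair_word l ps)"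
  by (force simp: pair_word_def)

text \<open>
  Only two odd colours carry a value, so two local pairs would repeat one of them in the wedge.
\<close>

lemma pairs_value_nonzero:
  assumes "pairs_value l (char_functional l \<theta>) M ps \<noteq> 0"
  shows "set_mset M \<subseteq> {1, 2}" "length ps \<le> 1" "\<And>i j. (i, j) \<in> set ps \<Longrightarrow> i \<in> {1, l + 1}"
proof -
  have d: "distinct (pair_word l ps)" and h: "char_functional l \<theta> M (set (pair_word l ps)) \<noteq> 0"
    using assms by (auto simp: pairs_value_def wedge_value_def pair_word_def split: if_splits)
  show "set_mset M \<subseteq> {1, 2}" by (rule char_functional_nonzero[OF h])
  have S: "set (pair_word l ps) \<subseteq> {1, l + 1}" using char_functional_nonzero(2)[OF h] by auto
  have "card (set (pair_word l ps)) \<le> card {1, l + 1}" using S by (intro card_mono) auto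
  also have "\<dots> \<le> 2" by (simp add: card_insert_if)
  finally show "length ps \<le> 1" using distinct_card[OF d] length_pair_word[of l ps] by simp
  show "\<And>i j. (i, j) \<in> set ps \<Longrightarrow> i \<in> {1, l + 1}" using pair_word_mem S by blast
qed

lemma inversions_short: "inversions [] = {}" "i \<le> j \<Longrightarrow> inversions [i, j] = {}" "j < i \<Longrightarrow> inversions [i, j] = {(0, 1)}"
  by (auto simp: inversions_def less_Suc_eq nth_Cons')

lemma pairs_value_Nil:
  assumes "set_mset M \<subseteq> {1, 2}"
  shows "pairs_value l (char_functional l \<theta>) M [] = (if count M 2 = 0 then \<theta> else if count M 2 = 1 then \<i> else 0)"
  using only_ones_iff[OF assms]
  by (auto simp: pairs_value_def wedge_value_def inversions_short char_functional_def not_in_iff split: if_splits)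

text \<open>
  A circuit passes a vertex with weight 1, and only if it keeps its odd colour and meets no edge of
  even colour 2.
\<close>

lemma pairs_value_single:
  assumes "set_mset M \<subseteq> {1, 2}" "i \<in> {1, l + 1}" "j \<in> {1, l + 1}" "l \<ge> 1"
  shows "pairs_value l (char_functional l \<theta>) M [(i, j)] = (if i = j \<and> count M 2 = 0 then 1 else 0)"
proof -
  define c where "c = char_functional l \<theta> M {1, l + 1}"
  have c: "c = (if count M 2 = 0 then -1 else 0)"
    using only_ones_iff[OF assms(1)] by (auto simp: c_def char_functional_def)
  have c': "char_functional l \<theta> M {l + 1, 1} = c" unfolding c_def by (simp add: insert_commute)
  have w: "wedge_value (char_functional l \<theta>) M [1, l + 1] = c" "wedge_value (char_functional l \<theta>) M [l + 1, 1] = - c"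
    "wedge_value (char_functional l \<theta>) M [x, x] = 0" for x
    using assms(4) c' by (auto simp: wedge_value_def inversions_short c_def)
  have e: "eta_index l 1 = l + 1" "eta_index l (l + 1) = 1" "eta_sign l 1 = -1" "eta_sign l (l + 1) = 1"
    using assms(4) by (auto simp: eta_index_def eta_sign_def)
  have pv: "pairs_value l (char_functional l \<theta>) M [(i, j)] = eta_sign l j * wedge_value (char_functional l \<theta>) M [i, eta_index l j]"
    by (simp add: pairs_value_def)
  consider "i = 1" "j = 1" | "i = 1" "j = l + 1" | "i = l + 1" "j = 1" | "i = l + 1" "j = l + 1"
    using assms(2,3) by blast
  then show ?thesis
  proof cases
    case 1
    then show ?thesis unfolding pv by (simp only: e w) (auto simp: c not_in_iff)
  next
    case 2
    then show ?thesis using assms(4) unfolding pv by (simp only: e w) simp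
  next
    case 3
    then show ?thesis using assms(4) unfolding pv by (simp only: e w) simp
  next
    case 4
    then show ?thesis unfolding pv by (simp only: e w) (auto simp: c not_in_iff)
  qed
qed

lemma count_colour:
  assumes "finite A"
  shows "count (image_mset f (mset_set A)) y = card {x \<in> A. f x = y}"
  using assms
proof (induction A rule: finite_induct)
  case (insert x A)
  have "{z \<in> insert x A. f z = y} = (if f x = y then insert x {z \<in> A. f z = y} else {z \<in> A. f z = y})" by auto
  then show ?case using insert by simp
qed simp

section \<open>Colourings and sets of arcs\<close>

text \<open>
  The colouring that encodes \<open>X\<close>. Outside the split edges, colour 2 means both arcs and colour 1 none.
  On a split edge, colour \<open>l + 1\<close> means that the half-edge in \<open>X\<close> is the incoming one for the orientation \<open>I\<close>
  and colour 1 that it is the outgoing one, so that an edge of colour 1 is traversed along \<open>I\<close>.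
\<close>

definition even_colour :: "mgraph \<Rightarrow> nat set \<Rightarrow> nat set \<Rightarrow> nat" where
  "even_colour G X = (\<lambda>e\<in>edges G - split_edges G X. if e \<subseteq> X then 2 else 1)"

definition odd_colour :: "nat \<Rightarrow> mgraph \<Rightarrow> nat set \<Rightarrow> nat set \<Rightarrow> nat set \<Rightarrow> nat" where
  "odd_colour l G X I = (\<lambda>e\<in>split_edges G X. if e \<inter> X \<subseteq> I then l + 1 else 1)"

lemma orbit_equivariant:
  assumes "\<And>x. x \<in> S \<Longrightarrow> \<pi> x \<in> S \<and> q (g x) = g (\<pi> x)" "a \<in> S"
  shows "orbit q (g a) = g ` orbit \<pi> a"
proof
  have "y \<in> orbit q (g a) \<Longrightarrow> y \<in> g ` (orbit \<pi> a \<inter> S)" for y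
  proof (induction rule: orbit.induct)
    case base
    then show ?case using assms(1)[OF assms(2)] orbit.base[of \<pi> a] by auto
  next
    case (step z)
    then obtain x where x: "x \<in> orbit \<pi> a" "x \<in> S" "z = g x" by auto
    then show ?case using assms(1)[OF x(2)] orbit.step[OF x(1)] by auto
  qed
  then show "orbit q (g a) \<subseteq> g ` orbit \<pi> a" by blast
  have "y \<in> orbit \<pi> a \<Longrightarrow> y \<in> S \<and> g y \<in> orbit q (g a)" for y
  proof (induction rule: orbit.induct)
    case base
    then show ?case using assms(1)[OF assms(2)] orbit.base[of q "g a"] by simp
  next
    case (step z)
    then show ?case using assms(1)[of z] orbit.step[of "g z" q "g a"] by simp
  qed
  then show "g ` orbit \<pi> a \<subseteq> orbit q (g a)" by blast
qed

locale split_pairing =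
  fixes G :: mgraph and X I :: "nat set" and \<kappa> :: "nat \<Rightarrow> nat"
  assumes G: "is_graph G" and X: "X \<subseteq> halves G"
    and bal: "balanced_orientation G (split_edges G X) I"
    and loc: "local_pairing G (split_edges G X) I \<kappa>"
begin

abbreviation "F \<equiv> split_edges G X"
abbreviation "U \<equiv> \<Union>(split_edges G X)"

lemma U_iff: "a \<in> U \<longleftrightarrow> a \<in> halves G \<and> (a \<in> X \<longleftrightarrow> mate G a \<notin> X)"
  by (rule Union_split_iff[OF G])

lemma I_sub:
  assumes "a \<in> I"
  shows "a \<in> U" "a \<in> halves G"
proof -
  show "a \<in> U" using assms bal unfolding balanced_orientation_def by blast
  then show "a \<in> halves G" using U_iff by blast
qed

lemma U_mate: "a \<in> U \<Longrightarrow> mate G a \<in> U"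
  using U_iff[of a] U_iff[of "mate G a"] mate_mate[OF G, of a] mate_in[OF G, of a] by simp

lemma mate_I:
  assumes "a \<in> U"
  shows "mate G a \<in> I \<longleftrightarrow> a \<notin> I"
proof -
  have a: "a \<in> halves G" using assms U_iff by blast
  have "edge_of G a \<in> F" using edge_split_iff[OF G a] assms U_iff by blast
  then have "card (edge_of G a \<inter> I) = 1" using bal by (simp add: balanced_orientation_def)
  then have "card ({a, mate G a} \<inter> I) = 1" using edge_of_mate(1)[OF G a] by simp
  moreover have "mate G a \<noteq> a" by (rule edge_of_mate(2)[OF G a])
  ultimately show ?thesis by (cases "a \<in> I"; cases "mate G a \<in> I") auto
qed

lemma \<kappa>_I:
  assumes "a \<in> I"
  shows "\<kappa> a \<in> U" "\<kappa> a \<notin> I" "inc G (\<kappa> a) = inc G a" "\<kappa> a \<in> halves G"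
proof -
  have "\<kappa> a \<in> U - I" using assms loc by (auto simp: local_pairing_def bij_betw_def)
  then show "\<kappa> a \<in> U" "\<kappa> a \<notin> I" "\<kappa> a \<in> halves G" using U_iff by blast+
  show "inc G (\<kappa> a) = inc G a" using assms loc by (simp add: local_pairing_def)
qed

lemma \<kappa>_onto:
  assumes "b \<in> U" "b \<notin> I"
  obtains a where "a \<in> I" "\<kappa> a = b"
proof -
  have "b \<in> \<kappa> ` I" using assms loc by (auto simp: local_pairing_def bij_betw_def)
  then show thesis using that by auto
qed

lemma card_in_out: "v \<in> verts G \<Longrightarrow> card (halves_at G v \<inter> I) = card (halves_at G v \<inter> (U - I))"
  using bal by (simp add: balanced_orientation_def)

lemma card_U_at: "v \<in> verts G \<Longrightarrow> card (halves_at G v \<inter> U) = 2 * card (halves_at G v \<inter> I)"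
proof -
  assume v: "v \<in> verts G"
  have fin: "finite (halves_at G v)" using finite_graph(2)[OF G] by (simp add: halves_at_def)
  have "halves_at G v \<inter> U = (halves_at G v \<inter> I) \<union> (halves_at G v \<inter> (U - I))"
    using I_sub by auto
  then have "card (halves_at G v \<inter> U) = card (halves_at G v \<inter> I) + card (halves_at G v \<inter> (U - I))"
    using fin card_Un_disjoint[of "halves_at G v \<inter> I" "halves_at G v \<inter> (U - I)"] by auto
  then show ?thesis using card_in_out[OF v] by simp
qed

abbreviation "psi \<equiv> even_colour G X"
abbreviation "phi l \<equiv> odd_colour l G X I"

lemma psi_edge:
  assumes "a \<in> halves G" "a \<notin> U"
  shows "psi (edge_of G a) = (if a \<in> X then 2 else 1)"
proof -
  have "edge_of G a \<in> edges G - F"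
    using edge_split_iff[OF G assms(1), of X] U_iff[of a] assms edge_of_in[OF G assms(1)] by blast
  moreover have "edge_of G a \<subseteq> X \<longleftrightarrow> a \<in> X"
    using edge_of_mate(1)[OF G assms(1)] U_iff[of a] assms by auto
  ultimately show ?thesis by (simp add: even_colour_def)
qed

lemma phi_edge:
  assumes "a \<in> U"
  shows "phi l (edge_of G a) = (if a \<in> X \<longleftrightarrow> a \<in> I then l + 1 else 1)"
proof -
  have a: "a \<in> halves G" using assms U_iff by blast
  have "edge_of G a \<in> F" using edge_split_iff[OF G a] assms U_iff by blast
  moreover have "edge_of G a \<inter> X \<subseteq> I \<longleftrightarrow> (a \<in> X \<longleftrightarrow> a \<in> I)"
    using edge_of_mate(1)[OF G a] mate_I[OF assms] assms U_iff[of a] by auto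
  ultimately show ?thesis by (simp add: odd_colour_def)
qed

text \<open>
  The weights of \<open>h(\<theta>)\<close> are the local rule for sets of arcs: \<open>\<theta>\<close> at a vertex without arc, \<open>\<i>\<close> at an
  end of a doubly traversed edge, 1 at a vertex of a circuit that is traversed consistently, and 0
  wherever the arcs do not form disjoint cycles.
\<close>

lemma vertex_weight_arcs:
  assumes l: "l \<ge> 1" and v: "v \<in> verts G"
  shows "vertex_weight l (char_functional l \<theta>) G F I \<kappa> psi (phi l) v =
    (if card (arcs_out G X v) = card (arcs_in G X v) \<and> card (arcs_out G X v) \<le> 1
     then if arcs_out G X v = {} then \<theta> else if doubles G X v \<noteq> {} then \<i> else 1
     else 0)"
proof -
  define A where "A = halves_at G v"
  define M where "M = image_mset (\<lambda>a. psi (edge_of G a)) (mset_set (A - U))"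
  define ps where "ps = map (\<lambda>a. (phi l (edge_of G a), phi l (edge_of G (\<kappa> a)))) (sorted_list_of_set (A \<inter> I))"
  have Ah: "a \<in> halves G" "inc G a = v" if "a \<in> A" for a using that by (auto simp: A_def halves_at_def)
  have fin: "finite A" using finite_graph(2)[OF G] by (simp add: A_def halves_at_def)
  have w: "vertex_weight l (char_functional l \<theta>) G F I \<kappa> psi (phi l) v = pairs_value l (char_functional l \<theta>) M ps"
    by (simp add: vertex_weight_def M_def ps_def A_def)
  have col: "psi (edge_of G a) = (if a \<in> X then 2 else 1)" if "a \<in> A - U" for a
    using psi_edge[of a] Ah[of a] that by blast
  have M12: "set_mset M \<subseteq> {1, 2}" using col fin by (auto simp: M_def)
  have "doubles G X v = {a \<in> A - U. psi (edge_of G a) = 2}"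
  proof (rule Set.set_eqI)
    fix a
    show "a \<in> doubles G X v \<longleftrightarrow> a \<in> {a \<in> A - U. psi (edge_of G a) = 2}"
    proof (cases "a \<in> A - U")
      case True
      then show ?thesis using col[OF True] Ah(1)[of a] U_iff[of a]
        by (simp add: doubles_def A_def[symmetric])
    next
      case False
      then show ?thesis using Ah(1)[of a] U_iff[of a] by (auto simp: doubles_def A_def[symmetric])
    qed
  qed
  then have cM: "count M 2 = card (doubles G X v)"
    unfolding M_def using fin by (subst count_colour) auto
  have finD: "finite (doubles G X v)" "finite (arcs_out G X v)" using fin by (auto simp: doubles_def arcs_out_def A_def)
  note oi = card_arcs_decomp[OF G, of X v, folded A_def]
  have cU: "card (A \<inter> U) = 2 * card (A \<inter> I)" using card_U_at[OF v] by (simp add: A_def)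
  have cUX: "card (A \<inter> U \<inter> X) + card (A \<inter> U - X) = card (A \<inter> U)"
    using fin card_Int_Diff[of "A \<inter> U" X] by simp
  have len: "length ps = card (A \<inter> I)" by (simp add: ps_def)
  \<comment> \<open>\<open>card (A \<inter> I)\<close> is the number of times the circuits pass \<open>v\<close>.\<close>
  consider "card (A \<inter> I) = 0" | "card (A \<inter> I) = 1" | "card (A \<inter> I) \<ge> 2" by linarith
  then show ?thesis
  proof cases
    case 1
    then have "ps = []" using len by simp
    moreover have "card (arcs_out G X v) = card (doubles G X v)" "card (arcs_in G X v) = card (doubles G X v)"
      using oi cU cUX 1 by auto
    moreover from this have "arcs_out G X v = {} \<longleftrightarrow> card (doubles G X v) = 0"
      using finD by (metis card_0_eq)
    moreover have "doubles G X v = {} \<longleftrightarrow> card (doubles G X v) = 0" using finD by simp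
    ultimately show ?thesis unfolding w using cM pairs_value_Nil[OF M12, of l \<theta>] by auto
  next
    case 2
    then obtain a where a: "A \<inter> I = {a}" by (auto simp: card_1_singleton_iff)
    define b where "b = \<kappa> a"
    have aI: "a \<in> I" "a \<in> A" using a by auto
    have aU: "a \<in> U" using I_sub aI by blast
    have b: "b \<in> U" "b \<notin> I" "b \<in> A" using \<kappa>_I[OF aI(1)] Ah[OF aI(2)] by (auto simp: b_def A_def halves_at_def)
    have ps: "ps = [(phi l (edge_of G a), phi l (edge_of G b))]" by (simp add: ps_def a b_def)
    have ab: "a \<noteq> b" using aI b by auto
    then have "card {a, b} = card (A \<inter> U)" using cU 2 by simp
    moreover have "{a, b} \<subseteq> A \<inter> U" using aI(2) aU b(1,3) by blast
    ultimately have AU: "A \<inter> U = {a, b}" using card_subset_eq[of "A \<inter> U" "{a, b}"] fin by simp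
    have pa: "phi l (edge_of G a) = (if a \<in> X then l + 1 else 1)" using phi_edge[OF aU] aI by simp
    have pb: "phi l (edge_of G b) = (if b \<in> X then 1 else l + 1)" using phi_edge[OF b(1)] b by simp
    have pv: "pairs_value l (char_functional l \<theta>) M ps =
        (if (a \<in> X \<longleftrightarrow> b \<notin> X) \<and> card (doubles G X v) = 0 then 1 else 0)"
      unfolding ps using l by (subst pairs_value_single[OF M12]) (auto simp: pa pb cM)
    show ?thesis
    proof (cases "a \<in> X \<longleftrightarrow> b \<notin> X")
      case True
      then have "card ({a, b} \<inter> X) = 1" "card ({a, b} - X) = 1"
        using ab by (cases "a \<in> X"; cases "b \<in> X"; simp add: insert_Diff_if)+
      then have o: "card (arcs_out G X v) = card (doubles G X v) + 1" "card (arcs_in G X v) = card (doubles G X v) + 1"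
        using oi AU by simp_all
      then show ?thesis unfolding w pv using finD True by auto
    next
      case False
      then have "card ({a, b} \<inter> X) \<noteq> card ({a, b} - X)"
        using ab by (cases "a \<in> X"; cases "b \<in> X"; simp add: insert_Diff_if)
      then show ?thesis unfolding w pv using oi AU False by auto
    qed
  next
    case 3
    then have no: "\<not> (card (arcs_out G X v) = card (arcs_in G X v) \<and> card (arcs_out G X v) \<le> 1)"
      using oi cU cUX by linarith
    have "pairs_value l (char_functional l \<theta>) M ps = 0"
      using pairs_value_nonzero(2)[of l \<theta> M ps] 3 len by force
    then show ?thesis unfolding w by (simp only: if_not_P[OF no])
  qed
qed

context
  assumes valid: "\<forall>v\<in>verts G. card (arcs_out G X v) = card (arcs_in G X v) \<and> card (arcs_out G X v) \<le> 1"
begin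

lemma inj_X: "inj_on (inc G) X"
  and bij_arc: "bij_betw (arc_map G X) (verts G) (verts G)"
  using arc_map_bij_iff[OF G X] valid by blast+

text \<open>
  With at most one arc leaving and one arriving, a circuit passes a vertex only once, and no doubly
  traversed edge ends there.
\<close>

lemma at_circuit:
  assumes "a \<in> I"
  shows "halves_at G (inc G a) \<inter> U = {a, \<kappa> a}" "a \<in> X \<longleftrightarrow> \<kappa> a \<notin> X" "doubles G X (inc G a) = {}"
proof -
  define v where "v = inc G a"
  define A where "A = halves_at G v"
  have fin: "finite A" using finite_graph(2)[OF G] by (simp add: A_def halves_at_def)
  have v: "v \<in> verts G" using inc_in[OF G I_sub(2)[OF assms]] by (simp add: v_def)
  have mem: "a \<in> A \<inter> U" "\<kappa> a \<in> A \<inter> U" "\<kappa> a \<noteq> a"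
    using \<kappa>_I[OF assms] I_sub[OF assms] assms by (auto simp: A_def v_def halves_at_def)
  note oi = card_arcs_decomp[OF G, of X v, folded A_def]
  have cUX: "card (A \<inter> U \<inter> X) + card (A \<inter> U - X) = card (A \<inter> U)"
    using fin card_Int_Diff[of "A \<inter> U" X] by simp
  have "card {a, \<kappa> a} \<le> card (A \<inter> U)" using fin mem by (intro card_mono) auto
  then have "card (A \<inter> U) \<ge> 2" using mem(3) by simp
  moreover have "card (arcs_out G X v) = card (arcs_in G X v)" "card (arcs_out G X v) \<le> 1" using valid v by auto
  ultimately have c: "card (A \<inter> U) = 2" "card (A \<inter> U \<inter> X) = 1" "card (A \<inter> U - X) = 1" "card (doubles G X v) = 0"
    using oi cUX by linarith+
  have AU: "A \<inter> U = {a, \<kappa> a}"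
    using card_subset_eq[of "A \<inter> U" "{a, \<kappa> a}"] fin mem c(1) by auto
  then show "halves_at G (inc G a) \<inter> U = {a, \<kappa> a}" by (simp add: A_def v_def)
  have "card ({a, \<kappa> a} \<inter> X) = 1" using c(2) AU by simp
  then show "a \<in> X \<longleftrightarrow> \<kappa> a \<notin> X" using mem(3) by (cases "a \<in> X"; cases "\<kappa> a \<in> X") auto
  have "finite (doubles G X v)" using fin by (simp add: doubles_def A_def)
  then show "doubles G X (inc G a) = {}" using c(4) by (simp add: v_def)
qed

lemma inj_I: "inj_on (inc G) I"
proof (rule inj_onI)
  fix a b assume ab: "a \<in> I" "b \<in> I" "inc G a = inc G b"
  then have "b \<in> halves_at G (inc G a) \<inter> U" using I_sub[OF ab(2)] by (simp add: halves_at_def)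
  then have "b \<in> {a, \<kappa> a}" using at_circuit(1)[OF ab(1)] by simp
  then show "a = b" using \<kappa>_I(2)[OF ab(1)] ab(2) by auto
qed

text \<open>
  The permutation \<open>mate G \<circ> \<kappa>\<close> that follows the circuits is intertwined by \<open>inc G\<close> with \<open>arc_map\<close> on
  circuits whose incoming half-edges lie outside \<open>X\<close>, and with its inverse on circuits whose incoming
  half-edges lie in \<open>X\<close>. Mixed circuits do not occur.
\<close>

lemma circuit_step:
  assumes "a \<in> I"
  shows "mate G (\<kappa> a) \<in> I" "mate G (\<kappa> a) \<in> X \<longleftrightarrow> a \<in> X"
    "a \<notin> X \<Longrightarrow> arc_map G X (inc G a) = inc G (mate G (\<kappa> a))"
    "a \<in> X \<Longrightarrow> arc_map G X (inc G (mate G (\<kappa> a))) = inc G a"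
proof -
  note k = \<kappa>_I[OF assms]
  show 1: "mate G (\<kappa> a) \<in> I" using mate_I[OF k(1)] k(2) by simp
  show 2: "mate G (\<kappa> a) \<in> X \<longleftrightarrow> a \<in> X" using U_iff[of "\<kappa> a"] k(1) at_circuit(2)[OF assms] by blast
  show "a \<notin> X \<Longrightarrow> arc_map G X (inc G a) = inc G (mate G (\<kappa> a))"
    using arc_map_in[OF inj_X, of "\<kappa> a"] at_circuit(2)[OF assms] k(3) by simp
  show "a \<in> X \<Longrightarrow> arc_map G X (inc G (mate G (\<kappa> a))) = inc G a"
    using arc_map_in[OF inj_X, of "mate G (\<kappa> a)"] 2 k(3) mate_mate[OF G k(4)] by simp
qed

text \<open>
  The permutation \<open>arc_map\<close> splits into transpositions along the doubly traversed edges and, on the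
  vertices of the circuits, cycles that run along the circuits or against them. The first part has
  \<open>card VD / 2\<close> transpositions, which \<open>\<i>\<close> per vertex reproduces because \<open>\<i>\<^sup>2 = -1\<close>; the second part has one orbit
  per circuit in either direction, so \<open>sign_orbits\<close> yields \<open>(-1) ^ num_circuits\<close> together with one sign
  per arc.
\<close>

lemma arc_sign:
  defines "VD \<equiv> {v \<in> verts G. doubles G X v \<noteq> {}}"
  shows "of_int (sign_on (verts G) (arc_map G X)) * (-1) ^ card X =
    (-1) ^ num_circuits G I \<kappa> * \<i> ^ card VD"
    and "card {v \<in> verts G. arcs_out G X v \<noteq> {}} = card X"
proof -
  define V where "V = verts G"
  define p where "p = arc_map G X"
  define \<pi> where "\<pi> = mate G \<circ> \<kappa>"
  define VF where "VF = inc G ` I"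
  have finV: "finite V" using finite_graph[OF G] by (simp add: V_def)
  have VDV: "VD \<subseteq> V" and VFV: "VF \<subseteq> V"
    using inc_in[OF G I_sub(2)] by (auto simp: VD_def V_def VF_def)
  have disj: "VD \<inter> VF = {}" using at_circuit(3) by (auto simp: VD_def VF_def)
  have X_cover: "inc G ` X = VD \<union> VF"
  proof (intro subset_antisym subsetI)
    fix v assume "v \<in> inc G ` X"
    then obtain x where x: "x \<in> X" "v = inc G x" by auto
    then have xh: "x \<in> halves G" using X by auto
    show "v \<in> VD \<union> VF"
    proof (cases "mate G x \<in> X")
      case True
      then have "x \<in> doubles G X v" using x xh by (simp add: doubles_def halves_at_def)
      then show ?thesis using x inc_in[OF G xh] by (auto simp: VD_def)
    next
      case False
      then have xU: "x \<in> U" using U_iff x xh by blast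
      show ?thesis
      proof (cases "x \<in> I")
        case True
        then show ?thesis using x by (auto simp: VF_def)
      next
        case False
        then obtain a where "a \<in> I" "\<kappa> a = x" using \<kappa>_onto xU by blast
        then show ?thesis using \<kappa>_I(3) x by (auto simp: VF_def image_iff)
      qed
    qed
  next
    fix v assume "v \<in> VD \<union> VF"
    then consider "v \<in> VD" | a where "a \<in> I" "v = inc G a" by (auto simp: VF_def)
    then show "v \<in> inc G ` X"
    proof cases
      case 1
      then show ?thesis by (auto simp: VD_def doubles_def halves_at_def)
    next
      case 2
      then show ?thesis using at_circuit(2)[OF 2(1)] \<kappa>_I(3)[OF 2(1)] by (metis imageI)
    qed
  qed
  have finVD: "finite VD" and finVF: "finite VF" using finV VDV VFV finite_subset by blast+
  have cX: "card X = card VD + card VF"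
    using card_image[OF inj_X] X_cover disj finVD finVF by (simp add: card_Un_disjoint)
  have "{v \<in> V. arcs_out G X v \<noteq> {}} = inc G ` X"
    using X inc_in[OF G] by (auto simp: arcs_out_def halves_at_def V_def)
  then show "card {v \<in> verts G. arcs_out G X v \<noteq> {}} = card X"
    using card_image[OF inj_X] by (simp add: V_def)
  have p_out: "p v = v" if "v \<notin> VD \<union> VF" for v
    unfolding p_def by (rule arc_map_out) (use that X_cover in blast)
  have pinj: "inj_on p V" using bij_arc by (simp add: p_def V_def bij_betw_def)
  have pD: "p v \<in> VD \<and> p (p v) = v \<and> p v \<noteq> v" if v: "v \<in> VD" for v
  proof -
    obtain d where d: "d \<in> halves G" "inc G d = v" "d \<in> X" "mate G d \<in> X"
      using v by (auto simp: VD_def doubles_def halves_at_def)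
    have p1: "p v = inc G (mate G d)" using arc_map_in[OF inj_X d(3)] d by (simp add: p_def)
    have p2: "p (p v) = v" using arc_map_in[OF inj_X d(4)] d mate_mate[OF G d(1)] p1 by (simp add: p_def)
    have "mate G d \<in> doubles G X (p v)"
      using d p1 mate_in[OF G d(1)] mate_mate[OF G d(1)] by (simp add: doubles_def halves_at_def)
    moreover have "p v \<in> verts G" using p1 inc_in[OF G mate_in[OF G d(1)]] by simp
    ultimately have "p v \<in> VD" by (auto simp: VD_def)
    moreover have "p v \<noteq> v"
      using inj_onD[OF inj_X _ d(4) d(3)] p1 d(2) edge_of_mate(2)[OF G d(1)] by auto
    ultimately show ?thesis using p2 by simp
  qed
  have pF: "p v \<in> VF" if v: "v \<in> VF" for v
  proof -
    obtain a where a: "a \<in> I" "v = inc G a" using v by (auto simp: VF_def)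
    show ?thesis
    proof (cases "a \<in> X")
      case False
      then show ?thesis using circuit_step(1,3)[OF a(1)] a by (simp add: p_def VF_def)
    next
      case True
      have m: "mate G a \<in> U" "mate G a \<notin> I" using U_mate mate_I I_sub(1)[OF a(1)] a(1) by blast+
      then obtain c where c: "c \<in> I" "\<kappa> c = mate G a" using \<kappa>_onto by blast
      have "p v = inc G (mate G a)" using arc_map_in[OF inj_X True] a by (simp add: p_def)
      also have "\<dots> = inc G c" using \<kappa>_I(3)[OF c(1)] c by simp
      finally show ?thesis using c by (simp add: VF_def)
    qed
  qed
  define qD where "qD = (\<lambda>v. if v \<in> VD then p v else v)"
  define qF where "qF = (\<lambda>v. if v \<in> VF then p v else v)"
  have qD: "qD permutes VD"
  proof (rule inj_imp_permutes[OF _ finVD])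
    show "inj_on qD VD" using pinj VDV by (auto simp: qD_def inj_on_def)
  qed (use pD in \<open>auto simp: qD_def\<close>)
  have qF: "qF permutes VF"
  proof (rule inj_imp_permutes[OF _ finVF])
    show "inj_on qF VF" using pinj VFV by (auto simp: qF_def inj_on_def)
  qed (use pF in \<open>auto simp: qF_def\<close>)
  have "p = qD \<circ> qF"
  proof
    fix v
    show "p v = (qD \<circ> qF) v"
      using disj pF[of v] p_out[of v] by (cases "v \<in> VF"; cases "v \<in> VD") (auto simp: qD_def qF_def)
  qed
  then have sp: "sign p = sign qD * sign qF"
    using permutes_imp_permutation[OF finVD qD] permutes_imp_permutation[OF finVF qF]
    by (simp add: sign_compose)
  have p_perm: "p permutes V"
    using bij_arc p_out VDV VFV by (auto simp: permutes_altdef p_def V_def)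
  have sD: "even (card VD)" "sign qD = (-1) ^ (card VD div 2)"
    using sign_involution[OF finVD qD] pD by (auto simp: qD_def)
  have orb: "orbit qF (inc G a) = inc G ` orbit \<pi> a" if a: "a \<in> I" for a
  proof (cases "a \<in> X")
    case False
    show ?thesis
    proof (rule orbit_equivariant[of "I - X"])
      fix x assume x: "x \<in> I - X"
      then have "inc G x \<in> VF" by (simp add: VF_def)
      then show "\<pi> x \<in> I - X \<and> qF (inc G x) = inc G (\<pi> x)"
        using circuit_step(1,2,3)[of x] x by (simp add: \<pi>_def qF_def p_def)
    qed (use a False in simp)
  next
    case True
    have "orbit (Hilbert_Choice.inv qF) (inc G a) = inc G ` orbit \<pi> a"
    proof (rule orbit_equivariant[of "I \<inter> X"])
      fix x assume x: "x \<in> I \<inter> X"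
      then have "inc G (\<pi> x) \<in> VF" "\<pi> x \<in> I \<inter> X"
        using circuit_step(1,2)[of x] by (auto simp: \<pi>_def VF_def)
      moreover have "qF (inc G (\<pi> x)) = inc G x"
        using circuit_step(4)[of x] x \<open>inc G (\<pi> x) \<in> VF\<close> by (simp add: \<pi>_def qF_def p_def)
      then have "Hilbert_Choice.inv qF (inc G x) = inc G (\<pi> x)"
        using permutes_inv_eq[OF qF] by metis
      ultimately show "\<pi> x \<in> I \<inter> X \<and> Hilbert_Choice.inv qF (inc G x) = inc G (\<pi> x)" by blast
    qed (use a True in simp)
    then show ?thesis using orbit_inv_eq[OF permutes_imp_permutation[OF finVF qF]] by simp
  qed
  have orbI: "orbit \<pi> a \<subseteq> I" if "a \<in> I" for a
  proof
    fix y assume "y \<in> orbit \<pi> a"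
    then show "y \<in> I"
      by (induction rule: orbit.induct) (use that circuit_step(1) in \<open>auto simp: \<pi>_def\<close>)
  qed
  have "orbit qF ` VF = (\<lambda>B. inc G ` B) ` (orbit \<pi> ` I)"
    unfolding VF_def image_image using orb by (rule image_cong[OF refl])
  moreover have "inj_on (\<lambda>B. inc G ` B) (orbit \<pi> ` I)"
  proof (rule inj_onI)
    fix B C assume "B \<in> orbit \<pi> ` I" "C \<in> orbit \<pi> ` I" "inc G ` B = inc G ` C"
    then show "B = C" using inj_on_image_eq_iff[OF inj_I, of B C] orbI by blast
  qed
  ultimately have "card (orbit qF ` VF) = num_circuits G I \<kappa>"
    by (simp add: card_image num_circuits_def \<pi>_def)
  then have sF: "sign qF = (-1) ^ (card VF + num_circuits G I \<kappa>)"
    using sign_orbits[OF finVF qF] by simp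
  have "\<i> ^ card VD = (-1) ^ (card VD div 2)"
    using sD(1) by (metis dvd_mult_div_cancel power2_i power_mult)
  moreover have "sign_on V p = sign p" by (rule sign_on_permutes[OF p_perm]) simp
  moreover have "(-1::complex) ^ card X = (-1) ^ card VF"
    using sD(1) by (simp add: cX power_add)
  ultimately show "of_int (sign_on (verts G) (arc_map G X)) * (-1) ^ card X =
    (-1) ^ num_circuits G I \<kappa> * \<i> ^ card VD"
    using sp sD(2) sF by (simp add: p_def V_def power_add flip: power_mult_distrib)
qed

end

text \<open>
  The vertex weights multiply to a power of \<open>\<theta>\<close>, one factor for each vertex without arc, and a power of \<open>\<i>\<close>.
  By \<open>arc_sign\<close>, the latter and the sign of the circuits make up the sign in the expansion of the determinant.
\<close>

lemma arc_term_colouring: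
  assumes l: "l \<ge> 1"
  shows "(-1) ^ num_circuits G I \<kappa> * (\<Prod>v\<in>verts G. vertex_weight l (char_functional l \<theta>) G F I \<kappa> psi (phi l) v) = arc_term \<theta> G X"
proof (cases "\<forall>v\<in>verts G. card (arcs_out G X v) = card (arcs_in G X v) \<and> card (arcs_out G X v) \<le> 1")
  case False
  then obtain v where v: "v \<in> verts G" "\<not> (card (arcs_out G X v) = card (arcs_in G X v) \<and> card (arcs_out G X v) \<le> 1)" by blast
  then have "vertex_weight l (char_functional l \<theta>) G F I \<kappa> psi (phi l) v = 0"
    unfolding vertex_weight_arcs[OF l v(1)] by (simp only: if_not_P if_False)
  then have "(\<Prod>v\<in>verts G. vertex_weight l (char_functional l \<theta>) G F I \<kappa> psi (phi l) v) = 0"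
    using finite_graph(1)[OF G] v(1) by (intro prod_zero) auto
  moreover have "arc_term \<theta> G X = 0"
    using False arc_map_bij_iff[OF G X] unfolding arc_term_def by (simp only: if_False)
  ultimately show ?thesis by simp
next
  case True
  define V where "V = verts G"
  have finV: "finite V" using finite_graph[OF G] by (simp add: V_def)
  have "(\<Prod>v\<in>V. vertex_weight l (char_functional l \<theta>) G F I \<kappa> psi (phi l) v) =
      (\<Prod>v\<in>V. (if arcs_out G X v = {} then \<theta> else 1) * (if doubles G X v \<noteq> {} then \<i> else 1))"
  proof (rule prod.cong[OF refl])
    fix v assume "v \<in> V"
    then have v: "v \<in> verts G" by (simp add: V_def)
    have "doubles G X v \<subseteq> arcs_out G X v" by (auto simp: doubles_def arcs_out_def)
    then show "vertex_weight l (char_functional l \<theta>) G F I \<kappa> psi (phi l) v =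
        (if arcs_out G X v = {} then \<theta> else 1) * (if doubles G X v \<noteq> {} then \<i> else 1)"
      unfolding vertex_weight_arcs[OF l v] if_P[OF bspec[OF True v]] by auto
  qed
  also have "\<dots> = \<theta> ^ card {v \<in> V. arcs_out G X v = {}} * \<i> ^ card {v \<in> V. doubles G X v \<noteq> {}}"
    using finV by (simp add: prod.distrib prod.If_cases Int_def)
  also have "card {v \<in> V. arcs_out G X v = {}} = card V - card X"
  proof -
    have "{v \<in> V. arcs_out G X v = {}} = V - {v \<in> V. arcs_out G X v \<noteq> {}}" by auto
    then show ?thesis using finV arc_sign(2)[OF True] by (simp add: card_Diff_subset V_def)
  qed
  finally have P: "(\<Prod>v\<in>V. vertex_weight l (char_functional l \<theta>) G F I \<kappa> psi (phi l) v) =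
    \<theta> ^ (card V - card X) * \<i> ^ card {v \<in> V. doubles G X v \<noteq> {}}" .
  have "arc_term \<theta> G X = of_int (sign_on V (arc_map G X)) * (-1) ^ card X * \<theta> ^ (card V - card X)"
    using inj_X[OF True] bij_arc[OF True] by (simp add: arc_term_def V_def)
  then show ?thesis unfolding V_def[symmetric] P using arc_sign(1)[OF True] by (simp add: V_def)
qed

end

text \<open>
  For a fixed Eulerian \<open>F\<close>, the colourings that avoid the colours of value zero correspond bijectively
  to the sets of arcs whose split edges are exactly \<open>F\<close>.
\<close>

lemma colour_sum_arcs:
  assumes G: "is_graph G" and F: "F \<subseteq> edges G" and l: "l \<ge> 1" and k: "k \<ge> 2"
    and bal: "balanced_orientation G F I" and loc: "local_pairing G F I \<kappa>"
  shows "(-1) ^ num_circuits G I \<kappa> * (\<Sum>\<psi>\<in>(edges G - F) \<rightarrow>\<^sub>E {1..k}. \<Sum>\<phi>\<in>F \<rightarrow>\<^sub>E {1..2 * l}.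
      \<Prod>v\<in>verts G. vertex_weight l (char_functional l \<theta>) G F I \<kappa> \<psi> \<phi> v) =
    (\<Sum>X\<in>{X \<in> Pow (halves G). split_edges G X = F}. arc_term \<theta> G X)"
proof -
  define E where "E = edges G"
  define W where "W = (\<lambda>\<psi> \<phi>. \<Prod>v\<in>verts G. vertex_weight l (char_functional l \<theta>) G F I \<kappa> \<psi> \<phi> v)"
  define S where "S = {X \<in> Pow (halves G). split_edges G X = F}"
  define P where "P = (E - F) \<rightarrow>\<^sub>E {1, 2::nat}"
  define Q where "Q = F \<rightarrow>\<^sub>E {1, l + 1}"
  have finV: "finite (verts G)" and finE: "finite E" and finH: "finite (halves G)"
    using finite_graph[OF G] by (auto simp: E_def)
  have finF: "finite F" using F finE finite_subset by (auto simp: E_def)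
  have cardI: "card (e \<inter> I) = 1" if "e \<in> F" for e using bal that by (simp add: balanced_orientation_def)
  \<comment> \<open>A colour outside \<open>{1, 2}\<close> on an edge outside \<open>F\<close> makes the weight of an end of that edge vanish.\<close>
  have Z1: "W \<psi> \<phi> = 0" if "e \<in> E - F" "\<psi> e \<notin> {1, 2}" for \<psi> \<phi> e
  proof -
    have e: "e \<in> edges G" "e \<noteq> {}" "e \<subseteq> halves G" using edges_subset[OF G, of e] that by (auto simp: E_def)
    then obtain a where a: "a \<in> e" by auto
    have ea: "edge_of G a = e" by (rule edge_of_eq[OF G e(1) a])
    have aU: "a \<notin> \<Union>F"
    proof
      assume "a \<in> \<Union>F"
      then obtain d where d: "d \<in> F" "a \<in> d" by auto
      then have "edge_of G a = d" using F by (intro edge_of_eq[OF G]) auto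
      then show False using ea d that by simp
    qed
    have ah: "a \<in> halves_at G (inc G a) - \<Union>F" using a e aU by (auto simp: halves_at_def)
    have "finite (halves_at G (inc G a) - \<Union>F)" using finH by (simp add: halves_at_def)
    then have "\<psi> e \<in># image_mset (\<lambda>a. \<psi> (edge_of G a)) (mset_set (halves_at G (inc G a) - \<Union>F))"
      using ah ea by force
    then have "vertex_weight l (char_functional l \<theta>) G F I \<kappa> \<psi> \<phi> (inc G a) = 0"
      unfolding vertex_weight_def using pairs_value_nonzero(1) that(2) by blast
    then show ?thesis unfolding W_def using finV inc_in[OF G, of a] a e by (intro prod_zero) auto
  qed
  \<comment> \<open>A colour outside \<open>{1, l + 1}\<close> on an edge of \<open>F\<close> makes the weight of the vertex vanish that the edge enters.\<close>
  have Z2: "W \<psi> \<phi> = 0" if "e \<in> F" "\<phi> e \<notin> {1, l + 1}" for \<psi> \<phi> e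
  proof -
    have e: "e \<in> edges G" "e \<subseteq> halves G" using edges_subset[OF G, of e] that F by auto
    have "e \<inter> I \<noteq> {}" using cardI[OF that(1)] by auto
    then obtain a where a: "a \<in> e" "a \<in> I" by auto
    have ea: "edge_of G a = e" by (rule edge_of_eq[OF G e(1) a(1)])
    have ah: "a \<in> halves_at G (inc G a) \<inter> I" using a e by (auto simp: halves_at_def)
    have "finite (halves_at G (inc G a) \<inter> I)" using finH by (simp add: halves_at_def)
    then have "(\<phi> e, \<phi> (edge_of G (\<kappa> a))) \<in> set (map (\<lambda>a. (\<phi> (edge_of G a), \<phi> (edge_of G (\<kappa> a))))
        (sorted_list_of_set (halves_at G (inc G a) \<inter> I)))"
      using ah ea by force
    then have "vertex_weight l (char_functional l \<theta>) G F I \<kappa> \<psi> \<phi> (inc G a) = 0"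
      unfolding vertex_weight_def using pairs_value_nonzero(3) that(2) by blast
    then show ?thesis unfolding W_def using finV inc_in[OF G, of a] a e by (intro prod_zero) auto
  qed
  have "(\<Sum>\<psi>\<in>(E - F) \<rightarrow>\<^sub>E {1..k}. \<Sum>\<phi>\<in>F \<rightarrow>\<^sub>E {1..2 * l}. W \<psi> \<phi>) = (\<Sum>\<psi>\<in>P. \<Sum>\<phi>\<in>F \<rightarrow>\<^sub>E {1..2 * l}. W \<psi> \<phi>)"
  proof (rule sum.mono_neutral_right)
    show "finite ((E - F) \<rightarrow>\<^sub>E {1..k})" using finE by (intro finite_PiE) auto
    show "P \<subseteq> (E - F) \<rightarrow>\<^sub>E {1..k}" unfolding P_def using k by (intro PiE_mono) auto
    show "\<forall>\<psi>\<in>((E - F) \<rightarrow>\<^sub>E {1..k}) - P. (\<Sum>\<phi>\<in>F \<rightarrow>\<^sub>E {1..2 * l}. W \<psi> \<phi>) = 0"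
    proof
      fix \<psi> assume \<psi>: "\<psi> \<in> ((E - F) \<rightarrow>\<^sub>E {1..k}) - P"
      then obtain e where "e \<in> E - F" "\<psi> e \<notin> {1, 2}" unfolding P_def PiE_def Pi_def by blast
      then show "(\<Sum>\<phi>\<in>F \<rightarrow>\<^sub>E {1..2 * l}. W \<psi> \<phi>) = 0" using Z1 by simp
    qed
  qed
  also have "\<dots> = (\<Sum>\<psi>\<in>P. \<Sum>\<phi>\<in>Q. W \<psi> \<phi>)"
  proof (rule sum.cong[OF refl], rule sum.mono_neutral_right)
    fix \<psi>
    show "finite (F \<rightarrow>\<^sub>E {1..2 * l})" using finF by (intro finite_PiE) auto
    show "Q \<subseteq> F \<rightarrow>\<^sub>E {1..2 * l}" unfolding Q_def using l by (intro PiE_mono) auto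
    show "\<forall>\<phi>\<in>(F \<rightarrow>\<^sub>E {1..2 * l}) - Q. W \<psi> \<phi> = 0"
    proof
      fix \<phi> assume \<phi>: "\<phi> \<in> (F \<rightarrow>\<^sub>E {1..2 * l}) - Q"
      then obtain e where "e \<in> F" "\<phi> e \<notin> {1, l + 1}" unfolding Q_def PiE_def Pi_def by blast
      then show "W \<psi> \<phi> = 0" by (rule Z2)
    qed
  qed
  also have "\<dots> = (\<Sum>(\<psi>, \<phi>)\<in>P \<times> Q. W \<psi> \<phi>)" by (rule sum.cartesian_product)
  also have "(-1) ^ num_circuits G I \<kappa> * \<dots> = (\<Sum>(\<psi>, \<phi>)\<in>P \<times> Q. (-1) ^ num_circuits G I \<kappa> * W \<psi> \<phi>)"
    by (simp add: sum_distrib_left case_prod_unfold)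
  also have "\<dots> = (\<Sum>X\<in>S. arc_term \<theta> G X)"
  proof (rule sum.reindex_bij_witness[of _ "\<lambda>X. (even_colour G X, odd_colour l G X I)"
        "\<lambda>(\<psi>, \<phi>). {a \<in> halves G. if edge_of G a \<in> F then \<phi> (edge_of G a) = l + 1 \<longleftrightarrow> a \<in> I else \<psi> (edge_of G a) = 2}"])
    fix X assume "X \<in> S"
    then have X: "X \<subseteq> halves G" and sX: "split_edges G X = F" by (auto simp: S_def)
    interpret split_pairing G X I \<kappa> by unfold_locales (use G X bal loc sX in auto)
    show "(even_colour G X, odd_colour l G X I) \<in> P \<times> Q"
      by (auto simp: even_colour_def odd_colour_def P_def Q_def E_def sX)
    show "(case (even_colour G X, odd_colour l G X I) of (\<psi>, \<phi>) \<Rightarrow>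
       {a \<in> halves G. if edge_of G a \<in> F then \<phi> (edge_of G a) = l + 1 \<longleftrightarrow> a \<in> I else \<psi> (edge_of G a) = 2}) = X"
      (is "?Y = X")
    proof (rule Set.set_eqI)
      fix a
      show "a \<in> ?Y \<longleftrightarrow> a \<in> X"
      proof (cases "a \<in> halves G")
        case True
        show ?thesis
        proof (cases "a \<in> \<Union>(split_edges G X)")
          case aU: True
          then have "edge_of G a \<in> F" using edge_split_iff[OF G True] U_iff sX by blast
          then show ?thesis using phi_edge[OF aU, of l] True l by auto
        next
          case aU: False
          then have "edge_of G a \<notin> F" using edge_split_iff[OF G True, of X] U_iff[of a] True sX by blast
          then show ?thesis using psi_edge[OF True aU] True by auto
        qed
      next
        case False
        then show ?thesis using X by auto
      qed
    qed
  next
    fix c assume "c \<in> P \<times> Q"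
    then obtain \<psi> \<phi> where c: "c = (\<psi>, \<phi>)" and \<psi>: "\<psi> \<in> P" and \<phi>: "\<phi> \<in> Q" by auto
    define X where "X = {a \<in> halves G. if edge_of G a \<in> F then \<phi> (edge_of G a) = l + 1 \<longleftrightarrow> a \<in> I else \<psi> (edge_of G a) = 2}"
    have Xsub: "X \<subseteq> halves G" by (auto simp: X_def)
    have memF: "a \<in> X \<longleftrightarrow> (\<phi> e = l + 1 \<longleftrightarrow> a \<in> I)" if "e \<in> F" "a \<in> e" for a e
      using that edge_of_eq[OF G, of e a] edges_subset[OF G, of e] F by (auto simp: X_def)
    have memE: "a \<in> X \<longleftrightarrow> \<psi> e = 2" if "e \<in> E - F" "a \<in> e" for a e
      using that edge_of_eq[OF G, of e a] edges_subset[OF G, of e] by (auto simp: X_def E_def)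
    have edge2: "\<exists>a b. e = {a, b} \<and> a \<in> I \<and> b \<notin> I" if e: "e \<in> F" for e
    proof -
      have "card e = 2" using card_edge[OF G] e F by auto
      then obtain a b where ab: "e = {a, b}" "a \<noteq> b" by (auto simp: card_2_iff)
      have "card (e \<inter> I) = 1" by (rule cardI[OF e])
      then consider "a \<in> I" "b \<notin> I" | "b \<in> I" "a \<notin> I" using ab by (cases "a \<in> I"; cases "b \<in> I") auto
      then show ?thesis
      proof cases
        case 1
        then show ?thesis using ab by blast
      next
        case 2
        then show ?thesis using ab by (metis insert_commute)
      qed
    qed
    have sX: "split_edges G X = F"
    proof (intro subset_antisym subsetI)
      fix e assume "e \<in> split_edges G X"
      then have e: "e \<in> edges G" "e \<inter> X \<noteq> {}" "\<not> e \<subseteq> X" by (auto simp: split_edges_def)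
      show "e \<in> F"
      proof (rule ccontr)
        assume "e \<notin> F"
        then have "e \<in> E - F" using e by (simp add: E_def)
        then show False using e memE[of e] by blast
      qed
    next
      fix e assume e: "e \<in> F"
      then obtain a b where "e = {a, b}" "a \<in> I" "b \<notin> I" using edge2 by blast
      then have "a \<in> X \<longleftrightarrow> b \<notin> X" using memF[OF e, of a] memF[OF e, of b] by auto
      then show "e \<in> split_edges G X" using e F \<open>e = {a, b}\<close> by (auto simp: split_edges_def)
    qed
    show "(case c of (\<psi>, \<phi>) \<Rightarrow> {a \<in> halves G. if edge_of G a \<in> F then \<phi> (edge_of G a) = l + 1 \<longleftrightarrow> a \<in> I else \<psi> (edge_of G a) = 2}) \<in> S"
      unfolding c prod.case X_def[symmetric] S_def using Xsub sX by blast
    interpret split_pairing G X I \<kappa> by unfold_locales (use G Xsub bal loc sX in auto)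
    have e1: "even_colour G X = \<psi>"
    proof
      fix e
      show "even_colour G X e = \<psi> e"
      proof (cases "e \<in> E - F")
        case True
        have "e \<subseteq> X \<longleftrightarrow> \<psi> e = 2"
        proof -
          have "e \<noteq> {}" using edges_subset[OF G] True by (auto simp: E_def)
          then show ?thesis using memE[OF True] by blast
        qed
        moreover have "\<psi> e = 1 \<or> \<psi> e = 2" using \<psi> True by (auto simp: P_def)
        ultimately show ?thesis using True by (auto simp: even_colour_def E_def sX)
      next
        case False
        then have "\<psi> e = undefined" using \<psi> unfolding P_def by (rule PiE_arb[rotated])
        then show ?thesis using False by (auto simp: even_colour_def E_def sX)
      qed
    qed
    have e2: "odd_colour l G X I = \<phi>"
    proof
      fix e
      show "odd_colour l G X I e = \<phi> e"
      proof (cases "e \<in> F")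
        case True
        then obtain a b where ab: "e = {a, b}" "a \<in> I" "b \<notin> I" using edge2 by blast
        have "e \<inter> X \<subseteq> I \<longleftrightarrow> \<phi> e = l + 1"
          using memF[OF True, of a] memF[OF True, of b] ab by auto
        moreover have "\<phi> e = 1 \<or> \<phi> e = l + 1" using \<phi> True by (auto simp: Q_def)
        ultimately show ?thesis using True by (auto simp: odd_colour_def sX)
      next
        case False
        then have "\<phi> e = undefined" using \<phi> unfolding Q_def by (rule PiE_arb[rotated])
        then show ?thesis using False by (auto simp: odd_colour_def sX)
      qed
    qed
    show "(even_colour G (case c of (\<psi>, \<phi>) \<Rightarrow> {a \<in> halves G. if edge_of G a \<in> F then \<phi> (edge_of G a) = l + 1 \<longleftrightarrow> a \<in> I else \<psi> (edge_of G a) = 2}),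
       odd_colour l G (case c of (\<psi>, \<phi>) \<Rightarrow> {a \<in> halves G. if edge_of G a \<in> F then \<phi> (edge_of G a) = l + 1 \<longleftrightarrow> a \<in> I else \<psi> (edge_of G a) = 2}) I) = c"
      unfolding c prod.case X_def[symmetric] e1 e2 by (rule refl)
    show "arc_term \<theta> G (case c of (\<psi>, \<phi>) \<Rightarrow> {a \<in> halves G. if edge_of G a \<in> F then \<phi> (edge_of G a) = l + 1 \<longleftrightarrow> a \<in> I else \<psi> (edge_of G a) = 2}) =
      (case c of (\<psi>, \<phi>) \<Rightarrow> (-1) ^ num_circuits G I \<kappa> * W \<psi> \<phi>)"
      unfolding c prod.case X_def[symmetric] W_def
      using arc_term_colouring[OF l, of \<theta>] unfolding e1 e2 sX by (rule sym)
  qed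
  finally show ?thesis unfolding W_def S_def E_def .
qed

theorem partition_function_char_det:
  assumes G: "is_graph G" and l: "l \<ge> 1" and k: "k \<ge> 2"
  shows "partition_function k l (char_functional l \<theta>) G = (of_nat k - of_nat (2 * l)) ^ circles G * char_det \<theta> G"
proof -
  define T where "T = {F. eulerian G F}"
  have finT: "finite T"
    by (rule finite_subset[of _ "Pow (edges G)"]) (use finite_graph[OF G] in \<open>auto simp: T_def eulerian_def\<close>)
  have "(\<Sum>F\<in>T. let (I, \<kappa>) = chosen_pairing G F in
       (-1) ^ num_circuits G I \<kappa> *
       (\<Sum>\<psi> \<in> (edges G - F) \<rightarrow>\<^sub>E {1..k}. \<Sum>\<phi> \<in> F \<rightarrow>\<^sub>E {1..2 * l}.
          \<Prod>v\<in>verts G. vertex_weight l (char_functional l \<theta>) G F I \<kappa> \<psi> \<phi> v)) =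
     (\<Sum>F\<in>T. \<Sum>X\<in>{X \<in> Pow (halves G). split_edges G X = F}. arc_term \<theta> G X)"
  proof (rule sum.cong[OF refl])
    fix F assume F: "F \<in> T"
    obtain I \<kappa> where IK: "chosen_pairing G F = (I, \<kappa>)" by fastforce
    have e: "eulerian G F" using F by (simp add: T_def)
    show "(let (I, \<kappa>) = chosen_pairing G F in
       (-1) ^ num_circuits G I \<kappa> *
       (\<Sum>\<psi> \<in> (edges G - F) \<rightarrow>\<^sub>E {1..k}. \<Sum>\<phi> \<in> F \<rightarrow>\<^sub>E {1..2 * l}.
          \<Prod>v\<in>verts G. vertex_weight l (char_functional l \<theta>) G F I \<kappa> \<psi> \<phi> v)) =
     (\<Sum>X\<in>{X \<in> Pow (halves G). split_edges G X = F}. arc_term \<theta> G X)"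
      unfolding IK Let_def prod.case
      by (rule colour_sum_arcs[OF G _ l k chosen_pairing[OF G e IK]]) (use e in \<open>simp add: eulerian_def\<close>)
  qed
  also have "\<dots> = (\<Sum>F\<in>T. \<Sum>X\<in>{X \<in> {X \<in> Pow (halves G). eulerian G (split_edges G X)}. split_edges G X = F}. arc_term \<theta> G X)"
    by (intro sum.cong refl) (auto simp: T_def)
  also have "\<dots> = (\<Sum>X\<in>{X \<in> Pow (halves G). eulerian G (split_edges G X)}. arc_term \<theta> G X)"
    by (rule sum.group) (use finT finite_graph[OF G] in \<open>auto simp: T_def\<close>)
  also have "\<dots> = (\<Sum>X\<in>Pow (halves G). arc_term \<theta> G X)"
    by (rule sum.mono_neutral_left) (use finite_graph[OF G] arc_term_not_eulerian[OF G] in auto)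
  finally show ?thesis
    unfolding partition_function_def char_det_arcs[OF G] T_def by simp
qed

section \<open>Gluing as elimination in a determinant\<close>

definition linked :: "(nat \<times> nat) list \<Rightarrow> nat set" where
  "linked ps = fst ` set ps \<union> snd ` set ps"

text \<open>
  A determinant for a graph whose labelled vertices are still to be glued in the pairs \<open>ps\<close>. Labelled
  vertices have diagonal entry 0 instead of \<open>\<theta>\<close>, since they disappear in the gluing, and each
  pair of vertices to be glued receives an additional entry 1.
\<close>

definition link_matrix :: "complex \<Rightarrow> mgraph \<Rightarrow> (nat \<times> nat) list \<Rightarrow> nat \<Rightarrow> nat \<Rightarrow> complex" where
  "link_matrix \<theta> H ps x y = (if x = y \<and> x \<notin> linked ps then \<theta> else 0) - of_nat (adj H x y)
     + (if (x, y) \<in> set ps \<or> (y, x) \<in> set ps then 1 else 0)"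

text \<open>
  The factor \<open>0 ^ circles\<close> is the value of the free circles when \<open>k = 2l\<close>.
\<close>

definition link_det :: "complex \<Rightarrow> mgraph \<Rightarrow> (nat \<times> nat) list \<Rightarrow> complex" where
  "link_det \<theta> H ps = 0 ^ circles H * det_on (verts H) (link_matrix \<theta> H ps)"

definition linkable :: "mgraph \<Rightarrow> (nat \<times> nat) list \<Rightarrow> bool" where
  "linkable H ps \<longleftrightarrow> is_graph H \<and> distinct (map fst ps @ map snd ps) \<and>
     linked ps \<subseteq> verts H \<and> (\<forall>x\<in>linked ps. deg H x = 1)"

lemma link_det_Nil: "link_det \<theta> H [] = 0 ^ circles H * char_det \<theta> H"
  unfolding link_det_def char_det_def
  by (intro arg_cong2[where f = "(*)"] det_on_cong) (auto simp: link_matrix_def linked_def)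

lemma link_matrix_sym: "is_graph H \<Longrightarrow> link_matrix \<theta> H ps x y = link_matrix \<theta> H ps y x"
  by (auto simp: link_matrix_def adj_sym[of H x y])

text \<open>
  Let \<open>w\<close> and \<open>z\<close> be the neighbours of \<open>u\<close> and \<open>v\<close>. Rows \<open>u\<close> and \<open>v\<close> are \<open>e\<^sub>v - e\<^sub>w\<close> and \<open>e\<^sub>u - e\<^sub>z\<close>. Adding row
  \<open>v\<close> to row \<open>w\<close> and row \<open>u\<close> to row \<open>z\<close> clears columns \<open>u\<close> and \<open>v\<close> in the other rows and creates entries \<open>-1\<close> at \<open>(w, z)\<close> and \<open>(z, w)\<close>: the
  adjacency of the unified edge. Deleting \<open>u\<close> and \<open>v\<close> then costs the factor \<open>-1\<close>. If the two open
  ends lie on one edge, then \<open>w = v\<close>, row \<open>u\<close> is zero, and the glued graph has a free circle.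
\<close>

lemma link_det_glue_ends:
  assumes lk: "linkable H ((u, v) # qs)"
  shows "linkable (glue_ends u v H) qs \<and> link_det \<theta> H ((u, v) # qs) = - link_det \<theta> (glue_ends u v H) qs"
proof -
  define ps where "ps = (u, v) # qs"
  define H' where "H' = glue_ends u v H"
  define V where "V = verts H"
  have H: "is_graph H" and dist: "distinct (map fst ps @ map snd ps)" and LV: "linked ps \<subseteq> V"
    and deg1: "\<And>x. x \<in> linked ps \<Longrightarrow> deg H x = 1" using lk by (auto simp: linkable_def ps_def V_def)
  have finV: "finite V" using finite_graph[OF H] by (simp add: V_def)
  have finH: "finite (halves H)" using finite_graph[OF H] by simp
  have L: "linked ps = {u, v} \<union> linked qs" by (auto simp: linked_def ps_def)
  have uv: "u \<noteq> v" "u \<notin> linked qs" "v \<notin> linked qs" using dist by (force simp: ps_def linked_def)+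
  have uvV: "u \<in> V" "v \<in> V" using LV L by auto
  have "card (halves_at H u) = 1" "card (halves_at H v) = 1" using deg1[of u] deg1[of v] L by (auto simp: deg_def)
  then obtain a b where a: "halves_at H u = {a}" and b: "halves_at H v = {b}" by (auto simp: card_1_singleton_iff)
  have ab: "a \<in> halves H" "b \<in> halves H" "inc H a = u" "inc H b = v" "a \<noteq> b"
    using a b uv by (auto simp: halves_at_def)
  have at_u: "c = a" if "c \<in> halves H" "inc H c = u" for c
    using that a unfolding halves_at_def by blast
  have at_v: "c = b" if "c \<in> halves H" "inc H c = v" for c
    using that b unfolding halves_at_def by blast
  note mate = mate_in[OF H] edge_of_mate(2)[OF H] mate_mate[OF H]
  define d where "d = edge_of H a"
  define e where "e = edge_of H b"
  have d: "d = {a, mate H a}" and e: "e = {b, mate H b}"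
    using edge_of_mate(1)[OF H] ab by (auto simp: d_def e_def)
  have H'_eq: "H' = \<lparr> verts = V - {u, v}, halves = halves H - {a, b}, inc = inc H,
          edges = (edges H - {d, e}) \<union> (if d = e then {} else {(d \<union> e) - {a, b}}),
          circles = circles H + (if d = e then 1 else 0) \<rparr>"
    by (simp add: H'_def glue_ends_def a b d_def e_def V_def Let_def)
  \<comment> \<open>The involution of the half-edges of the glued graph when the open ends lie on different edges.\<close>
  define \<mu> where "\<mu> = (\<lambda>c. if c = mate H a then mate H b else if c = mate H b then mate H a else mate H c)"
  have E: "edges H = (\<lambda>c. {c, mate H c}) ` halves H" by (rule edges_image[OF H])
  have inc': "inc H c \<in> V - {u, v}" if "c \<in> halves H - {a, b}" for c
    using that inc_in[OF H, of c] at_u[of c] at_v[of c] by (auto simp: V_def)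
  have deg': "halves_at H' x = halves_at H x" if "x \<noteq> u" "x \<noteq> v" for x
    using that ab by (auto simp: halves_at_def H'_eq)
  have "distinct (map fst qs @ map snd qs)" using dist by (simp add: ps_def)
  moreover have "linked qs \<subseteq> verts H'" using LV L uv by (simp add: H'_eq) blast
  moreover have "\<forall>x\<in>linked qs. deg H' x = 1"
  proof
    fix x assume x: "x \<in> linked qs"
    then have "x \<noteq> u" "x \<noteq> v" using uv by auto
    then show "deg H' x = 1" using deg1[of x] deg'[of x] x L by (simp add: deg_def)
  qed
  ultimately have Lk: "distinct (map fst qs @ map snd qs)" "linked qs \<subseteq> verts H'"
    "\<forall>x\<in>linked qs. deg H' x = 1" by simp_all
  have link_u: "(u, y) \<in> set ps \<or> (y, u) \<in> set ps \<longleftrightarrow> y = v"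
    and link_v: "(v, y) \<in> set ps \<or> (y, v) \<in> set ps \<longleftrightarrow> y = u" for y
    using uv by (force simp: ps_def linked_def)+
  have iu: "(c \<in> halves H \<and> inc H c = u) = (c = a)" and iv: "(c \<in> halves H \<and> inc H c = v) = (c = b)" for c
    using ab at_u at_v by blast+
  define w where "w = inc H (mate H a)"
  define z where "z = inc H (mate H b)"
  have "{c \<in> halves H. inc H c = u \<and> inc H (mate H c) = y} = (if y = w then {a} else {})" for y
    unfolding conj_assoc[symmetric] iu w_def by auto
  then have adj_u: "adj H u y = (if y = w then 1 else 0)" for y by (simp add: adj_def)
  have "{c \<in> halves H. inc H c = v \<and> inc H (mate H c) = y} = (if y = z then {b} else {})" for y
    unfolding conj_assoc[symmetric] iv z_def by auto
  then have adj_v: "adj H v y = (if y = z then 1 else 0)" for y by (simp add: adj_def)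
  define N where "N = link_matrix \<theta> H ps"
  have Nu: "N u y = (if y = v then 1 else 0) - (if y = w then 1 else 0)" for y
    using link_u[of y] L by (auto simp: N_def link_matrix_def adj_u)
  have Nv: "N v y = (if y = u then 1 else 0) - (if y = z then 1 else 0)" for y
    using link_v[of y] L by (auto simp: N_def link_matrix_def adj_v)
  have Nsym: "N x y = N y x" for x y unfolding N_def by (rule link_matrix_sym[OF H])
  show ?thesis
  proof (cases "d = e")
    case True
    then have mab: "mate H a = b" "mate H b = a" using d e ab(5) by (auto simp: doubleton_eq_iff)
    have "is_graph H'"
    proof (rule graph_of_involution(1)[where \<mu> = "mate H"])
      have "(\<lambda>c. {c, mate H c}) ` (halves H - {a, b}) = edges H - {d}"
      proof (intro subset_antisym subsetI)
        fix x assume "x \<in> (\<lambda>c. {c, mate H c}) ` (halves H - {a, b})"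
        then obtain c where c: "c \<in> halves H" "c \<noteq> a" "c \<noteq> b" "x = {c, mate H c}" by auto
        then show "x \<in> edges H - {d}" using E d mab by (auto simp: doubleton_eq_iff)
      next
        fix x assume x: "x \<in> edges H - {d}"
        then obtain c where c: "c \<in> halves H" "x = {c, mate H c}" using E by auto
        then have "c \<noteq> a" "c \<noteq> b" using x d mab by auto
        then show "x \<in> (\<lambda>c. {c, mate H c}) ` (halves H - {a, b})" using c by auto
      qed
      then show "edges H' = (\<lambda>c. {c, mate H c}) ` halves H'" using True by (simp add: H'_eq)
      show "mate H c \<in> halves H' \<and> mate H c \<noteq> c \<and> mate H (mate H c) = c" if "c \<in> halves H'" for c
      proof -
        have c: "c \<in> halves H" "c \<noteq> a" "c \<noteq> b" using that by (auto simp: H'_eq)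
        then have "mate H c \<noteq> a" "mate H c \<noteq> b" using mate(3)[OF c(1)] mab by auto
        then show ?thesis using mate c by (simp add: H'_eq)
      qed
    qed (use finV finH inc' in \<open>auto simp: H'_eq\<close>)
    moreover have "w = v" using mab ab by (simp add: w_def)
    then have "det_on V N = 0" using Nu finV uvV by (intro det_on_zero_row[of _ u]) auto
    moreover have "circles H' \<noteq> 0" using True by (simp add: H'_eq)
    ultimately show ?thesis using Lk unfolding H'_def[symmetric] ps_def[symmetric]
      by (simp add: linkable_def link_det_def N_def V_def)
  next
    case False
    have mab: "mate H a \<noteq> b" "mate H b \<noteq> a" using False d e mate(3) ab by (auto simp: insert_commute)
    have maa: "mate H a \<noteq> a" "mate H b \<noteq> b" using mate(2) ab by auto
    have mne: "mate H a \<noteq> mate H b" using mate(3) ab by metis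
    have \<mu>: "\<mu> c \<in> halves H' \<and> \<mu> c \<noteq> c \<and> \<mu> (\<mu> c) = c" if "c \<in> halves H'" for c
    proof -
      have c: "c \<in> halves H" "c \<noteq> a" "c \<noteq> b" using that by (auto simp: H'_eq)
      show ?thesis
      proof (cases "c = mate H a \<or> c = mate H b")
        case True
        then show ?thesis using mne mab maa mate(1) ab by (auto simp: \<mu>_def H'_eq)
      next
        case F: False
        have "mate H c \<noteq> a" "mate H c \<noteq> b" "mate H c \<noteq> mate H a" "mate H c \<noteq> mate H b"
          using F c mate(3)[OF c(1)] mate(3)[OF ab(1)] mate(3)[OF ab(2)] by metis+
        then show ?thesis using F c mate by (auto simp: \<mu>_def H'_eq)
      qed
    qed
    have E': "edges H' = (\<lambda>c. {c, \<mu> c}) ` halves H'"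
    proof (intro subset_antisym subsetI)
      fix x assume "x \<in> edges H'"
      then consider "x \<in> edges H" "x \<noteq> d" "x \<noteq> e" | "x = (d \<union> e) - {a, b}" using False by (auto simp: H'_eq)
      then show "x \<in> (\<lambda>c. {c, \<mu> c}) ` halves H'"
      proof cases
        case 1
        then obtain c where c: "c \<in> halves H" "x = {c, mate H c}" using E by auto
        have "c \<noteq> a" "c \<noteq> b" "c \<noteq> mate H a" "c \<noteq> mate H b"
          using 1 c d e mate(3) ab by (auto simp: insert_commute)
        then have "c \<in> halves H'" "x = {c, \<mu> c}" using c by (auto simp: H'_eq \<mu>_def)
        then show ?thesis by blast
      next
        case 2
        then have "x = {mate H a, mate H b}" using d e mab maa by auto
        moreover have "mate H a \<in> halves H'" using mate(1) ab mab maa by (auto simp: H'_eq)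
        ultimately show ?thesis by (auto simp: \<mu>_def)
      qed
    next
      fix x assume "x \<in> (\<lambda>c. {c, \<mu> c}) ` halves H'"
      then obtain c where c: "c \<in> halves H" "c \<noteq> a" "c \<noteq> b" "x = {c, \<mu> c}" by (auto simp: H'_eq)
      have new: "(d \<union> e) - {a, b} = {mate H a, mate H b}" using d e mab maa by auto
      show "x \<in> edges H'"
      proof (cases "c = mate H a \<or> c = mate H b")
        case True
        then have "x = {mate H a, mate H b}" using c by (auto simp: \<mu>_def)
        then show ?thesis using new False by (simp add: H'_eq)
      next
        case F: False
        then have x: "x = {c, mate H c}" using c by (simp add: \<mu>_def)
        then have "x \<in> edges H" using E c by auto
        moreover have "x \<noteq> d" "x \<noteq> e" using x c F d e by (auto simp: doubleton_eq_iff)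
        ultimately show ?thesis by (simp add: H'_eq)
      qed
    qed
    have G': "is_graph H'" and m': "\<And>c. c \<in> halves H' \<Longrightarrow> mate H' c = \<mu> c"
      using graph_of_involution[of H' \<mu>] finV finH inc' \<mu> E' by (auto simp: H'_eq)
    have wz: "w \<in> V" "z \<in> V" using inc_in[OF H mate(1)] ab by (auto simp: w_def z_def V_def)
    have "w \<noteq> u" "w \<noteq> v" "z \<noteq> u" "z \<noteq> v"
      using at_u[of "mate H a"] at_v[of "mate H a"] at_u[of "mate H b"] at_v[of "mate H b"]
        mate(1)[OF ab(1)] mate(1)[OF ab(2)] mab maa unfolding w_def z_def by blast+
    note wz = wz this
    \<comment> \<open>Both summands count when \<open>x = y = w = z\<close>: the unified edge is then a loop.\<close>
    have adj': "adj H' x y = adj H x y + (if x = w \<and> y = z then 1 else 0) + (if x = z \<and> y = w then 1 else 0)"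
      if x: "x \<in> V - {u, v}" and y: "y \<in> V - {u, v}" for x y
    proof -
      define C where "C = {c \<in> halves H. inc H c = x \<and> inc H (mate H c) = y}"
      have C1: "c \<notin> {a, b, mate H a, mate H b}" if "c \<in> C" for c
        using that x y ab mate(3) by (auto simp: C_def)
      define A1 where "A1 = {m. m = mate H a \<and> x = w \<and> y = z}"
      define A2 where "A2 = {m. m = mate H b \<and> x = z \<and> y = w}"
      have i: "inc H' = inc H" by (simp add: H'_eq)
      have new: "mate H a \<in> halves H'" "mate H b \<in> halves H'"
        using mate(1)[OF ab(1)] mate(1)[OF ab(2)] mab maa by (simp_all add: H'_eq)
      have nC: "mate H a \<notin> C" "mate H b \<notin> C" using C1 by blast+
      have "{c \<in> halves H'. inc H' c = x \<and> inc H' (mate H' c) = y} = C \<union> A1 \<union> A2"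
      proof (rule Set.set_eqI)
        fix c
        consider "c \<notin> halves H'" | "c = mate H a" | "c = mate H b" | "c \<in> halves H'" "c \<noteq> mate H a" "c \<noteq> mate H b"
          by blast
        then show "c \<in> {c \<in> halves H'. inc H' c = x \<and> inc H' (mate H' c) = y} \<longleftrightarrow> c \<in> C \<union> A1 \<union> A2"
        proof cases
          case 1
          have "c \<notin> C"
          proof
            assume "c \<in> C"
            then have "c \<in> halves H'" using C1[of c] by (simp add: H'_eq C_def)
            then show False using 1 by simp
          qed
          then show ?thesis using 1 new by (auto simp: A1_def A2_def)
        next
          case 2
          then have "mate H' c = mate H b" using m'[of c] new by (simp add: \<mu>_def)
          then show ?thesis using 2 nC mne new(1) by (auto simp: A1_def A2_def i w_def z_def)
        next
          case 3
          then have "mate H' c = mate H a" using m'[of c] new mne by (simp add: \<mu>_def)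
          then show ?thesis using 3 nC mne new(2) by (auto simp: A1_def A2_def i w_def z_def)
        next
          case 4
          then have "mate H' c = mate H c" using m'[of c] by (simp add: \<mu>_def)
          moreover have "c \<in> halves H" using 4 by (simp add: H'_eq)
          ultimately show ?thesis using 4 by (simp add: A1_def A2_def C_def i)
        qed
      qed
      moreover have "card (C \<union> A1 \<union> A2) = card (C \<union> A1) + card A2"
        using finH nC mne by (intro card_Un_disjoint) (auto simp: C_def A1_def A2_def)
      moreover have "card (C \<union> A1) = card C + card A1"
        using finH nC by (intro card_Un_disjoint) (auto simp: C_def A1_def)
      moreover have "card A1 = (if x = w \<and> y = z then 1 else 0)" "card A2 = (if x = z \<and> y = w then 1 else 0)"
        by (auto simp: A1_def A2_def)
      ultimately show ?thesis unfolding adj_def C_def by simp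
    qed
    define B1 where "B1 = (\<lambda>x y. if x = w then N w y + N v y else N x y)"
    define B where "B = (\<lambda>x y. if x = z then B1 z y + B1 u y else B1 x y)"
    have B: "B x y = N x y + (if x = w then N v y else 0) + (if x = z then N u y else 0)" for x y
      using wz by (auto simp: B_def B1_def)
    have "det_on V N = det_on V B1"
      unfolding B1_def using wz uvV finV by (intro det_on_add_row[symmetric]) auto
    also have "\<dots> = det_on V B"
      unfolding B_def using wz uvV finV by (intro det_on_add_row[symmetric]) auto
    also have "\<dots> = det_on V (\<lambda>x y. B y x)" using det_on_transpose[OF finV, of B] by simp
    also have "\<dots> = - det_on (V - {u, v}) (\<lambda>x y. B y x)"
    proof (rule det_on_eliminate_pair[OF finV uvV uv(1)])
      fix x
      show "B x u = (if x = v then 1 else 0)"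
        using wz uv(1) Nsym[of x u] Nu Nv unfolding B by auto
      show "B x v = (if x = u then 1 else 0)"
        using wz uv(1) Nsym[of x v] Nu Nv unfolding B by auto
    qed
    also have "det_on (V - {u, v}) (\<lambda>x y. B y x) = det_on (V - {u, v}) B"
      by (rule det_on_transpose) (use finV in simp)
    also have "\<dots> = det_on (V - {u, v}) (link_matrix \<theta> H' qs)"
    proof (rule det_on_cong)
      fix x y assume x: "x \<in> V - {u, v}" and y: "y \<in> V - {u, v}"
      have ll: "(x, y) \<in> set ps \<or> (y, x) \<in> set ps \<longleftrightarrow> (x, y) \<in> set qs \<or> (y, x) \<in> set qs"
        "x \<in> linked ps \<longleftrightarrow> x \<in> linked qs" using x y L by (auto simp: ps_def)
      have "B x y = N x y - (if x = w \<and> y = z then 1 else 0) - (if x = z \<and> y = w then 1 else 0)"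
      proof -
        have "N v y = - (if y = z then 1 else 0)" "N u y = - (if y = w then 1 else 0)"
          using Nv[of y] Nu[of y] y by simp_all
        then have "(if x = w then N v y else 0) = - (if x = w \<and> y = z then 1 else 0)"
          "(if x = z then N u y else 0) = - (if x = z \<and> y = w then 1 else 0)" by simp_all
        then show ?thesis unfolding B by (simp only: diff_conv_add_uminus)
      qed
      also have "\<dots> = link_matrix \<theta> H' qs x y"
      proof -
        have "of_nat (m + (if P then 1 else 0) + (if Q then 1 else 0)) =
            (of_nat m + (if P then 1 else 0) + (if Q then 1 else 0) :: complex)" for m P Q by simp
        then have e1: "(of_nat (adj H' x y) :: complex) = of_nat (adj H x y) + (if x = w \<and> y = z then 1 else 0) + (if x = z \<and> y = w then 1 else 0)"
          unfolding adj'[OF x y] .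
        have ar: "D - m + k - i - j = D - (m + i + j) + k" for D m k i j :: complex by simp
        have lhs: "N x y = (if x = y \<and> x \<notin> linked qs then \<theta> else 0) - of_nat (adj H x y)
            + (if (x, y) \<in> set qs \<or> (y, x) \<in> set qs then 1 else 0)"
          unfolding N_def link_matrix_def ll by (rule refl)
        have rhs: "link_matrix \<theta> H' qs x y = (if x = y \<and> x \<notin> linked qs then \<theta> else 0) - of_nat (adj H' x y)
            + (if (x, y) \<in> set qs \<or> (y, x) \<in> set qs then 1 else 0)"
          by (rule link_matrix_def)
        show ?thesis unfolding lhs rhs e1 by (rule ar)
      qed
      finally show "B x y = link_matrix \<theta> H' qs x y" .
    qed
    finally have "det_on V N = - det_on (V - {u, v}) (link_matrix \<theta> H' qs)" .
    moreover have "verts H' = V - {u, v}" "circles H' = circles H" using False by (auto simp: H'_eq)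
    ultimately show ?thesis using Lk G' unfolding H'_def[symmetric] ps_def[symmetric]
      by (simp add: linkable_def link_det_def N_def V_def)
  qed
qed

lemma link_det_fold:
  assumes "linkable H ps"
  shows "is_graph (fold (\<lambda>(u, v). glue_ends u v) ps H) \<and>
    link_det \<theta> H ps = (-1) ^ length ps * link_det \<theta> (fold (\<lambda>(u, v). glue_ends u v) ps H) []"
  using assms
proof (induction ps arbitrary: H)
  case Nil
  then show ?case by (simp add: linkable_def)
next
  case (Cons p qs)
  obtain u v where p: "p = (u, v)" by fastforce
  show ?case using link_det_glue_ends[of H u v qs \<theta>] Cons.IH[of "glue_ends u v H"] Cons.prems by (simp add: p)
qed

abbreviation "lft x \<equiv> sum_encode (Inl x)"
abbreviation "rgt x \<equiv> sum_encode (Inr x)"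

lemma enc_simps: "lft x = lft y \<longleftrightarrow> x = y" "rgt x = rgt y \<longleftrightarrow> x = y" "lft x \<noteq> rgt y" "rgt y \<noteq> lft x"
  using sum_encode_eq by auto

lemma disjoint_union_simps:
  "verts (disjoint_union F G) = lft ` verts F \<union> rgt ` verts G"
  "halves (disjoint_union F G) = lft ` halves F \<union> rgt ` halves G"
  "inc (disjoint_union F G) (lft a) = lft (inc F a)"
  "inc (disjoint_union F G) (rgt a) = rgt (inc G a)"
  "circles (disjoint_union F G) = circles F + circles G"
  by (auto simp: disjoint_union_def Plus_def image_Un image_image)

lemma disjoint_union_graph:
  assumes F: "is_graph F" and G: "is_graph G"
  shows "is_graph (disjoint_union F G)"
    "\<And>a. a \<in> halves F \<Longrightarrow> mate (disjoint_union F G) (lft a) = lft (mate F a)"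
    "\<And>a. a \<in> halves G \<Longrightarrow> mate (disjoint_union F G) (rgt a) = rgt (mate G a)"
proof -
  define D where "D = disjoint_union F G"
  define \<mu> where "\<mu> = (\<lambda>c. case sum_decode c of Inl a \<Rightarrow> lft (mate F a) | Inr a \<Rightarrow> rgt (mate G a))"
  have \<mu>_simps: "\<mu> (lft a) = lft (mate F a)" "\<mu> (rgt a) = rgt (mate G a)" for a by (auto simp: \<mu>_def)
  note [simp] = enc_simps
  have E: "edges D = (\<lambda>c. {c, \<mu> c}) ` halves D"
    unfolding D_def disjoint_union_simps
    by (simp add: disjoint_union_def edges_image[OF F] edges_image[OF G] image_Un image_image \<mu>_simps)
  have *: "\<mu> c \<in> halves D \<and> \<mu> c \<noteq> c \<and> \<mu> (\<mu> c) = c" if "c \<in> halves D" for c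
  proof -
    have "c \<in> lft ` halves F \<union> rgt ` halves G" using that by (simp add: D_def disjoint_union_simps)
    then show ?thesis
      using mate_in[OF F] mate_in[OF G] edge_of_mate(2)[OF F] edge_of_mate(2)[OF G] mate_mate[OF F] mate_mate[OF G]
      by (auto simp: D_def disjoint_union_simps \<mu>_simps)
  qed
  have fin: "finite (verts D)" "finite (halves D)" "\<And>c. c \<in> halves D \<Longrightarrow> inc D c \<in> verts D"
    using finite_graph[OF F] finite_graph[OF G] inc_in[OF F] inc_in[OF G]
    by (auto simp: D_def disjoint_union_simps)
  show "is_graph (disjoint_union F G)"
    using graph_of_involution(1)[OF fin * E] by (simp add: D_def)
  show "\<And>a. a \<in> halves F \<Longrightarrow> mate (disjoint_union F G) (lft a) = lft (mate F a)"
    "\<And>a. a \<in> halves G \<Longrightarrow> mate (disjoint_union F G) (rgt a) = rgt (mate G a)"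
    using graph_of_involution(2)[OF fin * E] by (auto simp: D_def disjoint_union_simps \<mu>_simps)
qed

lemma disjoint_union_adj:
  assumes F: "is_graph F" and G: "is_graph G"
  shows "adj (disjoint_union F G) (lft x) (lft y) = adj F x y"
    "adj (disjoint_union F G) (rgt x) (rgt y) = adj G x y"
    "adj (disjoint_union F G) (lft x) (rgt y) = 0"
    "adj (disjoint_union F G) (rgt y) (lft x) = 0"
    "deg (disjoint_union F G) (lft x) = deg F x"
    "deg (disjoint_union F G) (rgt x) = deg G x"
proof -
  note m = disjoint_union_graph(2,3)[OF F G]
  note [simp] = enc_simps
  have "{a \<in> halves (disjoint_union F G). inc (disjoint_union F G) a = lft x \<and>
      inc (disjoint_union F G) (mate (disjoint_union F G) a) = lft y} =
      lft ` {a \<in> halves F. inc F a = x \<and> inc F (mate F a) = y}"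
    using m by (auto simp: disjoint_union_simps)
  then show "adj (disjoint_union F G) (lft x) (lft y) = adj F x y"
    unfolding adj_def by (simp add: card_image inj_on_def)
  have "{a \<in> halves (disjoint_union F G). inc (disjoint_union F G) a = rgt x \<and>
      inc (disjoint_union F G) (mate (disjoint_union F G) a) = rgt y} =
      rgt ` {a \<in> halves G. inc G a = x \<and> inc G (mate G a) = y}"
    using m by (auto simp: disjoint_union_simps)
  then show "adj (disjoint_union F G) (rgt x) (rgt y) = adj G x y"
    unfolding adj_def by (simp add: card_image inj_on_def)
  have "{a \<in> halves (disjoint_union F G). inc (disjoint_union F G) a = lft x \<and>
      inc (disjoint_union F G) (mate (disjoint_union F G) a) = rgt y} = {}"
    using m by (auto simp: disjoint_union_simps)
  then show "adj (disjoint_union F G) (lft x) (rgt y) = 0" unfolding adj_def by (simp only: card.empty)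
  then show "adj (disjoint_union F G) (rgt y) (lft x) = 0"
    using adj_sym[OF disjoint_union_graph(1)[OF F G]] by simp
  have "halves_at (disjoint_union F G) (lft x) = lft ` halves_at F x"
    by (auto simp: halves_at_def disjoint_union_simps)
  then show "deg (disjoint_union F G) (lft x) = deg F x" by (simp add: deg_def card_image inj_on_def)
  have "halves_at (disjoint_union F G) (rgt x) = rgt ` halves_at G x"
    by (auto simp: halves_at_def disjoint_union_simps)
  then show "deg (disjoint_union F G) (rgt x) = deg G x" by (simp add: deg_def card_image inj_on_def)
qed

definition end_pairs :: "nat list \<Rightarrow> nat list \<Rightarrow> (nat \<times> nat) list" where
  "end_pairs us vs = map (\<lambda>(u, v). (lft u, rgt v)) (zip us vs)"

lemma glue_link_det:
  assumes F: "(F, us) \<in> fragments t" and G: "(G, vs) \<in> fragments t"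
  shows "is_graph (glue (F, us) (G, vs)) \<and>
    0 ^ circles (glue (F, us) (G, vs)) * char_det \<theta> (glue (F, us) (G, vs)) =
      (-1) ^ t * link_det \<theta> (disjoint_union F G) (end_pairs us vs)"
proof -
  define D where "D = disjoint_union F G"
  note [simp] = enc_simps
  have f: "is_graph F" "length us = t" "distinct us" "set us \<subseteq> verts F" "\<forall>u\<in>set us. deg F u = 1"
    and g: "is_graph G" "length vs = t" "distinct vs" "set vs \<subseteq> verts G" "\<forall>u\<in>set vs. deg G u = 1"
    using F G by (auto simp: fragments_def)
  have fs: "map fst (end_pairs us vs) = map lft us" "map snd (end_pairs us vs) = map rgt vs"
    using f(2) g(2) by (auto simp: end_pairs_def comp_def case_prod_unfold map_fst_zip map_snd_zip
        simp flip: map_map[of lft fst, unfolded comp_def] map_map[of rgt snd, unfolded comp_def])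
  have lk: "linked (end_pairs us vs) = lft ` set us \<union> rgt ` set vs"
    using arg_cong[OF fs(1), of set] arg_cong[OF fs(2), of set] by (simp add: linked_def)
  have "linkable D (end_pairs us vs)"
    unfolding linkable_def lk fs
  proof (intro conjI)
    show "is_graph D" unfolding D_def by (rule disjoint_union_graph(1)[OF f(1) g(1)])
    show "distinct (map lft us @ map rgt vs)" using f(3) g(3) by (auto simp: distinct_map inj_on_def)
    show "lft ` set us \<union> rgt ` set vs \<subseteq> verts D" using f(4) g(4) by (auto simp: D_def disjoint_union_simps)
    show "\<forall>x\<in>lft ` set us \<union> rgt ` set vs. deg D x = 1"
      using f(5) g(5) disjoint_union_adj(5,6)[OF f(1) g(1)] by (auto simp: D_def)
  qed
  from link_det_fold[OF this, of \<theta>]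
  have *: "is_graph (fold (\<lambda>(u, v). glue_ends u v) (end_pairs us vs) D)"
    "link_det \<theta> D (end_pairs us vs) = (-1) ^ length (end_pairs us vs) *
       link_det \<theta> (fold (\<lambda>(u, v). glue_ends u v) (end_pairs us vs) D) []" by auto
  have "glue (F, us) (G, vs) = fold (\<lambda>(u, v). glue_ends u v) (end_pairs us vs) D"
    by (simp add: glue_def end_pairs_def fold_map D_def comp_def case_prod_unfold)
  then show ?thesis using * f(2) g(2)
    by (simp add: link_det_Nil D_def end_pairs_def flip: mult.assoc power_add power_mult_distrib)
qed

section \<open>State sums for glued fragments\<close>

text \<open>
  Row \<open>x\<close> with \<open>x \<in> P\<close> is replaced by the unit vector at \<open>c x\<close>, so the determinant is a signed minor
  of \<open>A\<close>. Keeping the full index set makes the sign of the minor part of the determinant.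
\<close>

definition replace_rows :: "nat set \<Rightarrow> (nat \<Rightarrow> nat) \<Rightarrow> (nat \<Rightarrow> nat \<Rightarrow> complex) \<Rightarrow> nat \<Rightarrow> nat \<Rightarrow> complex" where
  "replace_rows P c A x y = (if x \<in> P then if y = c x then 1 else 0 else A x y)"

text \<open>
  For a symmetric matrix the minor that deletes the rows \<open>P\<close> and the columns \<open>Q\<close> equals the
  one that deletes the rows \<open>Q\<close> and the columns \<open>P\<close>. In terms of permutations: \<open>p\<close> contributes on
  either side only if it extends \<open>c\<close>, and then both products agree factor by factor.
\<close>

lemma det_on_replace_rows_inverse:
  assumes fin: "finite V" and sub: "P \<subseteq> V" "Q \<subseteq> V" and c: "\<And>x. x \<in> P \<Longrightarrow> c x \<in> Q \<and> d (c x) = x"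
    and d: "\<And>y. y \<in> Q \<Longrightarrow> d y \<in> P \<and> c (d y) = y" and sym: "\<And>x y. x \<in> V \<Longrightarrow> y \<in> V \<Longrightarrow> A x y = A y x"
  shows "det_on V (replace_rows P c A) = det_on V (replace_rows Q d A)"
proof -
  have "det_on V (replace_rows P c A) = det_on V (\<lambda>x y. replace_rows Q d A y x)"
    unfolding det_on_def
  proof (intro sum.cong refl arg_cong2[where f = "(*)"])
    fix p assume "p \<in> {p. p permutes V}"
    then have p: "p permutes V" by simp
    show "(\<Prod>x\<in>V. replace_rows P c A x (p x)) = (\<Prod>x\<in>V. replace_rows Q d A (p x) x)"
    proof (cases "\<forall>x\<in>P. p x = c x")
      case True
      show ?thesis
      proof (rule prod.cong[OF refl])
        fix x assume x: "x \<in> V"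
        show "replace_rows P c A x (p x) = replace_rows Q d A (p x) x"
        proof (cases "x \<in> P")
          case xP: True
          then show ?thesis using True c[OF xP] by (simp add: replace_rows_def)
        next
          case xP: False
          have "p x \<notin> Q"
          proof
            assume pQ: "p x \<in> Q"
            then have "p (d (p x)) = p x" using d[OF pQ] True by simp
            then have "d (p x) = x" using permutes_inj[OF p] by (simp add: inj_eq)
            then show False using xP d[OF pQ] by simp
          qed
          then show ?thesis using xP sym[OF x, of "p x"] x permutes_in_image[OF p, of x] by (simp add: replace_rows_def)
        qed
      qed
    next
      case False
      then obtain x where x: "x \<in> P" "p x \<noteq> c x" by blast
      have "(\<Prod>x\<in>V. replace_rows P c A x (p x)) = 0"
        by (rule prod_zero[OF fin]) (use x sub in \<open>auto simp: replace_rows_def intro!: bexI[of _ x]\<close>)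
      moreover have "(\<Prod>x\<in>V. replace_rows Q d A (p x) x) = 0"
      proof -
        define z where "z = Hilbert_Choice.inv p (c x)"
        have z: "p z = c x" by (simp add: z_def permutes_inverses[OF p])
        have "c x \<in> V" using c[OF x(1)] sub by auto
        then have "z \<in> V" using z permutes_in_image[OF p, of z] by simp
        moreover have "z \<noteq> x" using z x(2) by auto
        then have "replace_rows Q d A (p z) z = 0" using c[OF x(1)] by (simp add: replace_rows_def z)
        ultimately show ?thesis using fin by (intro prod_zero) auto
      qed
      ultimately show ?thesis by simp
    qed
  qed
  also have "\<dots> = det_on V (replace_rows Q d A)" by (rule det_on_transpose[OF fin])
  finally show ?thesis .
qed

text \<open>
  Any bijection would do, but the same one must be used in all fragments: changing it multiplies the
  value of a state by a sign that cancels between the two glued sides.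
\<close>

definition label_pairing :: "nat set \<Rightarrow> nat set \<Rightarrow> nat \<Rightarrow> nat" where
  "label_pairing S T = (SOME b. bij_betw b S T)"

lemma label_pairing:
  assumes "finite S" "finite T" "card S = card T"
  shows "bij_betw (label_pairing S T) S T"
  using someI_ex[OF finite_same_card_bij[OF assms]] unfolding label_pairing_def .

text \<open>
  The matrix consists of two symmetric blocks \<open>L\<close> and \<open>R\<close> connected only by the links \<open>J\<close> between \<open>f i\<close> and \<open>g i\<close>.
  Splitting the rows into their link part and their own part, let \<open>S\<close> and \<open>T\<close> be the labels whose rows
  on the left and on the right take the link. Such a row reaches into the opposite block, so
  a contributing permutation needs \<open>card S = card T\<close>. Interchanging the
  link rows \<open>f i\<close> and \<open>g (b i)\<close>, where \<open>b\<close> pairs \<open>S\<close> with \<open>T\<close>, makes the matrix block diagonal at the cost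
  of \<open>(-1) ^ card S\<close>. The blocks are the minors of \<open>L\<close> for \<open>(S, T)\<close> and of \<open>R\<close> for \<open>(T, S)\<close>, and symmetry
  turns the second one into the minor for \<open>(S, T)\<close>.
\<close>

lemma two_block_state_sum:
  fixes A :: "nat \<Rightarrow> nat \<Rightarrow> complex" and f g :: "nat \<Rightarrow> nat"
  assumes fin: "finite L" "finite R" and disj: "L \<inter> R = {}"
    and f: "inj_on f {..<t}" "f ` {..<t} \<subseteq> L" and g: "inj_on g {..<t}" "g ` {..<t} \<subseteq> R"
    and J: "\<And>x y. J x y = (if \<exists>i<t. (x = f i \<and> y = g i) \<or> (x = g i \<and> y = f i) then 1 else 0)"
    and A0: "\<And>x y. x \<in> L \<Longrightarrow> y \<in> R \<Longrightarrow> A x y = 0 \<and> A y x = 0"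
    and sym: "\<And>x y. A x y = A y x"
  shows "det_on (L \<union> R) (\<lambda>x y. J x y + A x y) =
    (\<Sum>(S, T)\<in>Pow {..<t} \<times> Pow {..<t}. if card S = card T then (-1) ^ card S *
       det_on L (replace_rows (f ` S) (\<lambda>x. f (label_pairing S T (inv_into {..<t} f x))) A) *
       det_on R (replace_rows (g ` S) (\<lambda>x. g (label_pairing S T (inv_into {..<t} g x))) A) else 0)"
proof -
  define V where "V = L \<union> R"
  define M where "M = (\<lambda>W x y. if x \<in> W then J x y else A x y)"
  define w where "w = (\<lambda>(S, T). f ` S \<union> g ` T)"
  define P where "P = Pow {..<t} \<times> Pow {..<t}"
  have finV: "finite V" using fin by (simp add: V_def)
  have fg: "f i \<noteq> g j" if "i < t" "j < t" for i j using that f g disj by blast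
  have fin_eq: "f i = f j \<longleftrightarrow> i = j" "g i = g j \<longleftrightarrow> i = j" if "i < t" "j < t" for i j
    using that f(1) g(1) by (auto simp: inj_on_def)
  have Jf: "J (f i) y = (if y = g i then 1 else 0)" if "i < t" for i y
    using that fg fin_eq unfolding J by metis
  have Jg: "J (g i) y = (if y = f i then 1 else 0)" if "i < t" for i y
    using that fg fin_eq unfolding J by metis
  have winj: "inj_on w P"
  proof (rule inj_onI)
    fix a b assume ab: "a \<in> P" "b \<in> P" "w a = w b"
    obtain S T S' T' where eq: "a = (S, T)" "b = (S', T')" by fastforce
    have sub: "S \<subseteq> {..<t}" "T \<subseteq> {..<t}" "S' \<subseteq> {..<t}" "T' \<subseteq> {..<t}" using ab eq by (auto simp: P_def)
    have e: "f ` S \<union> g ` T = f ` S' \<union> g ` T'" using ab eq by (simp add: w_def)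
    have fL: "f ` S \<subseteq> L" "f ` S' \<subseteq> L" "g ` T \<subseteq> R" "g ` T' \<subseteq> R" using sub f g by blast+
    have "f ` S = (f ` S \<union> g ` T) \<inter> L" "f ` S' = (f ` S' \<union> g ` T') \<inter> L" using fL disj by blast+
    then have "f ` S = f ` S'" using e by simp
    moreover have "g ` T = (f ` S \<union> g ` T) \<inter> R" "g ` T' = (f ` S' \<union> g ` T') \<inter> R" using fL disj by blast+
    then have "g ` T = g ` T'" using e by simp
    ultimately show "a = b" using inj_on_image_eq_iff[OF f(1)] inj_on_image_eq_iff[OF g(1)] sub eq by simp
  qed
  have "det_on V (\<lambda>x y. J x y + A x y) = (\<Sum>W\<in>Pow V. det_on V (M W))"
    unfolding M_def by (rule det_on_add[OF finV])
  also have "\<dots> = (\<Sum>W\<in>w ` P. det_on V (M W))"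
  proof (rule sum.mono_neutral_right)
    show "w ` P \<subseteq> Pow V" using f g by (fastforce simp: w_def P_def V_def)
    show "\<forall>W\<in>Pow V - w ` P. det_on V (M W) = 0"
    proof
      fix W assume W: "W \<in> Pow V - w ` P"
      have "\<exists>x\<in>W. x \<notin> f ` {..<t} \<union> g ` {..<t}"
      proof (rule ccontr)
        assume "\<not> ?thesis"
        then have sub: "W \<subseteq> f ` {..<t} \<union> g ` {..<t}" by blast
        define S T where "S = {i \<in> {..<t}. f i \<in> W}" and "T = {i \<in> {..<t}. g i \<in> W}"
        have "W = f ` S \<union> g ` T" using sub by (auto simp: S_def T_def)
        then have "W = w (S, T)" by (simp add: w_def)
        moreover have "(S, T) \<in> P" by (auto simp: P_def S_def T_def)
        ultimately show False using W by blast
      qed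
      then obtain x where x: "x \<in> W" "x \<notin> f ` {..<t} \<union> g ` {..<t}" by blast
      have "M W x y = 0" for y
      proof -
        have "\<not> (\<exists>i<t. (x = f i \<and> y = g i) \<or> (x = g i \<and> y = f i))" using x(2) by blast
        then show ?thesis using x(1) unfolding M_def J by simp
      qed
      then show "det_on V (M W) = 0" using x W by (intro det_on_zero_row[OF finV, of x]) auto
    qed
  qed (use finV in simp)
  also have "\<dots> = (\<Sum>a\<in>P. det_on V (M (w a)))" by (simp add: sum.reindex[OF winj])
  also have "\<dots> = (\<Sum>(S, T)\<in>P. if card S = card T then (-1) ^ card S *
       det_on L (replace_rows (f ` S) (\<lambda>x. f (label_pairing S T (inv_into {..<t} f x))) A) *
       det_on R (replace_rows (g ` S) (\<lambda>x. g (label_pairing S T (inv_into {..<t} g x))) A) else 0)"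
  proof (rule sum.cong[OF refl], clarify)
    fix S T assume "(S, T) \<in> P"
    then have S: "S \<subseteq> {..<t}" and T: "T \<subseteq> {..<t}" by (auto simp: P_def)
    have finS: "finite S" "finite T" using S T finite_subset by auto
    have St: "i < t" if "i \<in> S" for i using that S by auto
    have Tt: "i < t" if "i \<in> T" for i using that T by auto
    have fS: "f ` S \<subseteq> L" and gT: "g ` T \<subseteq> R" and gS: "g ` S \<subseteq> R" and fT: "f ` T \<subseteq> L" using f g S T by blast+
    define N where "N = M (w (S, T))"
    have Nf: "N (f i) y = (if y = g i then 1 else 0)" if "i \<in> S" for i y
      using that Jf[OF St[OF that]] by (simp add: N_def M_def w_def)
    have Ng: "N (g i) y = (if y = f i then 1 else 0)" if "i \<in> T" for i y
      using that Jg[OF Tt[OF that]] by (simp add: N_def M_def w_def)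
    have NA: "N x y = A x y" if "x \<notin> f ` S" "x \<notin> g ` T" for x y
      using that by (simp add: N_def M_def w_def)
    show "det_on V (M (w (S, T))) = (if card S = card T then (-1) ^ card S *
       det_on L (replace_rows (f ` S) (\<lambda>x. f (label_pairing S T (inv_into {..<t} f x))) A) *
       det_on R (replace_rows (g ` S) (\<lambda>x. g (label_pairing S T (inv_into {..<t} g x))) A) else 0)"
    proof (cases "card S = card T")
      case False
      \<comment> \<open>\<open>R1\<close> consists of the rows supported in \<open>L\<close>; a contributing permutation would map it onto \<open>L\<close>.\<close>
      define R1 where "R1 = (L - f ` S) \<union> g ` T"
      have "det_on V N = 0"
        unfolding det_on_def
      proof (intro sum.neutral ballI)
        fix p assume "p \<in> {p. p permutes V}"
        then have p: "p permutes V" by simp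
        have "\<exists>x\<in>V. N x (p x) = 0"
        proof (rule ccontr)
          assume "\<not> ?thesis"
          then have nz: "N x (p x) \<noteq> 0" if "x \<in> V" for x using that by blast
          have pV: "p x \<in> V" if "x \<in> V" for x using permutes_in_image[OF p] that by simp
          have "p x \<in> L" if x: "x \<in> R1" for x
          proof (cases "x \<in> g ` T")
            case True
            then obtain i where i: "i \<in> T" "x = g i" by blast
            then have "p x = f i" using nz[of x] Ng[OF i(1)] gT by (auto simp: V_def split: if_splits)
            then show ?thesis using fT i by auto
          next
            case F: False
            then have x': "x \<in> L" "x \<notin> f ` S" using x by (auto simp: R1_def)
            then have "A x (p x) \<noteq> 0" using nz[of x] NA[OF x'(2) F] by (simp add: V_def)
            then show ?thesis using A0[OF x'(1), of "p x"] pV[of x] x' by (auto simp: V_def)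
          qed
          then have "p ` R1 \<subseteq> L" by blast
          have R1V: "R1 \<subseteq> V" using gT by (auto simp: R1_def V_def)
          have "p x \<in> R" if x: "x \<in> V - R1" for x
          proof (cases "x \<in> f ` S")
            case True
            then obtain i where i: "i \<in> S" "x = f i" by blast
            then have "p x = g i" using nz[of x] Nf[OF i(1)] x by (auto split: if_splits)
            then show ?thesis using gS i by auto
          next
            case F: False
            then have x': "x \<in> R" "x \<notin> g ` T" using x by (auto simp: R1_def V_def)
            then have "A x (p x) \<noteq> 0" using nz[of x] NA[OF F x'(2)] by (simp add: V_def)
            then show ?thesis using A0[of "p x" x] x' pV[of x] by (auto simp: V_def)
          qed
          then have "p ` (V - R1) \<subseteq> R" by blast
          have inj: "inj_on p B" for B using permutes_inj[OF p] by (meson inj_on_subset subset_UNIV)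
          have "card R1 \<le> card L" using \<open>p ` R1 \<subseteq> L\<close> card_image[OF inj] card_mono[OF fin(1)] by metis
          moreover have "card (V - R1) \<le> card R" using \<open>p ` (V - R1) \<subseteq> R\<close> card_image[OF inj] card_mono[OF fin(2)] by metis
          moreover have "card (V - R1) = card V - card R1" using R1V finV by (simp add: card_Diff_subset finite_subset)
          moreover have "card R1 \<le> card V" using R1V finV by (rule card_mono[rotated])
          moreover have "card V = card L + card R" using fin disj by (simp add: V_def card_Un_disjoint)
          moreover have "card R1 = card (L - f ` S) + card (g ` T)"
            unfolding R1_def using fin gT disj finS by (intro card_Un_disjoint) auto
          moreover have "card (L - f ` S) = card L - card S"
            using fS finS inj_on_subset[OF f(1) S] by (simp add: card_Diff_subset card_image)
          moreover have "card S \<le> card L" using card_mono[OF fin(1) fS] card_image[OF inj_on_subset[OF f(1) S]] by simp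
          moreover have "card (g ` T) = card T" by (rule card_image[OF inj_on_subset[OF g(1) T]])
          ultimately show False using False by linarith
        qed
        then have "(\<Prod>x\<in>V. N x (p x)) = 0" using finV by (intro prod_zero) auto
        then show "of_int (sign p) * (\<Prod>x\<in>V. N x (p x)) = 0" by simp
      qed
      then show ?thesis using False by (simp add: N_def)
    next
      case True
      define b where "b = label_pairing S T"
      have b: "bij_betw b S T" unfolding b_def by (rule label_pairing[OF finS True])
      have bT: "b i \<in> T" if "i \<in> S" for i using b that by (auto simp: bij_betw_def)
      define d where "d = inv_into S b"
      have d: "d j \<in> S" "b (d j) = j" if "j \<in> T" for j
        using b that by (auto simp: d_def bij_betw_def inv_into_into f_inv_into_f)
      have db: "d (b i) = i" if "i \<in> S" for i using b that by (auto simp: d_def bij_betw_def)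
      define fi where "fi = inv_into {..<t} f"
      define gi where "gi = inv_into {..<t} g"
      have fi: "fi (f i) = i" if "i < t" for i using that f(1) by (simp add: fi_def)
      have gi: "gi (g i) = i" if "i < t" for i using that g(1) by (simp add: gi_def)
      \<comment> \<open>The interchange of link rows that makes the matrix block diagonal.\<close>
      define \<rho> where "\<rho> = (\<lambda>x. if x \<in> f ` S then g (b (fi x)) else if x \<in> g ` T then f (d (gi x)) else x)"
      have \<rho>f: "\<rho> (f i) = g (b i)" if "i \<in> S" for i using that fi[OF St[OF that]] by (auto simp: \<rho>_def)
      have fgST: "f ` S \<inter> g ` T = {}" using fS gT disj by blast
      have \<rho>g: "\<rho> (g j) = f (d j)" if "j \<in> T" for j using that gi[OF Tt[OF that]] fgST by (auto simp: \<rho>_def)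
      have \<rho>id: "\<rho> x = x" if "x \<notin> f ` S" "x \<notin> g ` T" for x using that by (simp add: \<rho>_def)
      define K where "K = f ` S \<union> g ` T"
      have finK: "finite K" using finS by (simp add: K_def)
      have KV: "K \<subseteq> V" using fS gT by (auto simp: K_def V_def)
      have invol: "\<rho> x \<in> K \<and> \<rho> (\<rho> x) = x \<and> \<rho> x \<noteq> x" if x: "x \<in> K" for x
      proof -
        consider i where "i \<in> S" "x = f i" | j where "j \<in> T" "x = g j" using x by (auto simp: K_def)
        then show ?thesis
        proof cases
          case 1
          then show ?thesis using \<rho>f[OF 1(1)] \<rho>g[OF bT[OF 1(1)]] db[OF 1(1)] bT[OF 1(1)] fgST
            by (auto simp: K_def)
        next
          case 2
          then show ?thesis using \<rho>g[OF 2(1)] \<rho>f[OF d(1)[OF 2(1)]] d[OF 2(1)] fgST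
            by (auto simp: K_def)
        qed
      qed
      have permK: "\<rho> permutes K"
      proof (rule inj_imp_permutes[OF _ finK])
        show "inj_on \<rho> K" using invol by (metis inj_on_inverseI)
      qed (use invol \<rho>id in \<open>auto simp: K_def\<close>)
      have "card K = 2 * card S"
        using fgST finS True inj_on_subset[OF f(1) S] inj_on_subset[OF g(1) T]
        by (simp add: K_def card_Un_disjoint card_image)
      then have sgn: "sign \<rho> = (-1) ^ card S" using sign_involution[OF finK permK] invol by simp
      have permV: "\<rho> permutes V" by (rule permutes_subset[OF permK KV])
      define B where "B = (\<lambda>x. N (\<rho> x))"
      have "det_on V B = of_int (sign \<rho>) * det_on V N" unfolding B_def by (rule det_on_permute_rows[OF finV permV])
      then have "det_on V N = (-1) ^ card S * det_on V B"
        unfolding sgn by (simp flip: mult.assoc power_mult_distrib)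
      also have "det_on V B = det_on L B * det_on R B"
        unfolding V_def
      proof (rule det_on_block[OF fin disj])
        fix x y assume x: "x \<in> L" and y: "y \<in> R"
        show "B x y = 0"
        proof (cases "x \<in> f ` S")
          case True
          then obtain i where i: "i \<in> S" "x = f i" by blast
          then have "B x y = (if y = f (b i) then 1 else 0)" using \<rho>f[OF i(1)] Ng[OF bT[OF i(1)]] by (simp add: B_def)
          moreover have "f (b i) \<in> L" using fT bT[OF i(1)] by blast
          ultimately show ?thesis using y disj by auto
        next
          case F: False
          have "x \<notin> g ` T" using x gT disj by blast
          then show ?thesis using F A0[OF x y] by (simp add: B_def \<rho>id NA)
        qed
      qed
      also have "det_on L B = det_on L (replace_rows (f ` S) (\<lambda>x. f (b (fi x))) A)"
      proof (rule det_on_cong)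
        fix x y assume x: "x \<in> L" and y: "y \<in> L"
        show "B x y = replace_rows (f ` S) (\<lambda>x. f (b (fi x))) A x y"
        proof (cases "x \<in> f ` S")
          case True
          then obtain i where i: "i \<in> S" "x = f i" by blast
          then show ?thesis using \<rho>f[OF i(1)] Ng[OF bT[OF i(1)]] fi[OF St[OF i(1)]] by (simp add: B_def replace_rows_def)
        next
          case F: False
          have "x \<notin> g ` T" using x gT disj by blast
          then show ?thesis using F by (simp add: B_def \<rho>id NA replace_rows_def)
        qed
      qed
      also have "det_on R B = det_on R (replace_rows (g ` T) (\<lambda>x. g (d (gi x))) A)"
      proof (rule det_on_cong)
        fix x y assume x: "x \<in> R" and y: "y \<in> R"
        show "B x y = replace_rows (g ` T) (\<lambda>x. g (d (gi x))) A x y"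
        proof (cases "x \<in> g ` T")
          case True
          then obtain j where j: "j \<in> T" "x = g j" by blast
          then show ?thesis using \<rho>g[OF j(1)] Nf[OF d(1)[OF j(1)]] gi[OF Tt[OF j(1)]] by (simp add: B_def replace_rows_def)
        next
          case F: False
          have "x \<notin> f ` S" using x fS disj by blast
          then show ?thesis using F by (simp add: B_def \<rho>id NA replace_rows_def)
        qed
      qed
      also have "\<dots> = det_on R (replace_rows (g ` S) (\<lambda>x. g (b (gi x))) A)"
      proof (rule det_on_replace_rows_inverse[OF fin(2) gT gS])
        fix x assume "x \<in> g ` T"
        then obtain j where j: "j \<in> T" "x = g j" by blast
        then show "g (d (gi x)) \<in> g ` S \<and> g (b (gi (g (d (gi x))))) = x"
          using gi[OF Tt[OF j(1)]] d[OF j(1)] gi[OF St[OF d(1)[OF j(1)]]] by simp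
      next
        fix x assume "x \<in> g ` S"
        then obtain i where i: "i \<in> S" "x = g i" by blast
        then show "g (b (gi x)) \<in> g ` T \<and> g (d (gi (g (b (gi x))))) = x"
          using gi[OF St[OF i(1)]] bT[OF i(1)] gi[OF Tt[OF bT[OF i(1)]]] db[OF i(1)] by simp
      qed (rule sym)
      finally show ?thesis using True by (simp add: N_def b_def fi_def gi_def mult.assoc)
    qed
  qed
  finally show ?thesis unfolding V_def P_def .
qed

definition fragment_matrix :: "complex \<Rightarrow> fragment \<Rightarrow> nat \<Rightarrow> nat \<Rightarrow> complex" where
  "fragment_matrix \<theta> F x y = (if x = y \<and> x \<notin> set (snd F) then \<theta> else 0) - of_nat (adj (fst F) x y)"

text \<open>
  The value of a fragment in the state \<open>(S, T)\<close>: a signed minor of its matrix with the labelled rows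
  \<open>S\<close> and the labelled columns \<open>T\<close> deleted.
\<close>

definition state_value :: "complex \<Rightarrow> fragment \<Rightarrow> nat set \<times> nat set \<Rightarrow> complex" where
  "state_value \<theta> F = (\<lambda>(S, T). 0 ^ circles (fst F) * det_on (verts (fst F))
     (replace_rows ((!) (snd F) ` S) (\<lambda>x. snd F ! label_pairing S T (inv_into {..<length (snd F)} ((!) (snd F)) x))
       (fragment_matrix \<theta> F)))"

definition states :: "nat \<Rightarrow> (nat set \<times> nat set) set" where
  "states t = {(S, T) \<in> Pow {..<t} \<times> Pow {..<t}. card S = card T}"

text \<open>
  Undoes the relabelling by which a fragment becomes one side of the disjoint union.
\<close>

lemma det_on_replace_rows_inj:
  assumes fin: "finite V" and us: "distinct us" "set us \<subseteq> V" "length us = t" and S: "S \<subseteq> {..<t}"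
    and h: "inj h" and A: "\<And>x y. x \<in> V \<Longrightarrow> y \<in> V \<Longrightarrow> A (h x) (h y) = B x y"
    and T: "T \<subseteq> {..<t}" "card S = card T"
  shows "det_on (h ` V) (replace_rows ((\<lambda>i. h (us ! i)) ` S) (\<lambda>x. h (us ! label_pairing S T (inv_into {..<t} (\<lambda>i. h (us ! i)) x))) A) =
    det_on V (replace_rows ((!) us ` S) (\<lambda>x. us ! label_pairing S T (inv_into {..<t} ((!) us) x)) B)"
proof -
  have inj: "inj_on ((!) us) {..<t}" using us by (auto simp: inj_on_def nth_eq_iff_index_eq)
  then have inj': "inj_on (\<lambda>i. h (us ! i)) {..<t}"
    using comp_inj_on[OF inj inj_on_subset[OF h subset_UNIV]] by (simp add: comp_def)
  show ?thesis
  proof (subst det_on_image)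
    show "inj_on h V" using h by (meson inj_on_subset subset_UNIV)
    show "det_on V (\<lambda>x y. replace_rows ((\<lambda>i. h (us ! i)) ` S) (\<lambda>x. h (us ! label_pairing S T (inv_into {..<t} (\<lambda>i. h (us ! i)) x))) A (h x) (h y)) =
      det_on V (replace_rows ((!) us ` S) (\<lambda>x. us ! label_pairing S T (inv_into {..<t} ((!) us) x)) B)"
    proof (rule det_on_cong)
      fix x y assume xy: "x \<in> V" "y \<in> V"
      show "replace_rows ((\<lambda>i. h (us ! i)) ` S) (\<lambda>x. h (us ! label_pairing S T (inv_into {..<t} (\<lambda>i. h (us ! i)) x))) A (h x) (h y) =
        replace_rows ((!) us ` S) (\<lambda>x. us ! label_pairing S T (inv_into {..<t} ((!) us) x)) B x y"
      proof (cases "x \<in> (!) us ` S")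
        case True
        then obtain i where i: "i \<in> S" "x = us ! i" by blast
        then have "i \<in> {..<t}" using S by blast
        then have "inv_into {..<t} (\<lambda>i. h (us ! i)) (h x) = i" "inv_into {..<t} ((!) us) x = i"
          using inv_into_f_f[OF inj'] inv_into_f_f[OF inj] i by auto
        moreover have "h x \<in> (\<lambda>i. h (us ! i)) ` S" using i by auto
        ultimately show ?thesis using True h by (simp add: replace_rows_def inj_eq)
      next
        case False
        then have "h x \<notin> (\<lambda>i. h (us ! i)) ` S" using h by (auto simp: inj_eq)
        then show ?thesis using False A[OF xy] by (simp add: replace_rows_def)
      qed
    qed
  qed (rule fin)
qed

text \<open>
  The connection form is diagonal in the states, with signs as its only coefficients. Both rank
  bounds rest on this: the number of states bounds the rank from above, and the signs make the form
  definite on states whose \<open>card S\<close> has a fixed parity.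
\<close>

theorem glue_state_sum:
  assumes F: "F \<in> fragments t" and G: "G \<in> fragments t"
  shows "is_graph (glue F G) \<and> 0 ^ circles (glue F G) * char_det \<theta> (glue F G) =
    (-1) ^ t * (\<Sum>s\<in>states t. (-1) ^ card (fst s) * state_value \<theta> F s * state_value \<theta> G s)"
proof -
  obtain F' us where F': "F = (F', us)" by fastforce
  obtain G' vs where G': "G = (G', vs)" by fastforce
  note [simp] = enc_simps
  have f: "is_graph F'" "length us = t" "distinct us" "set us \<subseteq> verts F'"
    and g: "is_graph G'" "length vs = t" "distinct vs" "set vs \<subseteq> verts G'"
    using F G F' G' by (auto simp: fragments_def)
  define D where "D = disjoint_union F' G'"
  define ps where "ps = end_pairs us vs"
  define L where "L = lft ` verts F'"
  define R where "R = rgt ` verts G'"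
  define f' where "f' = (\<lambda>i. lft (us ! i))"
  define g' where "g' = (\<lambda>i. rgt (vs ! i))"
  define A where "A = (\<lambda>x y. (if x = y \<and> x \<notin> linked ps then \<theta> else 0) - of_nat (adj D x y))"
  define J where "J = (\<lambda>x y. if \<exists>i<t. (x = f' i \<and> y = g' i) \<or> (x = g' i \<and> y = f' i) then 1 else 0 :: complex)"
  have fin: "finite L" "finite R" using finite_graph(1)[OF f(1)] finite_graph(1)[OF g(1)] by (auto simp: L_def R_def)
  have set_ps: "set ps = (\<lambda>i. (f' i, g' i)) ` {..<t}"
    using f(2) g(2) by (force simp: ps_def end_pairs_def set_zip f'_def g'_def)
  have sets: "set us = (!) us ` {..<t}" "set vs = (!) vs ` {..<t}"
    using f(2) g(2) by (auto simp: set_conv_nth)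
  have linked: "linked ps = lft ` set us \<union> rgt ` set vs"
    unfolding linked_def set_ps sets image_image f'_def g'_def by simp
  have injl: "inj (\<lambda>x. lft x)" "inj (\<lambda>x. rgt x)" by (auto simp: inj_def)
  have VD: "verts D = L \<union> R" by (simp add: D_def disjoint_union_simps L_def R_def)
  have "(x, y) \<in> set ps \<or> (y, x) \<in> set ps \<longleftrightarrow> (\<exists>i<t. (x = f' i \<and> y = g' i) \<or> (x = g' i \<and> y = f' i))" for x y
    unfolding set_ps by blast
  then have "link_matrix \<theta> D ps = (\<lambda>x y. J x y + A x y)"
    by (intro ext) (simp add: link_matrix_def J_def A_def)
  then have "link_det \<theta> D ps = 0 ^ circles D * det_on (L \<union> R) (\<lambda>x y. J x y + A x y)"
    by (simp add: link_det_def VD)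
  also have "det_on (L \<union> R) (\<lambda>x y. J x y + A x y) =
    (\<Sum>(S, T)\<in>Pow {..<t} \<times> Pow {..<t}. if card S = card T then (-1) ^ card S *
       det_on L (replace_rows (f' ` S) (\<lambda>x. f' (label_pairing S T (inv_into {..<t} f' x))) A) *
       det_on R (replace_rows (g' ` S) (\<lambda>x. g' (label_pairing S T (inv_into {..<t} g' x))) A) else 0)"
  proof (rule two_block_state_sum[OF fin])
    show "L \<inter> R = {}" by (auto simp: L_def R_def)
    show "inj_on f' {..<t}" using f(2,3) by (auto simp: f'_def inj_on_def nth_eq_iff_index_eq)
    show "inj_on g' {..<t}" using g(2,3) by (auto simp: g'_def inj_on_def nth_eq_iff_index_eq)
    have "f' ` {..<t} = lft ` set us" "g' ` {..<t} = rgt ` set vs"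
      unfolding sets f'_def g'_def image_image by simp_all
    then show "f' ` {..<t} \<subseteq> L" "g' ` {..<t} \<subseteq> R" using f(4) g(4) unfolding L_def R_def by blast+
    show "J x y = (if \<exists>i<t. (x = f' i \<and> y = g' i) \<or> (x = g' i \<and> y = f' i) then 1 else 0)" for x y
      by (simp add: J_def)
    show "A x y = A y x" for x y
      using adj_sym[OF disjoint_union_graph(1)[OF f(1) g(1)]] by (auto simp: A_def D_def)
    show "A x y = 0 \<and> A y x = 0" if "x \<in> L" "y \<in> R" for x y
      using that disjoint_union_adj(3,4)[OF f(1) g(1)] by (auto simp: A_def D_def L_def R_def)
  qed
  also have "\<dots> = (\<Sum>(S, T)\<in>states t. (-1) ^ card S *
       det_on L (replace_rows (f' ` S) (\<lambda>x. f' (label_pairing S T (inv_into {..<t} f' x))) A) *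
       det_on R (replace_rows (g' ` S) (\<lambda>x. g' (label_pairing S T (inv_into {..<t} g' x))) A))"
    unfolding states_def by (intro sum.mono_neutral_cong_right) (auto split: if_splits)
  also have "0 ^ circles D * \<dots> = (\<Sum>s\<in>states t. (-1) ^ card (fst s) * state_value \<theta> F s * state_value \<theta> G s)"
    unfolding sum_distrib_left
  proof (rule sum.cong[OF refl], clarify)
    fix S T assume "(S, T) \<in> states t"
    then have S: "S \<subseteq> {..<t}" "T \<subseteq> {..<t}" "card S = card T" by (auto simp: states_def)
    have dL: "0 ^ circles F' * det_on L (replace_rows (f' ` S) (\<lambda>x. f' (label_pairing S T (inv_into {..<t} f' x))) A) = state_value \<theta> F (S, T)"
      unfolding state_value_def F' prod.case fst_conv snd_conv f(2) L_def f'_def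
      by (subst det_on_replace_rows_inj[OF _ f(3,4,2) S(1) injl(1) _ S(2,3), where B = "fragment_matrix \<theta> (F', us)"])
         (use finite_graph(1)[OF f(1)] disjoint_union_adj(1)[OF f(1) g(1)] in
           \<open>auto simp: A_def linked fragment_matrix_def D_def\<close>)
    have dR: "0 ^ circles G' * det_on R (replace_rows (g' ` S) (\<lambda>x. g' (label_pairing S T (inv_into {..<t} g' x))) A) = state_value \<theta> G (S, T)"
      unfolding state_value_def G' prod.case fst_conv snd_conv g(2) R_def g'_def
      by (subst det_on_replace_rows_inj[OF _ g(3,4,2) S(1) injl(2) _ S(2,3), where B = "fragment_matrix \<theta> (G', vs)"])
         (use finite_graph(1)[OF g(1)] disjoint_union_adj(2)[OF f(1) g(1)] in
           \<open>auto simp: A_def linked fragment_matrix_def D_def\<close>)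
    show "0 ^ circles D * ((- 1) ^ card S *
        det_on L (replace_rows (f' ` S) (\<lambda>x. f' (label_pairing S T (inv_into {..<t} f' x))) A) *
        det_on R (replace_rows (g' ` S) (\<lambda>x. g' (label_pairing S T (inv_into {..<t} g' x))) A)) =
      (- 1) ^ card (fst (S, T)) * state_value \<theta> F (S, T) * state_value \<theta> G (S, T)"
      unfolding dL[symmetric] dR[symmetric]
      by (simp add: D_def disjoint_union_simps power_add mult_ac)
  qed
  finally have "link_det \<theta> D ps = (\<Sum>s\<in>states t. (-1) ^ card (fst s) * state_value \<theta> F s * state_value \<theta> G s)" .
  then show ?thesis
    using glue_link_det[of F' us t G' vs \<theta>] F G unfolding F' G' D_def ps_def by simp
qed

section \<open>Rank bounds and the upper bound on connection ranks\<close>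

text \<open>
  Gaussian elimination: one unknown is solved for by the equation \<open>c\<close> and substituted in the others.
\<close>

lemma underdetermined_system:
  fixes \<alpha> :: "'w \<Rightarrow> 's \<Rightarrow> 'a::field"
  assumes "finite S" "finite W" "card S < card W"
  shows "\<exists>y. (\<exists>w\<in>W. y w \<noteq> 0) \<and> (\<forall>s\<in>S. (\<Sum>w\<in>W. y w * \<alpha> w s) = 0)"
  using assms
proof (induction S arbitrary: W \<alpha> rule: finite_induct)
  case empty
  then have "W \<noteq> {}" by auto
  then show ?case by (intro exI[of _ "\<lambda>_. 1"]) auto
next
  case (insert c S)
  show ?case
  proof (cases "\<exists>w\<in>W. \<alpha> w c \<noteq> 0")
    case False
    obtain y where y: "\<exists>w\<in>W. y w \<noteq> 0" "\<forall>s\<in>S. (\<Sum>w\<in>W. y w * \<alpha> w s) = 0"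
      using insert.IH[of W \<alpha>] insert.prems insert.hyps by auto
    moreover have "(\<Sum>w\<in>W. y w * \<alpha> w c) = 0" using False by (intro sum.neutral) auto
    ultimately show ?thesis by (intro exI[of _ y]) auto
  next
    case True
    then obtain w0 where w0: "w0 \<in> W" "\<alpha> w0 c \<noteq> 0" by blast
    define W' where "W' = W - {w0}"
    define r where "r = (\<lambda>w. \<alpha> w c / \<alpha> w0 c)"
    have fin': "finite W'" using insert.prems by (simp add: W'_def)
    have "card S < card W'" using insert.prems insert.hyps w0(1) by (simp add: W'_def)
    then obtain y where y: "\<exists>w\<in>W'. y w \<noteq> 0" "\<forall>s\<in>S. (\<Sum>w\<in>W'. y w * (\<alpha> w s - r w * \<alpha> w0 s)) = 0"
      using insert.IH[OF fin', of "\<lambda>w s. \<alpha> w s - r w * \<alpha> w0 s"] by blast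
    define z where "z = (\<lambda>w. if w = w0 then - (\<Sum>w\<in>W'. y w * r w) else y w)"
    have zsum: "(\<Sum>w\<in>W. z w * \<alpha> w s) = (\<Sum>w\<in>W'. y w * (\<alpha> w s - r w * \<alpha> w0 s))" for s
    proof -
      have "(\<Sum>w\<in>W. z w * \<alpha> w s) = z w0 * \<alpha> w0 s + (\<Sum>w\<in>W'. z w * \<alpha> w s)"
        unfolding W'_def using insert.prems w0 by (simp add: sum.remove)
      also have "(\<Sum>w\<in>W'. z w * \<alpha> w s) = (\<Sum>w\<in>W'. y w * \<alpha> w s)"
        by (intro sum.cong) (auto simp: z_def W'_def)
      finally show ?thesis
        by (simp add: z_def sum_distrib_right sum_subtractf right_diff_distrib mult.assoc)
    qed
    have "(\<Sum>w\<in>W. z w * \<alpha> w c) = 0"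
      unfolding zsum using w0 by (simp add: r_def)
    moreover have "\<exists>w\<in>W. z w \<noteq> 0" using y(1) by (auto simp: z_def W'_def)
    ultimately show ?thesis using y(2) zsum by (intro exI[of _ z]) auto
  qed
qed

lemma (in vec_space) independent_columns:
  assumes "A \<in> carrier_mat n nc"
  obtains S where "finite S" "S \<subseteq> set (cols A)" "lin_indpt S" "rank A = card S"
    "set (cols A) \<subseteq> span S"
proof -
  have C: "set (cols A) \<subseteq> carrier_vec n" using assms cols_dim by blast
  obtain S where S: "maximal S (\<lambda>T. T \<subseteq> set (cols A) \<and> lin_indpt T)"
    using maximal_exists_superset[of "set (cols A)" "\<lambda>T. T \<subseteq> set (cols A) \<and> lin_indpt T" "{}"]
      finite_lin_indpt2[of "{}"] by auto
  then have sub: "S \<subseteq> set (cols A)" "lin_indpt S" by (auto simp: maximal_def)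
  have fin: "finite S" using sub(1) finite_subset by blast
  have "c \<in> span S" if c: "c \<in> set (cols A)" for c
  proof (rule ccontr)
    assume no: "c \<notin> span S"
    have SC: "S \<subseteq> carrier_vec n" using sub C by blast
    have "c \<notin> S" using no in_own_span[OF SC] by blast
    have "lin_indpt (S \<union> {c})"
      using lin_dep_iff_in_span[OF SC sub(2) _ \<open>c \<notin> S\<close>] no c C by blast
    then have "S \<union> {c} = S" using S c sub(1) unfolding maximal_def by blast
    then show False using \<open>c \<notin> S\<close> by blast
  qed
  then show thesis using that fin sub rank_card_indpt[OF assms S] by blast
qed

text \<open>
  More than \<open>card I\<close> columns would be linearly dependent, because already their coefficient vectors
  \<open>b\<close> are.
\<close>

lemma (in vec_space) rank_le_of_factorization:
  assumes "finite I"
  shows "rank (mat n nc (\<lambda>(i, j). \<Sum>s\<in>I. a i s * b s j)) \<le> card I"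
proof -
  define A where "A = mat n nc (\<lambda>(i, j). \<Sum>s\<in>I. a i s * b s j)"
  have A: "A \<in> carrier_mat n nc" by (simp add: A_def)
  obtain S where S: "finite S" "S \<subseteq> set (cols A)" "lin_indpt S" "rank A = card S"
    by (rule independent_columns[OF A])
  have SC: "S \<subseteq> carrier_vec n" using S(2) A cols_dim by blast
  have "\<exists>j<nc. c = col A j" if "c \<in> S" for c
  proof -
    have "c \<in> col A ` {0..<nc}" using that S(2) A by (auto simp: cols_def)
    then show ?thesis by (elim imageE) (metis atLeastLessThan_iff)
  qed
  then obtain ix where ix: "\<And>c. c \<in> S \<Longrightarrow> ix c < nc \<and> c = col A (ix c)" by metis
  have "card S \<le> card I"
  proof (rule ccontr)
    assume "\<not> card S \<le> card I"
    then obtain y where y: "\<exists>c\<in>S. y c \<noteq> 0" "\<forall>s\<in>I. (\<Sum>c\<in>S. y c * b s (ix c)) = 0"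
      using underdetermined_system[OF assms S(1), of "\<lambda>c s. b s (ix c)"] by auto
    then obtain c where c: "c \<in> S" "y c \<noteq> 0" by blast
    have "lincomb y S = 0\<^sub>v n"
    proof (rule eq_vecI)
      fix i assume "i < dim_vec (0\<^sub>v n :: 'a vec)"
      then have i: "i < n" by simp
      have "lincomb y S $ i = (\<Sum>c\<in>S. y c * c $ i)" by (rule lincomb_index[OF i SC])
      also have "\<dots> = (\<Sum>c\<in>S. \<Sum>s\<in>I. a i s * (y c * b s (ix c)))"
      proof (rule sum.cong[OF refl])
        fix c assume "c \<in> S"
        then have "c $ i = (\<Sum>s\<in>I. a i s * b s (ix c))"
        proof -
          have cc: "c = col A (ix c)" "ix c < nc" using ix[OF \<open>c \<in> S\<close>] by auto
          have "col A (ix c) $ i = (\<Sum>s\<in>I. a i s * b s (ix c))" using i cc(2) by (simp add: A_def)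
          then show ?thesis using cc(1) by metis
        qed
        then show "y c * c $ i = (\<Sum>s\<in>I. a i s * (y c * b s (ix c)))"
          by (simp add: sum_distrib_left mult_ac)
      qed
      also have "\<dots> = (\<Sum>s\<in>I. a i s * (\<Sum>c\<in>S. y c * b s (ix c)))"
        by (subst sum.swap) (simp add: sum_distrib_left)
      also have "\<dots> = 0" using y(2) by simp
      finally show "lincomb y S $ i = 0\<^sub>v n $ i" using i by simp
    qed (use SC in \<open>simp add: lincomb_dim[OF S(1)]\<close>)
    then have "lin_dep S" by (intro lin_dep_crit[OF S(1) subset_refl, where a = y and v = c]) (use c in auto)
    then show False using S(3) by simp
  qed
  then show ?thesis using S(4) by (simp add: A_def)
qed

text \<open>
  The bilinear form of a matrix of rank \<open>r\<close> factors through a space of dimension \<open>r\<close>, so any Gram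
  matrix with more than \<open>r\<close> rows is singular. With this criterion the
  rank can be bounded by linear combinations of fragments instead of a choice of rows.
\<close>

lemma (in vec_space) card_le_rank_of_nonsingular_gram:
  fixes e :: "nat \<Rightarrow> nat \<Rightarrow> 'a"
  assumes W: "finite W"
    and nonsing: "\<And>y. (\<And>w'. w' \<in> W \<Longrightarrow> (\<Sum>w\<in>W. y w * (\<Sum>i<n. \<Sum>j<nc. c w i * e i j * d w' j)) = 0) \<Longrightarrow>
      (\<And>w. w \<in> W \<Longrightarrow> y w = 0)"
  shows "card W \<le> rank (mat n nc (\<lambda>(i, j). e i j))"
proof -
  define A where "A = mat n nc (\<lambda>(i, j). e i j)"
  have A: "A \<in> carrier_mat n nc" by (simp add: A_def)
  obtain S where S: "finite S" "S \<subseteq> set (cols A)" "lin_indpt S" "rank A = card S" "set (cols A) \<subseteq> span S"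
    by (rule independent_columns[OF A])
  have SC: "S \<subseteq> carrier_vec n" using S(2) A cols_dim by blast
  have "\<exists>x. \<forall>i<n. e i j = (\<Sum>s\<in>S. x s * s $ i)" if j: "j < nc" for j
  proof -
    have "col A j \<in> set (cols A)" using j A by (auto simp: cols_def)
    then have "col A j \<in> span S" using S(5) by blast
    then obtain x where "col A j = lincomb x S" using finite_in_span[OF S(1) SC] by metis
    then have "col A j $ i = (\<Sum>s\<in>S. x s * s $ i)" if "i < n" for i
      using lincomb_index[OF that SC] by simp
    moreover have "col A j $ i = e i j" if "i < n" for i using that j by (simp add: A_def)
    ultimately show ?thesis by (intro exI[of _ x]) simp
  qed
  then obtain x where x: "\<And>i j. i < n \<Longrightarrow> j < nc \<Longrightarrow> e i j = (\<Sum>s\<in>S. x j s * s $ i)" by metis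
  have "card W \<le> card S"
  proof (rule ccontr)
    assume "\<not> card W \<le> card S"
    then obtain y where y: "\<exists>w\<in>W. y w \<noteq> 0" "\<forall>s\<in>S. (\<Sum>w\<in>W. y w * (\<Sum>i<n. c w i * s $ i)) = 0"
      using underdetermined_system[OF S(1) W, of "\<lambda>w s. \<Sum>i<n. c w i * s $ i"] by auto
    have "(\<Sum>w\<in>W. y w * (\<Sum>i<n. \<Sum>j<nc. c w i * e i j * d w' j)) = 0" for w'
    proof -
      define \<alpha> where "\<alpha> = (\<lambda>w s. \<Sum>i<n. c w i * s $ i)"
      define \<beta> where "\<beta> = (\<lambda>s. \<Sum>j<nc. x j s * d w' j)"
      have gram: "(\<Sum>i<n. \<Sum>j<nc. c w i * e i j * d w' j) = (\<Sum>s\<in>S. \<alpha> w s * \<beta> s)" for w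
      proof -
        have "(\<Sum>i<n. \<Sum>j<nc. c w i * e i j * d w' j) =
            (\<Sum>i<n. \<Sum>j<nc. \<Sum>s\<in>S. (c w i * s $ i) * (x j s * d w' j))"
          using x by (intro sum.cong refl) (simp add: sum_distrib_left sum_distrib_right mult_ac)
        also have "\<dots> = (\<Sum>i<n. \<Sum>s\<in>S. \<Sum>j<nc. (c w i * s $ i) * (x j s * d w' j))"
          by (intro sum.cong refl sum.swap)
        also have "\<dots> = (\<Sum>s\<in>S. \<Sum>i<n. \<Sum>j<nc. (c w i * s $ i) * (x j s * d w' j))"
          by (rule sum.swap)
        finally show ?thesis by (simp add: sum_product \<alpha>_def \<beta>_def)
      qed
      have "(\<Sum>w\<in>W. y w * (\<Sum>s\<in>S. \<alpha> w s * \<beta> s)) = (\<Sum>w\<in>W. \<Sum>s\<in>S. y w * \<alpha> w s * \<beta> s)"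
        by (simp add: sum_distrib_left mult.assoc)
      also have "\<dots> = (\<Sum>s\<in>S. (\<Sum>w\<in>W. y w * \<alpha> w s) * \<beta> s)"
        by (subst sum.swap) (simp add: sum_distrib_right)
      also have "\<dots> = 0" using y(2) by (simp add: \<alpha>_def)
      finally show ?thesis unfolding gram .
    qed
    then show False using nonsing[of y] y(1) by blast
  qed
  then show ?thesis using S(4) by (simp add: A_def)
qed

lemma card_states_le: "finite (states t)" "card (states t) \<le> 4 ^ t"
proof -
  have sub: "states t \<subseteq> Pow {..<t} \<times> Pow {..<t}" by (auto simp: states_def)
  show "finite (states t)" by (rule finite_subset[OF sub]) simp
  have "card (states t) \<le> card (Pow {..<t} \<times> Pow {..<t})" by (rule card_mono[OF _ sub]) simp
  also have "\<dots> = 2 ^ t * 2 ^ t" by (simp add: card_cartesian_product card_Pow)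
  also have "\<dots> = 4 ^ t" by (simp flip: power_mult_distrib)
  finally show "card (states t) \<le> 4 ^ t" .
qed

lemma partition_function_glue:
  assumes "F \<in> fragments t" "G \<in> fragments t"
  shows "partition_function 2 1 (h_theta \<theta>) (glue F G) =
    (-1) ^ t * (\<Sum>s\<in>states t. (-1) ^ card (fst s) * state_value \<theta> F s * state_value \<theta> G s)"
  using glue_state_sum[OF assms, of \<theta>] partition_function_char_det[of "glue F G" 1 2 \<theta>]
  unfolding char_functional_1 by simp

lemma connection_rank_le:
  "connection_rank (partition_function 2 1 (h_theta \<theta>)) t \<le> enat (4 ^ t)"
  unfolding connection_rank_def
proof (rule SUP_least)
  fix p assume "p \<in> lists (fragments t) \<times> lists (fragments t)"
  then obtain Fs Gs where p: "p = (Fs, Gs)" and Fs: "Fs \<in> lists (fragments t)" and Gs: "Gs \<in> lists (fragments t)"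
    by (elim SigmaE)
  define a where "a = (\<lambda>i s. (-1) ^ t * (-1) ^ card (fst s) * state_value \<theta> (Fs ! i) s)"
  define b where "b = (\<lambda>s j. state_value \<theta> (Gs ! j) s)"
  have "connection_submatrix (partition_function 2 1 (h_theta \<theta>)) Fs Gs =
    mat (length Fs) (length Gs) (\<lambda>(i, j). \<Sum>s\<in>states t. a i s * b s j)"
    unfolding connection_submatrix_def
  proof (rule cong_mat)
    fix i j assume "i < length Fs" "j < length Gs"
    then have "Fs ! i \<in> fragments t" "Gs ! j \<in> fragments t" using Fs Gs by (auto simp: in_lists_conv_set)
    then show "(case (i, j) of (i, j) \<Rightarrow> partition_function 2 1 (h_theta \<theta>) (glue (Fs ! i) (Gs ! j))) =
        (case (i, j) of (i, j) \<Rightarrow> \<Sum>s\<in>states t. a i s * b s j)"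
      unfolding prod.case partition_function_glue[OF \<open>Fs ! i \<in> fragments t\<close> \<open>Gs ! j \<in> fragments t\<close>]
      by (simp add: a_def b_def sum_distrib_left mult.assoc)
  qed simp_all
  then have "vec_space.rank (length Fs) (connection_submatrix (partition_function 2 1 (h_theta \<theta>)) Fs Gs) \<le> card (states t)"
    using vec_space.rank_le_of_factorization[OF card_states_le(1)] by simp
  also have "\<dots> \<le> 4 ^ t" by (rule card_states_le(2))
  finally show "(case p of (Fs, Gs) \<Rightarrow> enat (vec_space.rank (length Fs)
      (connection_submatrix (partition_function 2 1 (h_theta \<theta>)) Fs Gs))) \<le> enat (4 ^ t)"
    by (simp add: p)
qed

section \<open>Fragments from partial matchings\<close>

definition partial_matching :: "nat \<Rightarrow> (nat \<Rightarrow> nat) \<Rightarrow> bool" where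
  "partial_matching t M \<longleftrightarrow> (\<forall>i<t. M i < t \<and> M (M i) = i)"

definition unmatched :: "nat \<Rightarrow> (nat \<Rightarrow> nat) \<Rightarrow> nat set" where
  "unmatched t M = {i. i < t \<and> M i = i}"

definition mate_fun :: "nat \<Rightarrow> (nat \<Rightarrow> nat) \<Rightarrow> nat \<Rightarrow> nat" where
  "mate_fun t M h = (if h < t then if M h = h then t + h else M h else if h < 2 * t then h - t
     else if h < 3 * t then h + t else h - t)"

text \<open>
  Fixed points of \<open>M\<close> are the unmatched labels. Two matched labels \<open>i\<close> and \<open>M i\<close> are joined by an edge.
  An unmatched label \<open>i\<close> hangs on its own vertex \<open>t + i\<close> by the edge \<open>{i, t + i}\<close>, and this vertex carries a
  loop with half-edges \<open>2 * t + i\<close> and \<open>3 * t + i\<close> if \<open>i \<in> C\<close>.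
\<close>

definition matching_graph :: "nat \<Rightarrow> (nat \<Rightarrow> nat) \<Rightarrow> nat set \<Rightarrow> mgraph" where
  "matching_graph t M C =
    (let H = {..<t} \<union> (\<lambda>i. t + i) ` unmatched t M \<union>
       (\<lambda>i. 2 * t + i) ` (unmatched t M \<inter> C) \<union> (\<lambda>i. 3 * t + i) ` (unmatched t M \<inter> C)
     in \<lparr> verts = {..<t} \<union> (\<lambda>i. t + i) ` unmatched t M, halves = H,
          inc = (\<lambda>h. if h < t then h else t + h mod t),
          edges = (\<lambda>h. {h, mate_fun t M h}) ` H, circles = 0 \<rparr>)"

lemma matching_graph_simps:
  "verts (matching_graph t M C) = {..<t} \<union> (\<lambda>i. t + i) ` unmatched t M"
  "halves (matching_graph t M C) = {..<t} \<union> (\<lambda>i. t + i) ` unmatched t M \<union>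
       (\<lambda>i. 2 * t + i) ` (unmatched t M \<inter> C) \<union> (\<lambda>i. 3 * t + i) ` (unmatched t M \<inter> C)"
  "inc (matching_graph t M C) h = (if h < t then h else t + h mod t)"
  "edges (matching_graph t M C) = (\<lambda>h. {h, mate_fun t M h}) ` halves (matching_graph t M C)"
  "circles (matching_graph t M C) = 0"
  by (simp_all add: matching_graph_def Let_def)

lemma inc_matching:
  assumes "i < t"
  shows "inc (matching_graph t M C) i = i" "inc (matching_graph t M C) (t + i) = t + i"
    "inc (matching_graph t M C) (2 * t + i) = t + i" "inc (matching_graph t M C) (3 * t + i) = t + i"
  using assms by (simp_all add: matching_graph_simps mod_add_self1)

lemma mate_fun_simps:
  assumes "i < t"
  shows "mate_fun t M i = (if M i = i then t + i else M i)" "mate_fun t M (t + i) = i"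
    "mate_fun t M (2 * t + i) = 3 * t + i" "mate_fun t M (3 * t + i) = 2 * t + i"
  using assms by (simp_all add: mate_fun_def)

lemma matching_halves_cases:
  assumes "h \<in> halves (matching_graph t M C)"
  obtains (1) i where "i < t" "h = i" | (2) i where "i \<in> unmatched t M" "h = t + i"
    | (3) i where "i \<in> unmatched t M" "i \<in> C" "h = 2 * t + i" | (4) i where "i \<in> unmatched t M" "i \<in> C" "h = 3 * t + i"
  using assms by (auto simp: matching_graph_simps)

lemma matching_graph:
  assumes M: "partial_matching t M"
  shows "is_graph (matching_graph t M C)"
    "\<And>h. h \<in> halves (matching_graph t M C) \<Longrightarrow> mate (matching_graph t M C) h = mate_fun t M h"
proof -
  let ?G = "matching_graph t M C"
  have u: "i < t" "M i = i" if "i \<in> unmatched t M" for i using that by (auto simp: unmatched_def)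
  have inv: "mate_fun t M h \<in> halves ?G \<and> mate_fun t M h \<noteq> h \<and> mate_fun t M (mate_fun t M h) = h"
    if "h \<in> halves ?G" for h
    using that
  proof (cases rule: matching_halves_cases)
    case (1 i)
    then have "M i < t" "M (M i) = i" using M by (auto simp: partial_matching_def)
    then show ?thesis using 1 mate_fun_simps[of i t M] mate_fun_simps[of "M i" t M]
      by (cases "M i = i") (auto simp: matching_graph_simps unmatched_def)
  next
    case (2 i)
    then show ?thesis using u[of i] mate_fun_simps[of i t M] by (auto simp: matching_graph_simps)
  next
    case (3 i)
    then show ?thesis using u[of i] mate_fun_simps[of i t M] by (auto simp: matching_graph_simps)
  next
    case (4 i)
    then show ?thesis using u[of i] mate_fun_simps[of i t M] by (auto simp: matching_graph_simps)
  qed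
  have fin: "finite (unmatched t M)" by (simp add: unmatched_def)
  have f: "finite (verts ?G)" "finite (halves ?G)" using fin by (simp_all add: matching_graph_simps)
  have i: "inc ?G h \<in> verts ?G" if "h \<in> halves ?G" for h
    using that
  proof (cases rule: matching_halves_cases)
    case (1 i)
    then show ?thesis using inc_matching(1)[of i t M C] by (auto simp: matching_graph_simps)
  next
    case (2 i)
    then show ?thesis using inc_matching(2)[of i t M C] u[of i] by (auto simp: matching_graph_simps)
  next
    case (3 i)
    then show ?thesis using inc_matching(3)[of i t M C] u[of i] by (auto simp: matching_graph_simps)
  next
    case (4 i)
    then show ?thesis using inc_matching(4)[of i t M C] u[of i] by (auto simp: matching_graph_simps)
  qed
  show "is_graph ?G" by (rule graph_of_involution(1)[OF f i inv matching_graph_simps(4)])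
  show "mate ?G h = mate_fun t M h" if "h \<in> halves ?G" for h
    by (rule graph_of_involution(2)[OF f i inv matching_graph_simps(4) that])
qed

lemma adj_matching_label:
  assumes M: "partial_matching t M" and i: "i < t"
  shows "adj (matching_graph t M C) i y = (if y = (if M i = i then t + i else M i) then 1 else 0)"
    "deg (matching_graph t M C) i = 1"
proof -
  let ?G = "matching_graph t M C"
  have at: "halves_at ?G i = {i}"
  proof (rule Set.set_eqI)
    fix h
    show "h \<in> halves_at ?G i \<longleftrightarrow> h \<in> {i}"
    proof
      assume "h \<in> halves_at ?G i"
      then have "h \<in> halves ?G" "inc ?G h = i" by (auto simp: halves_at_def)
      then show "h \<in> {i}" using i by (cases "h < t") (auto simp: matching_graph_simps)
    next
      assume "h \<in> {i}"
      then show "h \<in> halves_at ?G i" using i inc_matching(1)[OF i, of M C]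
        by (auto simp: halves_at_def matching_graph_simps)
    qed
  qed
  show "deg ?G i = 1" by (simp add: deg_def at)
  have ih: "i \<in> halves ?G" using i by (simp add: matching_graph_simps)
  define k where "k = (if M i = i then t + i else M i)"
  have mk: "mate ?G i = k" using matching_graph(2)[OF M ih] mate_fun_simps(1)[OF i] by (simp add: k_def)
  have ik: "inc ?G k = k"
    using inc_matching(1)[of "M i" t M C] inc_matching(2)[OF i, of M C] i M by (auto simp: k_def partial_matching_def)
  have "{a \<in> halves ?G. inc ?G a = i \<and> inc ?G (mate ?G a) = y} = {a \<in> halves_at ?G i. inc ?G (mate ?G a) = y}"
    by (auto simp: halves_at_def)
  also have "\<dots> = (if y = k then {i} else {})" using mk ik by (auto simp: at)
  finally show "adj ?G i y = (if y = (if M i = i then t + i else M i) then 1 else 0)"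
    unfolding adj_def k_def[symmetric] by simp
qed

lemma adj_matching_inner:
  assumes M: "partial_matching t M" and i: "i \<in> unmatched t M"
  shows "adj (matching_graph t M C) (t + i) (t + i) = (if i \<in> C then 2 else 0)"
    "y \<noteq> t + i \<Longrightarrow> adj (matching_graph t M C) (t + i) y = (if y = i then 1 else 0)"
proof -
  let ?G = "matching_graph t M C"
  have it: "i < t" "M i = i" using i by (auto simp: unmatched_def)
  define A where "A = {t + i} \<union> (if i \<in> C then {2 * t + i, 3 * t + i} else {})"
  have at: "halves_at ?G (t + i) = A"
  proof (rule Set.set_eqI)
    fix h
    show "h \<in> halves_at ?G (t + i) \<longleftrightarrow> h \<in> A"
    proof
      assume "h \<in> halves_at ?G (t + i)"
      then have h: "h \<in> halves ?G" "inc ?G h = t + i" by (auto simp: halves_at_def)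
      from h(1) show "h \<in> A"
      proof (cases rule: matching_halves_cases)
        case (1 j)
        then show ?thesis using h(2) inc_matching(1)[of j t M C] by simp
      next
        case (2 j)
        then have "j < t" by (simp add: unmatched_def)
        then show ?thesis using 2 h(2) inc_matching(2)[of j t M C] by (simp add: A_def)
      next
        case (3 j)
        then have "j < t" by (simp add: unmatched_def)
        then show ?thesis using 3 h(2) inc_matching(3)[of j t M C] by (simp add: A_def)
      next
        case (4 j)
        then have "j < t" by (simp add: unmatched_def)
        then show ?thesis using 4 h(2) inc_matching(4)[of j t M C] by (simp add: A_def)
      qed
    next
      assume "h \<in> A"
      then show "h \<in> halves_at ?G (t + i)" using i inc_matching[OF it(1), of M C]
        by (auto simp: halves_at_def A_def matching_graph_simps(2) split: if_splits)
    qed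
  qed
  have Ah: "h \<in> halves ?G" if "h \<in> A" for h using that at by (auto simp: halves_at_def)
  have im: "inc ?G (mate ?G h) = (if h = t + i then i else t + i)" if h: "h \<in> A" for h
  proof -
    have m: "mate ?G h = mate_fun t M h" by (rule matching_graph(2)[OF M Ah[OF h]])
    consider "h = t + i" | "h = 2 * t + i" | "h = 3 * t + i" using h by (auto simp: A_def split: if_splits)
    then show ?thesis unfolding m
    proof cases
      case 1
      then show "inc ?G (mate_fun t M h) = (if h = t + i then i else t + i)"
        by (simp only: mate_fun_simps[OF it(1)] inc_matching[OF it(1)] if_True simp_thms)
    next
      case 2
      then have "h \<noteq> t + i" using it(1) by simp
      then show "inc ?G (mate_fun t M h) = (if h = t + i then i else t + i)"
        by (simp only: 2 mate_fun_simps[OF it(1)] inc_matching[OF it(1)] if_False)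
    next
      case 3
      then have "h \<noteq> t + i" using it(1) by simp
      then show "inc ?G (mate_fun t M h) = (if h = t + i then i else t + i)"
        by (simp only: 3 mate_fun_simps[OF it(1)] inc_matching[OF it(1)] if_False)
    qed
  qed
  have adj: "adj ?G (t + i) y = card {h \<in> A. inc ?G (mate ?G h) = y}" for y
    unfolding adj_def at[symmetric] by (rule arg_cong[of _ _ card]) (auto simp: halves_at_def)
  have set: "{h \<in> A. inc ?G (mate ?G h) = y} = {h \<in> A. (if h = t + i then i else t + i) = y}" for y
    by (intro Collect_cong conj_cong refl) (simp only: im)
  have "{h \<in> A. inc ?G (mate ?G h) = t + i} = (if i \<in> C then {2 * t + i, 3 * t + i} else {})"
    unfolding set using it(1) by (cases "i \<in> C") (auto simp: A_def)
  then show "adj ?G (t + i) (t + i) = (if i \<in> C then 2 else 0)" unfolding adj using it(1) by simp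
  show "adj ?G (t + i) y = (if y = i then 1 else 0)" if "y \<noteq> t + i"
  proof -
    have "{h \<in> A. inc ?G (mate ?G h) = y} = (if y = i then {t + i} else {})"
      unfolding set using it(1) that by (cases "i \<in> C") (auto simp: A_def)
    then show ?thesis unfolding adj by simp
  qed
qed

definition matching_fragment :: "nat \<Rightarrow> (nat \<Rightarrow> nat) \<Rightarrow> nat set \<Rightarrow> fragment" where
  "matching_fragment t M C = (matching_graph t M C, [0..<t])"

lemma matching_fragment_in:
  assumes "partial_matching t M"
  shows "matching_fragment t M C \<in> fragments t"
  using matching_graph(1)[OF assms] adj_matching_label(2)[OF assms]
  by (auto simp: matching_fragment_def fragments_def matching_graph_simps(1))

text \<open>
  Deleted rows follow the pairing of \<open>S\<close> with \<open>T\<close>, the others the matching. A state in which the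
  result is not a permutation has value zero.
\<close>

definition state_map :: "nat set \<Rightarrow> nat set \<Rightarrow> (nat \<Rightarrow> nat) \<Rightarrow> nat \<Rightarrow> nat" where
  "state_map S T M x = (if x \<in> S then label_pairing S T x else M x)"

definition state_sign :: "nat \<Rightarrow> (nat \<Rightarrow> nat) \<Rightarrow> nat set \<times> nat set \<Rightarrow> complex" where
  "state_sign t M = (\<lambda>(S, T). if bij_betw (state_map S T M) {..<t} {..<t}
     then of_int (sign_on {..<t} (state_map S T M)) else 0)"

text \<open>
  At most one permutation contributes to the minor. At an unmatched label \<open>i\<close> with \<open>i \<in> S\<close> the vertex
  \<open>t + i\<close> cannot be reached from \<open>i\<close>, so it is fixed and contributes its diagonal entry \<open>\<theta>\<close> or \<open>\<theta> - 2\<close>; with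
  \<open>i \<notin> S\<close> the label must go to \<open>t + i\<close> and back, a transposition with both entries \<open>-1\<close>. One of these entries is
  counted in \<open>(-1) ^ (t - card S)\<close>, the other cancels the sign of the transposition.
\<close>

lemma state_value_matching:
  assumes M: "partial_matching t M" and s: "(S, T) \<in> states t"
  shows "state_value \<theta> (matching_fragment t M C) (S, T) =
    (-1) ^ (t - card S) * state_sign t M (S, T) *
      (\<Prod>i\<in>unmatched t M. if i \<in> S then \<theta> - (if i \<in> C then 2 else 0) else 1)"
proof -
  define U where "U = unmatched t M"
  define V where "V = {..<t} \<union> (\<lambda>i. t + i) ` U"
  define b where "b = label_pairing S T"
  have S: "S \<subseteq> {..<t}" and T: "T \<subseteq> {..<t}" and cST: "card S = card T" using s by (auto simp: states_def)
  have finU: "finite U" by (simp add: U_def unmatched_def)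
  have finV: "finite V" using finU by (simp add: V_def)
  have Ut: "i < t" "M i = i" if "i \<in> U" for i using that by (auto simp: U_def unmatched_def)
  have Mt: "M i < t" if "i < t" for i using that M by (auto simp: partial_matching_def)
  have bt: "b x < t" if "x \<in> S" for x
    using label_pairing[OF finite_subset[OF S] finite_subset[OF T] cST] that T by (auto simp: b_def bij_betw_def)
  define R where "R = (\<lambda>x y. if x \<in> S then (if y = b x then 1 else 0) else fragment_matrix \<theta> (matching_fragment t M C) x y)"
  \<comment> \<open>The only candidate for a contributing permutation, and \<open>ww\<close> the entries that it collects.\<close>
  define gg where "gg = (\<lambda>x. if x \<in> S then b x else if x < t then (if M x = x then t + x else M x)
      else if x - t \<in> S then x else x - t)"
  define ww where "ww = (\<lambda>x. if x \<in> S then 1 else if x < t then - 1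
      else if x - t \<in> S then \<theta> - (if x - t \<in> C then 2 else 0) else - 1)"
  have gS: "gg x = b x" "ww x = 1" if "x \<in> S" for x using that by (simp_all add: gg_def ww_def)
  have gl: "gg x = (if M x = x then t + x else M x)" "ww x = -1" if "x < t" "x \<notin> S" for x
    using that by (simp_all add: gg_def ww_def)
  have gi: "gg (t + i) = (if i \<in> S then t + i else i)"
    "ww (t + i) = (if i \<in> S then \<theta> - (if i \<in> C then 2 else 0) else -1)" for i
  proof -
    have "t + i \<notin> S" using S by auto
    then show "gg (t + i) = (if i \<in> S then t + i else i)"
      "ww (t + i) = (if i \<in> S then \<theta> - (if i \<in> C then 2 else 0) else -1)"
      by (simp_all add: gg_def ww_def)
  qed
  have V_cases: "x \<in> S \<or> x < t \<and> x \<notin> S \<or> (\<exists>i\<in>U. x = t + i)" if "x \<in> V" for x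
    using that by (auto simp: V_def)
  have nthS: "(!) [0..<t] ` S = S" using S by (force simp: image_iff)
  have inj: "inj_on ((!) [0..<t]) {..<t}" by (auto simp: inj_on_def)
  have "state_value \<theta> (matching_fragment t M C) (S, T) = det_on V R"
    unfolding state_value_def prod.case matching_fragment_def fst_conv snd_conv matching_graph_simps(1,5) power_0
      mult_1 V_def[symmetric] U_def[symmetric] nthS
  proof (rule det_on_cong)
    fix x y
    show "replace_rows S (\<lambda>x. [0..<t] ! label_pairing S T (inv_into {..<length [0..<t]} ((!) [0..<t]) x))
        (fragment_matrix \<theta> (matching_graph t M C, [0..<t])) x y = R x y"
    proof (cases "x \<in> S")
      case True
      then have "x < t" using S by auto
      then have "inv_into {..<t} ((!) [0..<t]) x = x" using inv_into_f_f[OF inj, of x] by simp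
      then show ?thesis using True bt[OF True] by (simp add: replace_rows_def R_def b_def)
    qed (simp add: replace_rows_def R_def matching_fragment_def)
  qed
  also have "\<dots> = det_on V (\<lambda>x y. if y = gg x then ww x else 0)"
    unfolding det_on_def
  proof (intro sum.cong refl arg_cong2[where f = "(*)"])
    fix p assume "p \<in> {p. p permutes V}"
    then have p: "p permutes V" by simp
    define R' where "R' = (\<lambda>x y. if y = gg x then ww x else 0)"
    have RS: "R x y = (if y = b x then 1 else 0)" if "x \<in> S" for x y using that by (simp add: R_def)
    have Rl: "R x y = (if y = (if M x = x then t + x else M x) then -1 else 0)" if "x < t" "x \<notin> S" for x y
      using that adj_matching_label(1)[OF M that(1)]
      by (auto simp: R_def fragment_matrix_def matching_fragment_def)
    have Ri: "R (t + i) y = (if y = t + i then \<theta> - (if i \<in> C then 2 else 0) else if y = i then -1 else 0)"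
      if i: "i \<in> U" for i y
    proof -
      have "t + i \<notin> S" using S by auto
      then show ?thesis using adj_matching_inner(1)[OF M i[unfolded U_def], where C = C]
          adj_matching_inner(2)[OF M i[unfolded U_def], where C = C and y = y] Ut[OF i]
        by (cases "y = t + i") (auto simp: R_def fragment_matrix_def matching_fragment_def)
    qed
    have eq': "R x y = R' x y" if x: "x \<in> V" and nz: "R' x y \<noteq> 0" for x y
    proof -
      have y: "y = gg x" by (rule ccontr) (use nz in \<open>simp add: R'_def\<close>)
      consider "x \<in> S" | "x < t" "x \<notin> S" | i where "i \<in> U" "x = t + i" using V_cases[OF x] by blast
      then show ?thesis
      proof cases
        case 1
        then show ?thesis by (simp add: RS R'_def gS)
      next
        case 2
        then show ?thesis using Rl[OF 2] by (simp add: R'_def gl[OF 2])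
      next
        case 3
        show ?thesis unfolding 3(2) Ri[OF 3(1)] R'_def using y[unfolded 3(2) gi] Ut(1)[OF 3(1)]
          by (cases "i \<in> S") (simp_all add: gi)
      qed
    qed
    have eq: "R x (p x) = R' x (p x)" if all: "\<forall>z\<in>V. R z (p z) \<noteq> 0" and x: "x \<in> V" for x
    proof -
      consider "x \<in> S" | "x < t" "x \<notin> S" | i where "i \<in> U" "x = t + i" using V_cases[OF x] by blast
      then show ?thesis
      proof cases
        case 1
        then show ?thesis by (simp add: RS R'_def gS)
      next
        case 2
        then show ?thesis using Rl[OF 2] by (simp add: R'_def gl[OF 2])
      next
        case 3
        have iV: "i \<in> V" "t + i \<in> V" using Ut[OF 3(1)] 3(1) by (auto simp: V_def)
        have "R (t + i) (p (t + i)) \<noteq> 0" using all iV by blast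
        then have pi: "p (t + i) = t + i \<or> p (t + i) = i" using Ri[OF 3(1)] by (auto split: if_splits)
        show ?thesis
        proof (cases "i \<in> S")
          case True
          have "p (t + i) = t + i"
          proof (rule ccontr)
            assume ne: "p (t + i) \<noteq> t + i"
            define z where "z = Hilbert_Choice.inv p (t + i)"
            have z: "p z = t + i" by (simp add: z_def permutes_inverses[OF p])
            have zV: "z \<in> V" using z iV permutes_in_image[OF p, of z] by simp
            have zi: "z \<noteq> t + i" using z ne by auto
            have Rz: "R z (t + i) \<noteq> 0" using all zV z by metis
            consider "z \<in> S" | "z < t" "z \<notin> S" | j where "j \<in> U" "z = t + j" using V_cases[OF zV] by blast
            then show False
            proof cases
              case 1
              then show ?thesis using Rz RS[OF 1] bt[OF 1] by (auto split: if_splits)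
            next
              case 2
              then show ?thesis using Rz Rl[OF 2] Mt[OF 2(1)] True by (auto split: if_splits)
            next
              case j: 3
              then show ?thesis using Rz Ri[OF j(1)] zi Ut[OF j(1)] by (auto split: if_splits)
            qed
          qed
          then show ?thesis using True unfolding 3(2) Ri[OF 3(1)] R'_def by (simp add: gi)
        next
          case False
          have "R i (p i) \<noteq> 0" using all iV by blast
          then have "p i = t + i" using Rl[of i] Ut[OF 3(1)] False by (auto split: if_splits)
          have "p (t + i) \<noteq> t + i"
          proof
            assume "p (t + i) = t + i"
            then have "p (t + i) = p i" using \<open>p i = t + i\<close> by simp
            then have "t + i = i" using permutes_inj[OF p] by (simp add: inj_eq)
            then show False using Ut[OF 3(1)] by simp
          qed
          then have "p (t + i) = i" using pi by simp
          then show ?thesis using False Ut(1)[OF 3(1)] unfolding 3(2) Ri[OF 3(1)] R'_def by (simp add: gi)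
        qed
      qed
    qed
    have "(\<Prod>x\<in>V. R x (p x)) = (\<Prod>x\<in>V. R' x (p x))"
    proof (cases "\<forall>z\<in>V. R z (p z) \<noteq> 0")
      case True
      then show ?thesis using eq by (intro prod.cong) auto
    next
      case False
      then obtain z where z: "z \<in> V" "R z (p z) = 0" by blast
      then have z': "R' z (p z) = 0" using eq'[OF z(1)] by metis
      have "(\<Prod>x\<in>V. R x (p x)) = 0" by (rule prod_zero[OF finV]) (use z in blast)
      moreover have "(\<Prod>x\<in>V. R' x (p x)) = 0" by (rule prod_zero[OF finV]) (use z z' in blast)
      ultimately show ?thesis by simp
    qed
    then show "(\<Prod>x\<in>V. R x (p x)) = (\<Prod>x\<in>V. if p x = gg x then ww x else 0)" by (simp add: R'_def)
  qed
  also have "\<dots> = (\<Prod>x\<in>V. ww x) * (if bij_betw gg V V then of_int (sign_on V gg) else 0)"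
    by (rule det_on_monomial[OF finV])
  also have "(\<Prod>x\<in>V. ww x) = (-1) ^ (t - card S) * (\<Prod>i\<in>U. if i \<in> S then \<theta> - (if i \<in> C then 2 else 0) else -1)"
  proof -
    have "(\<Prod>x\<in>V. ww x) = (\<Prod>x\<in>{..<t}. ww x) * (\<Prod>x\<in>(\<lambda>i. t + i) ` U. ww x)"
      unfolding V_def using finU by (intro prod.union_disjoint) auto
    also have "(\<Prod>x\<in>{..<t}. ww x) = (\<Prod>x\<in>{..<t}. if x \<in> S then 1 else -1)"
      by (rule prod.cong) (auto simp: gS gl)
    also have "\<dots> = (-1) ^ card ({..<t} - S)" using S by (simp add: prod.If_cases Diff_eq)
    also have "card ({..<t} - S) = t - card S" using S finite_subset[OF S] by (simp add: card_Diff_subset)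
    also have "(\<Prod>x\<in>(\<lambda>i. t + i) ` U. ww x) = (\<Prod>i\<in>U. ww (t + i))"
      by (simp add: prod.reindex)
    also have "\<dots> = (\<Prod>i\<in>U. if i \<in> S then \<theta> - (if i \<in> C then 2 else 0) else -1)"
      by (simp add: gi)
    finally show ?thesis .
  qed
  also have "(if bij_betw gg V V then of_int (sign_on V gg) else 0) = (-1) ^ card (U - S) * state_sign t M (S, T)"
  proof -
    \<comment> \<open>On the vertices, the candidate is \<open>state_map\<close> preceded by the transpositions of \<open>i\<close> and \<open>t + i\<close>
      for the unmatched labels \<open>i \<notin> S\<close>.\<close>
    define g0 where "g0 = (\<lambda>x. if x < t then state_map S T M x else x)"
    define \<tau> where "\<tau> = (\<lambda>x. if x < t then (if x \<in> U - S then t + x else x) else if x - t \<in> U - S then x - t else x)"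
    define K where "K = (U - S) \<union> (\<lambda>i. t + i) ` (U - S)"
    have finK: "finite K" using finU by (simp add: K_def)
    have KV: "K \<subseteq> V" using Ut by (auto simp: K_def V_def)
    have tauK: "\<tau> x \<in> K \<and> \<tau> (\<tau> x) = x \<and> \<tau> x \<noteq> x" if x: "x \<in> K" for x
    proof -
      consider "x \<in> U - S" | i where "i \<in> U - S" "x = t + i" using x by (auto simp: K_def)
      then show ?thesis
      proof cases
        case 1
        then have "x < t" using Ut by blast
        then show ?thesis using 1 by (simp add: K_def \<tau>_def)
      next
        case 2
        then have "i < t" using Ut by blast
        then show ?thesis using 2 by (simp add: K_def \<tau>_def)
      qed
    qed
    have permK: "\<tau> permutes K"
    proof (rule inj_imp_permutes[OF _ finK])
      show "inj_on \<tau> K" using tauK by (metis inj_on_inverseI)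
      show "\<tau> x = x" if "x \<notin> K" for x
      proof (cases "x < t")
        case True
        then show ?thesis using that by (auto simp: \<tau>_def K_def)
      next
        case False
        have "x - t \<notin> U - S"
        proof
          assume "x - t \<in> U - S"
          moreover have "x = t + (x - t)" using False by simp
          ultimately show False using that unfolding K_def by blast
        qed
        then show ?thesis using False by (auto simp: \<tau>_def)
      qed
    qed (use tauK in blast)
    have "card K = 2 * card (U - S)"
    proof -
      have "card K = card (U - S) + card ((\<lambda>i. t + i) ` (U - S))"
        unfolding K_def using finU Ut by (intro card_Un_disjoint) auto
      then show ?thesis by (simp add: card_image)
    qed
    then have sgn\<tau>: "sign \<tau> = (-1) ^ card (U - S)" using sign_involution[OF finK permK] tauK by simp
    have permV: "\<tau> permutes V" by (rule permutes_subset[OF permK KV])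
    have g: "gg x = (g0 \<circ> \<tau>) x" if x: "x \<in> V" for x
    proof -
      consider "x \<in> S" | "x < t" "x \<notin> S" | i where "i \<in> U" "x = t + i" using V_cases[OF x] by blast
      then show ?thesis
      proof cases
        case 1
        then have "x < t" using S by auto
        then show ?thesis using 1 by (simp add: gS g0_def \<tau>_def state_map_def b_def)
      next
        case 2
        then show ?thesis by (simp add: gl g0_def \<tau>_def state_map_def U_def unmatched_def)
      next
        case 3
        show ?thesis using 3(1) Ut[OF 3(1)] unfolding 3(2) gi by (simp add: g0_def \<tau>_def state_map_def)
      qed
    qed
    have g0t: "state_map S T M x < t" if "x < t" for x
      using that bt Mt by (auto simp: state_map_def b_def)
    have b1: "bij_betw gg V V \<longleftrightarrow> bij_betw (g0 \<circ> \<tau>) V V" by (rule bij_betw_cong) (use g in auto)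
    have b2: "bij_betw (g0 \<circ> \<tau>) V V \<longleftrightarrow> bij_betw g0 V V"
      using bij_betw_comp_iff[OF permutes_imp_bij[OF permV], of g0 V] by simp
    have b3: "bij_betw g0 V V \<longleftrightarrow> bij_betw (state_map S T M) {..<t} {..<t}"
    proof
      assume b: "bij_betw g0 V V"
      have inj': "inj_on (state_map S T M) {..<t}"
      proof (rule inj_onI)
        fix x y assume xy: "x \<in> {..<t}" "y \<in> {..<t}" "state_map S T M x = state_map S T M y"
        then have "g0 x = g0 y" by (simp add: g0_def)
        moreover have "x \<in> V" "y \<in> V" using xy by (auto simp: V_def)
        ultimately show "x = y" using b by (meson bij_betw_def inj_onD)
      qed
      moreover have "state_map S T M ` {..<t} = {..<t}"
        by (rule endo_inj_surj) (use g0t inj' in auto)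
      ultimately show "bij_betw (state_map S T M) {..<t} {..<t}" by (simp add: bij_betw_def)
    next
      assume b: "bij_betw (state_map S T M) {..<t} {..<t}"
      have b1: "bij_betw g0 {..<t} {..<t}" using b by (subst bij_betw_cong[of _ _ "state_map S T M"]) (auto simp: g0_def)
      have b2: "bij_betw g0 ((\<lambda>i. t + i) ` U) ((\<lambda>i. t + i) ` U)"
        by (subst bij_betw_cong[of _ _ id]) (auto simp: g0_def)
      show "bij_betw g0 V V" unfolding V_def by (rule bij_betw_combine[OF b1 b2]) auto
    qed
    have sg: "sign_on V gg = (-1) ^ card (U - S) * sign_on {..<t} (state_map S T M)" if b: "bij_betw g0 V V"
    proof -
      have "sign_on V gg = sign_on V (g0 \<circ> \<tau>)" by (rule sign_on_cong) (use g in auto)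
      also have "\<dots> = sign_on V g0 * sign_on V \<tau>"
        by (rule sign_on_compose[OF b permutes_imp_bij[OF permV] finV])
      also have "sign_on V \<tau> = sign \<tau>" by (rule sign_on_permutes[OF permV subset_refl])
      also have "sign_on V g0 = sign_on {..<t} (state_map S T M)"
        unfolding sign_on_def
      proof (rule arg_cong[of _ _ sign], rule ext)
        fix x show "restrict_id g0 V x = restrict_id (state_map S T M) {..<t} x"
          by (auto simp: restrict_id_def g0_def V_def)
      qed
      finally show ?thesis using sgn\<tau> by simp
    qed
    show ?thesis unfolding b1 b2 b3 state_sign_def prod.case using sg[unfolded b3] by auto
  qed
  also have "(-1) ^ (t - card S) * (\<Prod>i\<in>U. if i \<in> S then \<theta> - (if i \<in> C then 2 else 0) else -1) *
      ((-1) ^ card (U - S) * state_sign t M (S, T)) =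
    (-1) ^ (t - card S) * state_sign t M (S, T) *
      (\<Prod>i\<in>U. if i \<in> S then \<theta> - (if i \<in> C then 2 else 0) else 1)"
  proof -
    have "(\<Prod>i\<in>U. if i \<in> S then \<theta> - (if i \<in> C then 2 else 0) else -1) =
      (\<Prod>i\<in>U. (if i \<in> S then 1 else -1) * (if i \<in> S then \<theta> - (if i \<in> C then 2 else 0) else 1))"
      by (rule prod.cong) auto
    also have "\<dots> = (\<Prod>i\<in>U. if i \<in> S then 1 else -1) * (\<Prod>i\<in>U. if i \<in> S then \<theta> - (if i \<in> C then 2 else 0) else 1)"
      by (rule prod.distrib)
    also have "(\<Prod>i\<in>U. if i \<in> S then 1 else -1 :: complex) = (-1) ^ card (U - S)"
      using finU by (simp add: prod.If_cases Diff_eq)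
    finally have P: "(\<Prod>i\<in>U. if i \<in> S then \<theta> - (if i \<in> C then 2 else 0) else -1) =
      (-1) ^ card (U - S) * (\<Prod>i\<in>U. if i \<in> S then \<theta> - (if i \<in> C then 2 else 0) else 1)" .
    have "a * (s * q) * (s * g) = a * g * q" if "s * s = 1" for a s q g :: complex
    proof -
      have "a * (s * q) * (s * g) = (s * s) * (a * g * q)" by (simp only: mult_ac)
      then show ?thesis using that by simp
    qed
    then show ?thesis unfolding P by (simp flip: power_mult_distrib)
  qed
  finally show ?thesis by (simp add: U_def)
qed

section \<open>The span of the matching fragments\<close>

text \<open>
  Since the connection form depends on the fragments only through their state values,
  linear combinations of fragments are identified with the resulting functions on states.
\<close>

definition spanned :: "complex \<Rightarrow> nat \<Rightarrow> (nat set \<times> nat set \<Rightarrow> complex) \<Rightarrow> bool" where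
  "spanned \<theta> t q \<longleftrightarrow> (\<exists>A c. finite A \<and> A \<subseteq> fragments t \<and>
     (\<forall>s\<in>states t. q s = (\<Sum>F\<in>A. c F * state_value \<theta> F s)))"

lemma spanned_zero: "spanned \<theta> t (\<lambda>s. 0)"
  unfolding spanned_def by (intro exI[of _ "{}"]) simp

lemma spanned_fragment: "F \<in> fragments t \<Longrightarrow> spanned \<theta> t (state_value \<theta> F)"
  unfolding spanned_def by (intro exI[of _ "{F}"] exI[of _ "\<lambda>_. 1"]) simp

lemma spanned_scale:
  assumes "spanned \<theta> t q"
  shows "spanned \<theta> t (\<lambda>s. a * q s)"
proof -
  obtain A c where "finite A" "A \<subseteq> fragments t" "\<forall>s\<in>states t. q s = (\<Sum>F\<in>A. c F * state_value \<theta> F s)"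
    using assms by (auto simp: spanned_def)
  then show ?thesis unfolding spanned_def
    by (intro exI[of _ A] exI[of _ "\<lambda>F. a * c F"]) (simp add: sum_distrib_left mult.assoc)
qed

lemma spanned_add:
  assumes "spanned \<theta> t q" "spanned \<theta> t r"
  shows "spanned \<theta> t (\<lambda>s. q s + r s)"
proof -
  obtain A c where A: "finite A" "A \<subseteq> fragments t" "\<forall>s\<in>states t. q s = (\<Sum>F\<in>A. c F * state_value \<theta> F s)"
    using assms by (auto simp: spanned_def)
  obtain B d where B: "finite B" "B \<subseteq> fragments t" "\<forall>s\<in>states t. r s = (\<Sum>F\<in>B. d F * state_value \<theta> F s)"
    using assms by (auto simp: spanned_def)
  have ext: "(\<Sum>F\<in>C. e F * state_value \<theta> F s) = (\<Sum>F\<in>A \<union> B. (if F \<in> C then e F else 0) * state_value \<theta> F s)"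
    if "C \<subseteq> A \<union> B" for C e s
    using that A(1) B(1) by (intro sum.mono_neutral_cong_left) auto
  have "\<forall>s\<in>states t. q s + r s =
      (\<Sum>F\<in>A \<union> B. ((if F \<in> A then c F else 0) + (if F \<in> B then d F else 0)) * state_value \<theta> F s)"
    using A(3) B(3) ext[of A] ext[of B] by (simp only: distrib_right sum.distrib) simp
  then show ?thesis unfolding spanned_def using A B
    by (intro exI[of _ "A \<union> B"] exI[of _ "\<lambda>F. (if F \<in> A then c F else 0) + (if F \<in> B then d F else 0)"]) simp
qed

lemma spanned_sum:
  assumes "finite B" "\<And>b. b \<in> B \<Longrightarrow> spanned \<theta> t (q b)"
  shows "spanned \<theta> t (\<lambda>s. \<Sum>b\<in>B. q b s)"
  using assms
proof (induction B rule: finite_induct)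
  case empty
  then show ?case by (simp add: spanned_zero)
next
  case (insert b B)
  then show ?case using spanned_add[of \<theta> t "q b" "\<lambda>s. \<Sum>b\<in>B. q b s"] by simp
qed

lemma spanned_cong:
  assumes "spanned \<theta> t q" "\<And>s. s \<in> states t \<Longrightarrow> r s = q s"
  shows "spanned \<theta> t r"
  using assms unfolding spanned_def by metis

text \<open>
  The state value of a matching fragment with two changes: the factor of an unmatched label \<open>i\<close> is an arbitrary
  weight \<open>m i\<close> depending on whether \<open>i \<in> S\<close>, and for the pairs in \<open>R\<close> exactly one of the two
  matched labels must lie in \<open>S\<close>.
\<close>

definition weighted_state :: "nat \<Rightarrow> (nat \<Rightarrow> nat) \<Rightarrow> nat set \<Rightarrow> (nat \<Rightarrow> bool \<Rightarrow> complex) \<Rightarrow> nat set \<times> nat set \<Rightarrow> complex" where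
  "weighted_state t M R m = (\<lambda>(S, T). (-1) ^ (t - card S) * state_sign t M (S, T) *
     (\<Prod>i\<in>unmatched t M. m i (i \<in> S)) * (if \<forall>i\<in>R. i \<in> S \<longleftrightarrow> M i \<notin> S then 1 else 0))"

text \<open>
  At an unmatched label the vertex without and with a loop give the weight vectors \<open>(1, \<theta>)\<close> and
  \<open>(1, \<theta> - 2)\<close>, where the first entry belongs to \<open>i \<notin> S\<close>. They are linearly independent, so every pair of weights is a
  combination \<open>\<mu> (1, \<theta> - 2) + \<nu> (1, \<theta>)\<close>; the product over all unmatched labels is expanded.
\<close>

lemma spanned_weighted_free:
  assumes M: "partial_matching t M"
  shows "spanned \<theta> t (weighted_state t M {} m)"
proof -
  define U where "U = unmatched t M"
  have finU: "finite U" by (simp add: U_def unmatched_def)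
  define \<mu> where "\<mu> = (\<lambda>i. (\<theta> * m i False - m i True) / 2)"
  define \<nu> where "\<nu> = (\<lambda>i. m i False - \<mu> i)"
  define c where "c = (\<lambda>B. (\<Prod>i\<in>B. \<mu> i) * (\<Prod>i\<in>U - B. \<nu> i))"
  have "spanned \<theta> t (\<lambda>s. \<Sum>B\<in>Pow U. c B * state_value \<theta> (matching_fragment t M B) s)"
    using finU spanned_scale[OF spanned_fragment[OF matching_fragment_in[OF M]]] by (intro spanned_sum) auto
  then show ?thesis
  proof (rule spanned_cong)
    fix s assume "s \<in> states t"
    then obtain S T where s: "s = (S, T)" "(S, T) \<in> states t" by (cases s) auto
    have "(\<Prod>i\<in>U. m i (i \<in> S)) =
        (\<Prod>i\<in>U. \<mu> i * (if i \<in> S then \<theta> - 2 else 1) + \<nu> i * (if i \<in> S then \<theta> else 1))"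
      by (rule prod.cong[OF refl]) (simp add: \<nu>_def \<mu>_def field_simps)
    also have "\<dots> = (\<Sum>B\<in>Pow U. (\<Prod>i\<in>B. \<mu> i * (if i \<in> S then \<theta> - 2 else 1)) *
        (\<Prod>i\<in>U - B. \<nu> i * (if i \<in> S then \<theta> else 1)))"
      by (rule prod_add[OF finU])
    also have "\<dots> = (\<Sum>B\<in>Pow U. c B * (\<Prod>i\<in>U. if i \<in> S then \<theta> - (if i \<in> B then 2 else 0) else 1))"
    proof (rule sum.cong[OF refl])
      fix B assume B: "B \<in> Pow U"
      then have UB: "B \<union> (U - B) = U" "finite B" using finU finite_subset by auto
      have "(\<Prod>i\<in>U. if i \<in> S then \<theta> - (if i \<in> B then 2 else 0) else 1) =
          (\<Prod>i\<in>B. if i \<in> S then \<theta> - (if i \<in> B then 2 else 0) else 1) *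
          (\<Prod>i\<in>U - B. if i \<in> S then \<theta> - (if i \<in> B then 2 else 0) else 1)"
        by (subst UB(1)[symmetric], subst prod.union_disjoint) (use UB finU in auto)
      also have "\<dots> = (\<Prod>i\<in>B. if i \<in> S then \<theta> - 2 else 1) * (\<Prod>i\<in>U - B. if i \<in> S then \<theta> else 1)"
        by (intro arg_cong2[where f = "(*)"] prod.cong) auto
      finally show "(\<Prod>i\<in>B. \<mu> i * (if i \<in> S then \<theta> - 2 else 1)) * (\<Prod>i\<in>U - B. \<nu> i * (if i \<in> S then \<theta> else 1)) =
          c B * (\<Prod>i\<in>U. if i \<in> S then \<theta> - (if i \<in> B then 2 else 0) else 1)"
        by (simp only: prod.distrib c_def mult_ac)
    qed
    finally have "(\<Prod>i\<in>U. m i (i \<in> S)) =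
      (\<Sum>B\<in>Pow U. c B * (\<Prod>i\<in>U. if i \<in> S then \<theta> - (if i \<in> B then 2 else 0) else 1))" .
    then show "weighted_state t M {} m s = (\<Sum>B\<in>Pow U. c B * state_value \<theta> (matching_fragment t M B) s)"
      unfolding s weighted_state_def prod.case state_value_matching[OF M s(2)] U_def[symmetric]
      by (simp add: sum_distrib_left mult_ac)
  qed
qed

definition unpair :: "(nat \<Rightarrow> nat) \<Rightarrow> nat \<Rightarrow> nat \<Rightarrow> nat" where
  "unpair M i = M(i := i, M i := M i)"

lemma unpair:
  assumes M: "partial_matching t M" and i: "i < t" "M i \<noteq> i"
  shows "partial_matching t (unpair M i)"
    "unmatched t (unpair M i) = insert i (insert (M i) (unmatched t M))"
    "i \<notin> unmatched t M" "M i \<notin> unmatched t M" "M i < t" "M (M i) = i"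
proof -
  have Mi: "M i < t" "M (M i) = i" using M i by (auto simp: partial_matching_def)
  show "M i < t" "M (M i) = i" by (rule Mi)+
  have x: "M x \<noteq> i" "M x \<noteq> M i" if "x < t" "x \<noteq> i" "x \<noteq> M i" for x
  proof -
    have "M (M x) = x" using M that by (simp add: partial_matching_def)
    then show "M x \<noteq> i" "M x \<noteq> M i" using that Mi by auto
  qed
  show "partial_matching t (unpair M i)"
    unfolding partial_matching_def
  proof (intro allI impI)
    fix y assume y: "y < t"
    show "unpair M i y < t \<and> unpair M i (unpair M i y) = y"
    proof (cases "y = i \<or> y = M i")
      case True
      then show ?thesis using y by (auto simp: unpair_def)
    next
      case False
      then have "unpair M i y = M y" by (simp add: unpair_def)
      moreover have "unpair M i (M y) = M (M y)" using x[OF y] False by (simp add: unpair_def)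
      ultimately show ?thesis using M y by (simp add: partial_matching_def)
    qed
  qed
  show "unmatched t (unpair M i) = insert i (insert (M i) (unmatched t M))"
    using i Mi by (auto simp: unmatched_def unpair_def)
  show "i \<notin> unmatched t M" "M i \<notin> unmatched t M" using i Mi by (auto simp: unmatched_def)
qed

text \<open>
  If both labels lie in \<open>S\<close>, the matching is never consulted at them. If neither does, the state maps
  differ by the transposition of \<open>i\<close> and \<open>M i\<close>.
\<close>

lemma state_sign_unpair:
  assumes M: "partial_matching t M" and i: "i < t" "M i \<noteq> i"
  shows "i \<in> S \<Longrightarrow> M i \<in> S \<Longrightarrow> state_sign t (unpair M i) (S, T) = state_sign t M (S, T)"
    "i \<notin> S \<Longrightarrow> M i \<notin> S \<Longrightarrow> state_sign t (unpair M i) (S, T) = - state_sign t M (S, T)"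
proof -
  note u = unpair[OF assms]
  show "state_sign t (unpair M i) (S, T) = state_sign t M (S, T)" if "i \<in> S" "M i \<in> S"
  proof -
    have "state_map S T (unpair M i) = state_map S T M"
      using that by (auto simp: state_map_def unpair_def fun_eq_iff)
    then show ?thesis by (simp add: state_sign_def)
  qed
  show "state_sign t (unpair M i) (S, T) = - state_sign t M (S, T)" if ni: "i \<notin> S" "M i \<notin> S"
  proof -
    define \<tau> where "\<tau> = transpose i (M i)"
    define g where "g = state_map S T (unpair M i)"
    have \<tau>: "\<tau> permutes {..<t}" unfolding \<tau>_def by (rule permutes_swap_id) (use i u in auto)
    have "state_map S T M = g \<circ> \<tau>"
    proof
      fix x show "state_map S T M x = (g \<circ> \<tau>) x"
        using ni u(6) by (auto simp: state_map_def g_def \<tau>_def transpose_def unpair_def)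
    qed
    moreover have "bij_betw (g \<circ> \<tau>) {..<t} {..<t} \<longleftrightarrow> bij_betw g {..<t} {..<t}"
      using bij_betw_comp_iff[OF permutes_imp_bij[OF \<tau>], of g "{..<t}"] by simp
    moreover have "sign_on {..<t} (g \<circ> \<tau>) = - sign_on {..<t} g" if "bij_betw g {..<t} {..<t}"
    proof -
      have "sign_on {..<t} (g \<circ> \<tau>) = sign_on {..<t} g * sign_on {..<t} \<tau>"
        by (rule sign_on_compose[OF that permutes_imp_bij[OF \<tau>]]) simp
      also have "sign_on {..<t} \<tau> = -1" unfolding \<tau>_def by (rule sign_on_transpose) (use i u in auto)
      finally show ?thesis by simp
    qed
    ultimately show ?thesis by (simp add: state_sign_def g_def[symmetric])
  qed
qed

text \<open>
  The restriction at a pair \<open>{i, j}\<close> is enforced by inclusion and exclusion: to the edge between \<open>i\<close> and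
  \<open>j\<close>, the two unmatched labels with weights concentrated on \<open>i, j \<notin> S\<close> are added and those
  with weights concentrated on \<open>i, j \<in> S\<close> are subtracted. By \<open>state_sign_unpair\<close> this
  cancels exactly the states in which \<open>S\<close> contains both labels or neither.
\<close>

lemma spanned_weighted:
  assumes "partial_matching t M" "R \<subseteq> {..<t} - unmatched t M" "M ` R \<subseteq> R"
  shows "spanned \<theta> t (weighted_state t M R m)"
  using assms
proof (induction "card R" arbitrary: R M m rule: less_induct)
  case less
  note M = less.prems(1)
  have finR: "finite R" using less.prems(2) finite_subset by blast
  show ?case
  proof (cases "R = {}")
    case True
    then show ?thesis using spanned_weighted_free[OF M] by simp
  next
    case False
    then obtain i where i: "i \<in> R" by blast
    define j where "j = M i"
    have it: "i < t" "M i \<noteq> i" using i less.prems(2) by (auto simp: unmatched_def)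
    note u = unpair[OF M it]
    have j: "j \<in> R" "j < t" "M j = i" "j \<noteq> i" using i less.prems(3) u it by (auto simp: j_def)
    define R' where "R' = R - {i, j}"
    define M' where "M' = unpair M i"
    have cR: "card R' < card R" unfolding R'_def using finR i by (intro psubset_card_mono) auto
    have Mx: "M (M x) = x" if "x \<in> R" for x
      using that less.prems(1,2) by (auto simp: partial_matching_def)
    have MR': "M x \<in> R'" if x: "x \<in> R'" for x
    proof -
      have xR: "x \<in> R" "x \<noteq> i" "x \<noteq> j" using x by (auto simp: R'_def)
      have "M x \<noteq> i" "M x \<noteq> j" using Mx[OF xR(1)] xR j(3) by (auto simp: j_def)
      then show ?thesis using xR less.prems(3) by (auto simp: R'_def)
    qed
    have M'x: "M' x = M x" if "x \<in> R'" for x using that by (auto simp: M'_def unpair_def R'_def j_def)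
    have s1: "spanned \<theta> t (weighted_state t M R' n)" for n
      by (rule less.hyps[OF cR M]) (use less.prems(2) MR' in \<open>auto simp: R'_def\<close>)
    have s2: "spanned \<theta> t (weighted_state t M' R' n)" for n
    proof (rule less.hyps[OF cR])
      show "partial_matching t M'" using u(1) by (simp add: M'_def)
      show "R' \<subseteq> {..<t} - unmatched t M'" using less.prems(2) u(2) by (auto simp: R'_def M'_def j_def)
      show "M' ` R' \<subseteq> R'" using MR' M'x by auto
    qed
    define e where "e = (\<lambda>b. m(i := \<lambda>x. if x = b then 1 else 0, j := \<lambda>x. if x = b then 1 else (0::complex)))"
    have "spanned \<theta> t (\<lambda>s. weighted_state t M R' m s +
        (weighted_state t M' R' (e False) s + (-1) * weighted_state t M' R' (e True) s))"
      by (intro spanned_add s1 s2 spanned_scale)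
    then show ?thesis
    proof (rule spanned_cong)
      fix s assume "s \<in> states t"
      obtain S T where s: "s = (S, T)" by (cases s)
      define U where "U = unmatched t M"
      have finU: "finite U" by (simp add: U_def unmatched_def)
      have ij: "i \<notin> U" "j \<notin> U" "unmatched t M' = insert i (insert j U)"
        using u(2,3,4) by (simp_all add: U_def M'_def j_def)
      define c where "c = (-1) ^ (t - card S) * (\<Prod>x\<in>U. m x (x \<in> S)) * (if \<forall>x\<in>R'. x \<in> S \<longleftrightarrow> M x \<notin> S then 1 else 0)"
      have "(\<Prod>x\<in>U. e b x (x \<in> S)) = (\<Prod>x\<in>U. m x (x \<in> S))" for b
        using ij by (intro prod.cong) (auto simp: e_def)
      then have pe: "(\<Prod>x\<in>unmatched t M'. e b x (x \<in> S)) =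
          (if (i \<in> S) = b \<and> (j \<in> S) = b then \<Prod>x\<in>U. m x (x \<in> S) else 0)" for b
        unfolding ij(3) using finU ij(1,2) j(4) by (simp add: e_def)
      have R'eq: "(\<forall>x\<in>R'. x \<in> S \<longleftrightarrow> M' x \<notin> S) \<longleftrightarrow> (\<forall>x\<in>R'. x \<in> S \<longleftrightarrow> M x \<notin> S)" using M'x by simp
      have Req: "(\<forall>x\<in>R. x \<in> S \<longleftrightarrow> M x \<notin> S) \<longleftrightarrow> (i \<in> S \<longleftrightarrow> j \<notin> S) \<and> (\<forall>x\<in>R'. x \<in> S \<longleftrightarrow> M x \<notin> S)"
      proof -
        have "R = insert i (insert j R')" using i j by (auto simp: R'_def)
        then show ?thesis using j(3) by (auto simp: j_def[symmetric])
      qed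
      have w1: "weighted_state t M R' m s = c * state_sign t M (S, T)"
        by (simp add: weighted_state_def s c_def U_def)
      have w2: "weighted_state t M' R' (e b) s =
          (if (i \<in> S) = b \<and> (j \<in> S) = b then c * state_sign t M' (S, T) else 0)" for b
        unfolding weighted_state_def s prod.case pe R'eq c_def by simp
      have w3: "weighted_state t M R m s = (if i \<in> S \<longleftrightarrow> j \<notin> S then c * state_sign t M (S, T) else 0)"
        unfolding weighted_state_def s prod.case Req c_def U_def by simp
      note ss = state_sign_unpair[OF M it, of S T, folded M'_def j_def]
      consider "i \<in> S" "j \<in> S" | "i \<notin> S" "j \<notin> S" | "i \<in> S \<longleftrightarrow> j \<notin> S" by blast
      then show "weighted_state t M R m s = weighted_state t M R' m s +
        (weighted_state t M' R' (e False) s + (-1) * weighted_state t M' R' (e True) s)"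
      proof cases
        case 1
        then show ?thesis unfolding w1 w2 w3 using ss(1) by simp
      next
        case 2
        then show ?thesis unfolding w1 w2 w3 using ss(2) by simp
      next
        case 3
        then have "\<not> ((i \<in> S) = b \<and> (j \<in> S) = b)" for b by auto
        then show ?thesis unfolding w1 w2 w3 using 3 by simp
      qed
    qed
  qed
qed

section \<open>Two-coloured Motzkin words\<close>

text \<open>
  A state \<open>(S, T)\<close> is a word whose letter at \<open>i\<close> is \<open>(i \<in> S, i \<in> T)\<close>. Reading \<open>(True, False)\<close> as an up step,
  \<open>(False, True)\<close> as a down step and the two remaining letters as level steps of two colours, \<open>words n h\<close>
  are the two-coloured Motzkin prefixes of length \<open>n\<close> that end at height \<open>h\<close>.
\<close>

type_synonym word = "(bool \<times> bool) list"

fun words :: "nat \<Rightarrow> nat \<Rightarrow> word set" where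
  "words 0 h = (if h = 0 then {[]} else {})"
| "words (Suc n) h = (\<lambda>w. w @ [(True, True)]) ` words n h \<union> (\<lambda>w. w @ [(False, False)]) ` words n h
     \<union> (\<lambda>w. w @ [(False, True)]) ` words n (Suc h)
     \<union> (if h = 0 then {} else (\<lambda>w. w @ [(True, False)]) ` words n (h - 1))"

text \<open>
  \<open>M\<close> matches every closing letter to an earlier opening letter; \<open>P\<close> is the set of opening letters still
  waiting for a partner. The matching may have crossings.
\<close>

definition realizes :: "word \<Rightarrow> (nat \<Rightarrow> nat) \<Rightarrow> nat set \<Rightarrow> bool" where
  "realizes w M P \<longleftrightarrow> P \<subseteq> {i. i < length w \<and> w ! i = (True, False)} \<and> (\<forall>i\<in>P. M i = i) \<and>
     (\<forall>i\<ge>length w. M i = i) \<and>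
     (\<forall>i<length w. i \<notin> P \<longrightarrow> (case w ! i of
        (True, False) \<Rightarrow> i < M i \<and> M i < length w \<and> w ! M i = (False, True) \<and> M (M i) = i
      | (False, True) \<Rightarrow> M i < i \<and> w ! M i = (True, False) \<and> M (M i) = i
      | _ \<Rightarrow> M i = i))"

lemma finite_words: "finite (words n h)"
  by (induction n arbitrary: h) auto

lemma length_words: "w \<in> words n h \<Longrightarrow> length w = n"
  by (induction n arbitrary: h w) (auto split: if_splits)

lemma realizesD:
  assumes "realizes w M P"
  shows "\<And>i. i \<in> P \<Longrightarrow> i < length w \<and> w ! i = (True, False) \<and> M i = i"
    "\<And>i. i \<ge> length w \<Longrightarrow> M i = i"
    "\<And>i. i < length w \<Longrightarrow> i \<notin> P \<Longrightarrow> w ! i = (True, False) \<Longrightarrow> i < M i \<and> M i < length w \<and> w ! M i = (False, True) \<and> M (M i) = i"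
    "\<And>i. i < length w \<Longrightarrow> w ! i = (False, True) \<Longrightarrow> M i < i \<and> w ! M i = (True, False) \<and> M (M i) = i"
    "\<And>i. i < length w \<Longrightarrow> w ! i = (b, b) \<Longrightarrow> M i = i"
proof -
  note r = assms[unfolded realizes_def]
  note A = r[THEN conjunct1] r[THEN conjunct2, THEN conjunct1] r[THEN conjunct2, THEN conjunct2, THEN conjunct1]
    r[THEN conjunct2, THEN conjunct2, THEN conjunct2]
  have c: "case w ! i of
        (True, False) \<Rightarrow> i < M i \<and> M i < length w \<and> w ! M i = (False, True) \<and> M (M i) = i
      | (False, True) \<Rightarrow> M i < i \<and> w ! M i = (True, False) \<and> M (M i) = i
      | _ \<Rightarrow> M i = i" if "i < length w" "i \<notin> P" for i
    by (rule A(4)[rule_format, OF that])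
  show P: "\<And>i. i \<in> P \<Longrightarrow> i < length w \<and> w ! i = (True, False) \<and> M i = i"
    "\<And>i. i \<ge> length w \<Longrightarrow> M i = i" using A(1,2,3) by auto
  show "i < M i \<and> M i < length w \<and> w ! M i = (False, True) \<and> M (M i) = i"
    if "i < length w" "i \<notin> P" "w ! i = (True, False)" for i
    using c[OF that(1,2)] that(3) by simp
  show "M i < i \<and> w ! M i = (True, False) \<and> M (M i) = i" if "i < length w" "w ! i = (False, True)" for i
  proof -
    have "i \<notin> P" using P(1)[of i] that by auto
    then show ?thesis using c[OF that(1)] that by simp
  qed
  show "M i = i" if "i < length w" "w ! i = (b, b)" for i
  proof -
    have "i \<notin> P" using P(1)[of i] that by (cases b) auto
    then show ?thesis using c[OF that(1)] that by (cases b) auto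
  qed
qed

lemma realizesI:
  assumes "\<And>i. i \<in> P \<Longrightarrow> i < length w \<and> w ! i = (True, False) \<and> M i = i"
    "\<And>i. i \<ge> length w \<Longrightarrow> M i = i"
    "\<And>i. i < length w \<Longrightarrow> i \<notin> P \<Longrightarrow> w ! i = (True, False) \<Longrightarrow> i < M i \<and> M i < length w \<and> w ! M i = (False, True) \<and> M (M i) = i"
    "\<And>i. i < length w \<Longrightarrow> w ! i = (False, True) \<Longrightarrow> M i < i \<and> w ! M i = (True, False) \<and> M (M i) = i"
    "\<And>i b. i < length w \<Longrightarrow> w ! i = (b, b) \<Longrightarrow> M i = i"
  shows "realizes w M P"
  unfolding realizes_def
proof (intro conjI allI impI)
  fix i assume i: "i < length w" "i \<notin> P"
  show "case w ! i of
        (True, False) \<Rightarrow> i < M i \<and> M i < length w \<and> w ! M i = (False, True) \<and> M (M i) = i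
      | (False, True) \<Rightarrow> M i < i \<and> w ! M i = (True, False) \<and> M (M i) = i
      | _ \<Rightarrow> M i = i"
  proof -
    obtain a b where ab: "w ! i = (a, b)" by fastforce
    then show ?thesis using assms(3)[OF i] assms(4)[OF i(1)] assms(5)[OF i(1), of a]
      by (cases a; cases b) auto
  qed
qed (use assms(1,2) in auto)

text \<open>
  A new closing letter takes an arbitrary waiting opening letter as its partner.
\<close>

lemma words_realizable:
  "w \<in> words n h \<Longrightarrow> \<exists>M P. realizes w M P \<and> card P = h"
proof (induction n arbitrary: h w)
  case 0
  then show ?case by (intro exI[of _ id] exI[of _ "{}"]) (auto simp: realizes_def split: if_splits)
next
  case (Suc n)
  consider v b where "v \<in> words n h" "w = v @ [(b, b)]" | v where "v \<in> words n (Suc h)" "w = v @ [(False, True)]"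
    | v where "h \<noteq> 0" "v \<in> words n (h - 1)" "w = v @ [(True, False)]"
    using Suc.prems by (auto split: if_splits)
  then show ?case
  proof cases
    case (1 v b)
    then obtain M P where MP: "realizes v M P" "card P = h" using Suc.IH by blast
    note r = realizesD[OF MP(1)]
    have "realizes w M P"
    proof (rule realizesI)
      fix i assume "i \<in> P"
      then have "i < length v \<and> v ! i = (True, False) \<and> M i = i" by (rule r(1))
      then show "i < length w \<and> w ! i = (True, False) \<and> M i = i" using 1 by (simp add: nth_append)
    next
      fix i assume "i < length w" "i \<notin> P" "w ! i = (True, False)"
      then have "i < length v" "v ! i = (True, False)" using 1 by (auto simp: nth_append split: if_splits)
      then show "i < M i \<and> M i < length w \<and> w ! M i = (False, True) \<and> M (M i) = i"
        using r(3)[of i] \<open>i \<notin> P\<close> 1 by (simp add: nth_append)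
    next
      fix i assume "i < length w" "w ! i = (False, True)"
      then have "i < length v" "v ! i = (False, True)" using 1 by (auto simp: nth_append split: if_splits)
      then show "M i < i \<and> w ! M i = (True, False) \<and> M (M i) = i" using r(4)[of i] 1 by (simp add: nth_append)
    next
      fix i c assume i: "i < length w" "w ! i = (c, c)"
      show "M i = i"
      proof (cases "i < length v")
        case True
        then show ?thesis using r(5)[of i c] i 1 by (simp add: nth_append)
      qed (use r(2) in simp)
    next
      fix i assume "i \<ge> length w"
      then show "M i = i" using r(2)[of i] 1 by simp
    qed
    then show ?thesis using MP(2) by blast
  next
    case (2 v)
    then obtain M P where MP: "realizes v M P" "card P = Suc h" using Suc.IH by blast
    note r = realizesD[OF MP(1)]
    obtain p where p: "p \<in> P" using MP(2) by fastforce
    define N where "N = M(p := length v, length v := p)"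
    have pv: "p < length v" "v ! p = (True, False)" "M p = p" using r(1)[OF p] by auto
    have Mlt: "M i < length v" if "i < length v" for i
    proof (cases "i \<in> P")
      case True
      then show ?thesis using r(1)[OF True] that by simp
    next
      case False
      obtain a b where "v ! i = (a, b)" by fastforce
      then show ?thesis using r(3)[OF that False] r(4)[OF that] r(5)[OF that, of a] that by (cases a; cases b) auto
    qed
    have N: "N i = M i" "M i \<noteq> p" if "i < length v" "i \<noteq> p" "M (M i) = i" for i
      using that pv by (auto simp: N_def)
    have "realizes w N (P - {p})"
    proof (rule realizesI)
      fix i assume "i \<in> P - {p}"
      then show "i < length w \<and> w ! i = (True, False) \<and> N i = i"
        using r(1)[of i] 2 by (auto simp: nth_append N_def)
    next
      fix i assume "i \<ge> length w"
      then show "N i = i" using r(2)[of i] 2 pv by (auto simp: N_def)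
    next
      fix i assume i: "i < length w" "i \<notin> P - {p}" "w ! i = (True, False)"
      then have iv: "i < length v" "v ! i = (True, False)" using 2 by (auto simp: nth_append split: if_splits)
      show "i < N i \<and> N i < length w \<and> w ! N i = (False, True) \<and> N (N i) = i"
      proof (cases "i = p")
        case True
        then show ?thesis using 2 pv by (simp add: N_def nth_append)
      next
        case False
        then have ri: "i < M i \<and> M i < length v \<and> v ! M i = (False, True) \<and> M (M i) = i"
          using r(3)[of i] iv i(2) by simp
        then have "N i = M i" "M i \<noteq> p" using N[of i] iv False by auto
        moreover have "N (M i) = i" using ri \<open>M i \<noteq> p\<close> by (simp add: N_def)
        ultimately show ?thesis using ri 2 by (simp add: nth_append)
      qed
    next
      fix i assume i: "i < length w" "w ! i = (False, True)"
      show "N i < i \<and> w ! N i = (True, False) \<and> N (N i) = i"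
      proof (cases "i = length v")
        case True
        then show ?thesis using 2 pv by (simp add: N_def nth_append)
      next
        case False
        then have iv: "i < length v" "v ! i = (False, True)" using i 2 by (auto simp: nth_append split: if_splits)
        then have ri: "M i < i \<and> v ! M i = (True, False) \<and> M (M i) = i" using r(4)[of i] by simp
        have "i \<noteq> p" using iv pv by auto
        then have "N i = M i" "M i \<noteq> p" using N[of i] iv ri by auto
        moreover have "N (M i) = i" using ri \<open>M i \<noteq> p\<close> Mlt[OF iv(1)] by (simp add: N_def)
        ultimately show ?thesis using ri 2 iv Mlt[OF iv(1)] by (simp add: nth_append)
      qed
    next
      fix i c assume i: "i < length w" "w ! i = (c, c)"
      then have iv: "i < length v" "v ! i = (c, c)" using 2 by (auto simp: nth_append split: if_splits)
      then have "i \<noteq> p" using pv by (cases c) auto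
      then show "N i = i" using r(5)[of i c] iv by (simp add: N_def)
    qed
    moreover have "card (P - {p}) = h" using MP(2) p by simp
    ultimately show ?thesis by blast
  next
    case (3 v)
    then obtain M P where MP: "realizes v M P" "card P = h - 1" using Suc.IH by blast
    note r = realizesD[OF MP(1)]
    have finP: "finite P" by (rule finite_subset[of _ "{..<length v}"]) (use r(1) in auto)
    have nP: "length v \<notin> P" using r(1) by blast
    have "realizes w M (insert (length v) P)"
    proof (rule realizesI)
      fix i assume "i \<in> insert (length v) P"
      then show "i < length w \<and> w ! i = (True, False) \<and> M i = i"
        using r(1)[of i] r(2)[of i] 3 by (auto simp: nth_append)
    next
      fix i assume "i < length w" "i \<notin> insert (length v) P" "w ! i = (True, False)"
      then have "i < length v" "v ! i = (True, False)" "i \<notin> P" using 3 by (auto simp: nth_append split: if_splits)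
      then show "i < M i \<and> M i < length w \<and> w ! M i = (False, True) \<and> M (M i) = i"
        using r(3)[of i] 3 by (simp add: nth_append)
    next
      fix i assume "i < length w" "w ! i = (False, True)"
      then have "i < length v" "v ! i = (False, True)" using 3 by (auto simp: nth_append split: if_splits)
      then show "M i < i \<and> w ! M i = (True, False) \<and> M (M i) = i" using r(4)[of i] 3 by (simp add: nth_append)
    next
      fix i c assume "i < length w" "w ! i = (c, c)"
      then have "i < length v" "v ! i = (c, c)" using 3 by (auto simp: nth_append split: if_splits)
      then show "M i = i" using r(5)[of i c] by simp
    qed (use r(2) 3 in auto)
    moreover have "card (insert (length v) P) = h" using MP(2) 3 finP nP by simp
    ultimately show ?thesis by blast
  qed
qed

text \<open>
  Both sides satisfy the recursion of the words, which is Pascal's rule applied twice. At \<open>h = 0\<close> the up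
  step is missing; there the binomial coefficients on the two sides of the reflection cancel because
  \<open>C(2n,n-1) = C(2n,n+1)\<close>.
\<close>

lemma card_words: "int (card (words n h)) = int ((2 * n) choose (n + h)) - int ((2 * n) choose (n + h + 2))"
proof (induction n arbitrary: h)
  case 0
  then show ?case by simp
next
  case (Suc n)
  have inj: "inj_on (\<lambda>w. w @ [x]) A" for x :: "bool \<times> bool" and A by (auto simp: inj_on_def)
  define A where "A = (\<lambda>w. w @ [(True, True)]) ` words n h"
  define B where "B = (\<lambda>w. w @ [(False, False)]) ` words n h"
  define C where "C = (\<lambda>w. w @ [(False, True)]) ` words n (Suc h)"
  define D where "D = (if h = 0 then {} else (\<lambda>w. w @ [(True, False)]) ` words n (h - 1))"
  have fin: "finite A" "finite B" "finite C" "finite D" by (auto simp: A_def B_def C_def D_def finite_words)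
  have "card (words (Suc n) h) = card (A \<union> B \<union> C \<union> D)" by (simp add: A_def B_def C_def D_def)
  also have "\<dots> = card (A \<union> B \<union> C) + card D"
    using fin by (intro card_Un_disjoint) (auto simp: A_def B_def C_def D_def)
  also have "card (A \<union> B \<union> C) = card (A \<union> B) + card C"
    using fin by (intro card_Un_disjoint) (auto simp: A_def B_def C_def D_def)
  also have "card (A \<union> B) = card A + card B"
    using fin by (intro card_Un_disjoint) (auto simp: A_def B_def C_def D_def)
  finally have "card (words (Suc n) h) = card A + card B + card C + card D" .
  moreover have "card A = card (words n h)" "card B = card (words n h)" "card C = card (words n (Suc h))"
    "card D = (if h = 0 then 0 else card (words n (h - 1)))"
    by (simp_all add: A_def B_def C_def D_def card_image[OF inj])
  ultimately have rec: "card (words (Suc n) h) = 2 * card (words n h) + card (words n (Suc h)) + (if h = 0 then 0 else card (words n (h - 1)))"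
    by simp
  have pas: "(2 * Suc n) choose (Suc (Suc k)) = (2 * n choose k) + 2 * (2 * n choose Suc k) + (2 * n choose Suc (Suc k))" for k
    by (simp add: numeral_2_eq_2)
  show ?case
  proof (cases h)
    case 0
    have "(2 * n) choose (n - 1) = (2 * n) choose (n + 1)" if "n \<noteq> 0"
      using binomial_symmetric[of "n - 1" "2 * n"] that by simp
    then show ?thesis
      using rec Suc.IH[of 0] Suc.IH[of 1] 0 pas[of "n - 1"] pas[of "n + 1"]
      by (cases n) simp_all
  next
    case (Suc k)
    then show ?thesis
      using rec Suc.IH[of h] Suc.IH[of "Suc h"] Suc.IH[of k] pas[of "n + k"] pas[of "n + k + 2"]
      by simp
  qed
qed

section \<open>Independent vectors and the lower bound on connection ranks\<close>

definition word_S :: "word \<Rightarrow> nat set" where "word_S w = {i. i < length w \<and> fst (w ! i)}"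
definition word_T :: "word \<Rightarrow> nat set" where "word_T w = {i. i < length w \<and> snd (w ! i)}"
definition word_matching :: "word \<Rightarrow> nat \<Rightarrow> nat" where
  "word_matching w = (SOME M. realizes w M {})"

text \<open>
  The weights force \<open>S\<close> to agree with the word at its level letters and to contain exactly one label
  of each matched pair. The states that remain are those obtained from the word by interchanging the
  letters of some matched pairs.
\<close>

definition word_vector :: "word \<Rightarrow> nat set \<times> nat set \<Rightarrow> complex" where
  "word_vector w = weighted_state (length w) (word_matching w) ({..<length w} - unmatched (length w) (word_matching w))
     (\<lambda>i b. if b = fst (w ! i) then 1 else 0)"

definition openers :: "word \<Rightarrow> nat set" where "openers w = {i. i < length w \<and> w ! i = (True, False)}"

text \<open>
  The statistic that orders the words for the triangularity argument.
\<close>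

definition opener_sum :: "word \<Rightarrow> nat" where "opener_sum w = \<Sum>(openers w)"

lemma word_matching:
  assumes "w \<in> words n 0"
  shows "realizes w (word_matching w) {}"
proof -
  obtain M P where MP: "realizes w M P" "card P = 0" using words_realizable[OF assms] by blast
  have "finite P" by (rule finite_subset[of _ "{..<length w}"]) (use realizesD(1)[OF MP(1)] in auto)
  then have "realizes w M {}" using MP by simp
  then show ?thesis unfolding word_matching_def by (rule someI[of "\<lambda>M. realizes w M {}"])
qed

lemma word_matching_partial:
  assumes "w \<in> words n 0"
  shows "partial_matching n (word_matching w)"
    "i < n \<Longrightarrow> i \<in> unmatched n (word_matching w) \<longleftrightarrow> (\<exists>b. w ! i = (b, b))"
    "i < n \<Longrightarrow> w ! i = (True, False) \<Longrightarrow> i < word_matching w i \<and> w ! word_matching w i = (False, True)"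
    "i < n \<Longrightarrow> w ! i = (False, True) \<Longrightarrow> word_matching w i < i \<and> w ! word_matching w i = (True, False)"
proof -
  note r = realizesD[OF word_matching[OF assms]]
  have n: "length w = n" by (rule length_words[OF assms])
  have cases: "w ! i = (True, False) \<or> w ! i = (False, True) \<or> (\<exists>b. w ! i = (b, b))" for i
    by (cases "w ! i") auto
  show "partial_matching n (word_matching w)"
    unfolding partial_matching_def
  proof (intro allI impI)
    fix i assume "i < n"
    then have i: "i < length w" using n by simp
    show "word_matching w i < n \<and> word_matching w (word_matching w i) = i"
      using cases[of i] r(3)[OF i] r(4)[OF i] r(5)[OF i] i n by auto
  qed
  show "i < n \<Longrightarrow> i \<in> unmatched n (word_matching w) \<longleftrightarrow> (\<exists>b. w ! i = (b, b))"
    using cases[of i] r(3)[of i] r(4)[of i] r(5)[of i] n by (auto simp: unmatched_def)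
  show "i < n \<Longrightarrow> w ! i = (True, False) \<Longrightarrow> i < word_matching w i \<and> w ! word_matching w i = (False, True)"
    using r(3)[of i] n by simp
  show "i < n \<Longrightarrow> w ! i = (False, True) \<Longrightarrow> word_matching w i < i \<and> w ! word_matching w i = (True, False)"
    using r(4)[of i] n by simp
qed

lemma state_sign_real: "cnj (state_sign t M s) = state_sign t M s"
  by (cases s) (simp add: state_sign_def)

lemma word_vector_real: "cnj (word_vector w s) = word_vector w s"
  by (cases s) (simp add: word_vector_def weighted_state_def state_sign_real if_distrib[of cnj] cong: if_cong)

lemma word_vector_nonzero_iff:
  assumes w: "w \<in> words n 0"
  shows "word_vector w (S, T) \<noteq> 0 \<longleftrightarrow>
    bij_betw (state_map S T (word_matching w)) {..<n} {..<n} \<and>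
    (\<forall>i\<in>unmatched n (word_matching w). i \<in> S \<longleftrightarrow> fst (w ! i)) \<and>
    (\<forall>i\<in>{..<n} - unmatched n (word_matching w). i \<in> S \<longleftrightarrow> word_matching w i \<notin> S)"
proof -
  have fin: "finite (unmatched n (word_matching w))" by (simp add: unmatched_def)
  have "(\<Prod>i\<in>unmatched n (word_matching w). if (i \<in> S) = fst (w ! i) then 1 else 0 :: complex) \<noteq> 0 \<longleftrightarrow>
      (\<forall>i\<in>unmatched n (word_matching w). i \<in> S \<longleftrightarrow> fst (w ! i))"
    using prod_zero_iff[OF fin, of "\<lambda>i. if (i \<in> S) = fst (w ! i) then 1 else 0 :: complex"] by auto
  then show ?thesis
    unfolding word_vector_def weighted_state_def prod.case state_sign_def length_words[OF w]
    by (auto simp: sign_on_def)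
qed

text \<open>
  Among the matched labels, \<open>M\<close> interchanges \<open>S\<close> with its complement, so \<open>S\<close> contains half of them.
\<close>

lemma card_of_balanced_state:
  assumes M: "partial_matching n M" and S: "S \<subseteq> {..<n}"
    and K: "\<forall>i\<in>{..<n} - unmatched n M. i \<in> S \<longleftrightarrow> M i \<notin> S"
  shows "2 * card S = 2 * card (S \<inter> unmatched n M) + card ({..<n} - unmatched n M)"
proof -
  define U where "U = unmatched n M"
  define K' where "K' = {..<n} - U"
  have MK: "M i \<in> K' \<and> M (M i) = i" if "i \<in> K'" for i
  proof -
    have i: "i < n" "M i \<noteq> i" using that by (auto simp: K'_def U_def unmatched_def)
    then have "M i < n" "M (M i) = i" using M by (auto simp: partial_matching_def)
    then show ?thesis using i by (simp add: K'_def U_def unmatched_def)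
  qed
  have K2: "i \<in> S \<longleftrightarrow> M i \<notin> S" if "i \<in> K'" for i using K that by (simp add: K'_def U_def)
  have fin: "finite S" "finite K'" using S finite_subset by (auto simp: K'_def)
  have "card (S \<inter> K') = card (K' - S)"
  proof (rule bij_betw_same_card[of M], rule bij_betw_byWitness[of _ M])
    show "M ` (S \<inter> K') \<subseteq> K' - S" using K2 MK by blast
    show "M ` (K' - S) \<subseteq> S \<inter> K'" using K2 MK by blast
  qed (use MK in auto)
  moreover have "card K' = card (K' \<inter> S) + card (K' - S)" using fin(2) by (rule card_Int_Diff)
  moreover have "card S = card (S \<inter> U) + card (S - U)" using fin(1) by (rule card_Int_Diff)
  moreover have "S - U = S \<inter> K'" using S by (auto simp: K'_def)
  ultimately show ?thesis by (simp add: U_def[symmetric] K'_def[symmetric] Int_commute)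
qed

text \<open>
  The size of \<open>S\<close> is determined by \<open>w\<close> on the support of its vector; hence the sign \<open>(-1) ^ card S\<close> of the
  connection form is constant there.
\<close>

lemma word_vector_parity:
  assumes w: "w \<in> words n 0" and s: "(S, T) \<in> states n" and nz: "word_vector w (S, T) \<noteq> 0"
  shows "even (card S) \<longleftrightarrow> even (card {i \<in> unmatched n (word_matching w). fst (w ! i)} + card ({..<n} - unmatched n (word_matching w)) div 2)"
proof -
  note nz' = nz[unfolded word_vector_nonzero_iff[OF w]]
  have S: "S \<subseteq> {..<n}" using s by (auto simp: states_def)
  have "S \<inter> unmatched n (word_matching w) = {i \<in> unmatched n (word_matching w). fst (w ! i)}" using nz' by auto
  then have "2 * card S = 2 * card {i \<in> unmatched n (word_matching w). fst (w ! i)} + card ({..<n} - unmatched n (word_matching w))"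
    using card_of_balanced_state[OF word_matching_partial(1)[OF w] S] nz' by simp
  then have "card S = card {i \<in> unmatched n (word_matching w). fst (w ! i)} + card ({..<n} - unmatched n (word_matching w)) div 2"
    by linarith
  then show ?thesis by simp
qed

lemma word_letter:
  assumes w: "w \<in> words n 0" and i: "i < n"
  shows "i \<in> word_S w \<longleftrightarrow> fst (w ! i)" "i \<in> word_T w \<longleftrightarrow> snd (w ! i)"
    "w ! i = (True, False) \<or> w ! i = (False, True) \<or> (\<exists>b. w ! i = (b, b))"
  using i length_words[OF w] by (auto simp: word_S_def word_T_def) (cases "w ! i"; auto)+

lemma word_state:
  assumes w: "w \<in> words n 0"
  shows "(word_S w, word_T w) \<in> states n" "word_vector w (word_S w, word_T w) \<noteq> 0"
proof -
  define M where "M = word_matching w"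
  define U where "U = unmatched n M"
  define S where "S = word_S w"
  define T where "T = word_T w"
  note m = word_matching_partial[OF w, folded M_def, folded U_def]
  have n: "length w = n" by (rule length_words[OF w])
  have ST: "S \<subseteq> {..<n}" "T \<subseteq> {..<n}" by (auto simp: S_def T_def word_S_def word_T_def n)
  note l = word_letter[OF w, folded S_def T_def]
  have Mn: "M i < n \<and> M (M i) = i" if "i < n" for i using m(1) that by (simp add: partial_matching_def)
  have U: "i \<in> S \<longleftrightarrow> fst (w ! i)" "i \<in> T \<longleftrightarrow> fst (w ! i)" "M i = i" if iU: "i \<in> U" for i
  proof -
    have i: "i < n" using iU by (simp add: U_def unmatched_def)
    then obtain b where "w ! i = (b, b)" using m(2) iU by blast
    then show "i \<in> S \<longleftrightarrow> fst (w ! i)" "i \<in> T \<longleftrightarrow> fst (w ! i)" using l[OF i] by auto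
    show "M i = i" using iU by (simp add: U_def unmatched_def)
  qed
  have K: "(i \<in> S \<longleftrightarrow> M i \<notin> S) \<and> (i \<in> T \<longleftrightarrow> M i \<notin> T) \<and> (i \<in> S \<longleftrightarrow> i \<notin> T)" if "i \<in> {..<n} - U" for i
  proof -
    have i: "i < n" "i \<notin> U" using that by auto
    then have nb: "\<not> (\<exists>b. w ! i = (b, b))" using m(2) by blast
    have Mi: "M i < n" using Mn i by simp
    from l(3)[OF i(1)] nb consider "w ! i = (True, False)" | "w ! i = (False, True)" by blast
    then show ?thesis
    proof cases
      case 1
      then show ?thesis using m(3)[OF i(1) 1] l(1,2)[OF i(1)] l(1,2)[OF Mi] by simp
    next
      case 2
      then show ?thesis using m(4)[OF i(1) 2] l(1,2)[OF i(1)] l(1,2)[OF Mi] by simp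
    qed
  qed
  have "S \<inter> U = T \<inter> U" using U by blast
  moreover have "2 * card S = 2 * card (S \<inter> U) + card ({..<n} - U)"
    unfolding U_def by (rule card_of_balanced_state[OF m(1) ST(1)]) (use K in \<open>auto simp: U_def\<close>)
  moreover have "2 * card T = 2 * card (T \<inter> U) + card ({..<n} - U)"
    unfolding U_def by (rule card_of_balanced_state[OF m(1) ST(2)]) (use K in \<open>auto simp: U_def\<close>)
  ultimately have card: "card S = card T" by simp
  show "(word_S w, word_T w) \<in> states n" using ST card by (auto simp: states_def S_def T_def)
  have "bij_betw (label_pairing S T) S T"
    by (rule label_pairing[OF finite_subset[OF ST(1)] finite_subset[OF ST(2)] card]) auto
  then have b1: "bij_betw (state_map S T M) S T"
    by (subst bij_betw_cong[of _ _ "label_pairing S T"]) (auto simp: state_map_def)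
  have MST: "i \<in> S \<longleftrightarrow> M i \<in> T" if "i < n" for i
  proof (cases "i \<in> U")
    case True
    show ?thesis unfolding U(3)[OF True] U(1)[OF True] U(2)[OF True] by (rule refl)
  next
    case False
    then have "i \<in> {..<n} - U" using that by simp
    from K[OF this] show ?thesis by blast
  qed
  have "bij_betw M ({..<n} - S) ({..<n} - T)"
  proof (rule bij_betw_byWitness[of _ M])
    show "M ` ({..<n} - S) \<subseteq> {..<n} - T" using MST Mn by auto
    show "M ` ({..<n} - T) \<subseteq> {..<n} - S" using MST Mn by (metis (no_types, lifting) DiffD1 DiffD2 DiffI image_subsetI lessThan_iff)
  qed (use Mn in auto)
  then have b2: "bij_betw (state_map S T M) ({..<n} - S) ({..<n} - T)"
    by (subst bij_betw_cong[of _ _ M]) (auto simp: state_map_def)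
  have "bij_betw (state_map S T M) (S \<union> ({..<n} - S)) (T \<union> ({..<n} - T))"
    by (rule bij_betw_combine[OF b1 b2]) auto
  moreover have "S \<union> ({..<n} - S) = {..<n}" "T \<union> ({..<n} - T) = {..<n}" using ST by auto
  ultimately have "bij_betw (state_map S T M) {..<n} {..<n}" by simp
  then show "word_vector w (word_S w, word_T w) \<noteq> 0"
    unfolding word_vector_nonzero_iff[OF w] S_def[symmetric] T_def[symmetric] M_def[symmetric] U_def[symmetric]
    using U(1) K by blast
qed

text \<open>
  If the vector of \<open>w\<close> does not vanish at the state of \<open>w'\<close>, the words agree on the level letters of \<open>w\<close>,
  and \<open>w'\<close> has one opening letter in each matched pair of \<open>w\<close>. In \<open>w\<close> the opening letter
  is the smaller member of the pair, so the positions of the opening letters can only grow from \<open>w\<close> to \<open>w'\<close>,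
  and they stay the same only if the words coincide.
\<close>

lemma word_vector_triangular:
  assumes w: "w \<in> words n 0" and w': "w' \<in> words n 0"
    and nz: "word_vector w (word_S w', word_T w') \<noteq> 0"
  shows "opener_sum w \<le> opener_sum w'" "opener_sum w = opener_sum w' \<Longrightarrow> w = w'"
proof -
  define M where "M = word_matching w"
  define U where "U = unmatched n M"
  define S where "S = word_S w'"
  define T where "T = word_T w'"
  note m = word_matching_partial[OF w, folded M_def, folded U_def]
  have n: "length w = n" "length w' = n" using length_words w w' by auto
  have st: "S \<subseteq> {..<n}" "T \<subseteq> {..<n}" "card S = card T"
    using word_state(1)[OF w'] by (auto simp: states_def S_def T_def)
  note l = word_letter[OF w] and l' = word_letter[OF w', folded S_def T_def]
  have Mn: "M i < n" "M (M i) = i" if "i < n" for i using m(1) that by (auto simp: partial_matching_def)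
  note nz' = nz[unfolded word_vector_nonzero_iff[OF w], folded M_def S_def T_def, folded U_def]
  have bij: "bij_betw (state_map S T M) {..<n} {..<n}" and SU: "\<And>i. i \<in> U \<Longrightarrow> i \<in> S \<longleftrightarrow> fst (w ! i)"
    and SK: "\<And>i. i < n \<Longrightarrow> i \<notin> U \<Longrightarrow> i \<in> S \<longleftrightarrow> M i \<notin> S" using nz' by auto
  have lp: "bij_betw (label_pairing S T) S T"
    by (rule label_pairing[OF finite_subset[OF st(1)] finite_subset[OF st(2)] st(3)]) auto
  \<comment> \<open>Since \<open>state_map\<close> is a bijection that already maps \<open>S\<close> onto \<open>T\<close>, the matching maps the complement of \<open>S\<close>
    onto the complement of \<open>T\<close>.\<close>
  have MT: "i \<in> S \<longleftrightarrow> M i \<in> T" if i: "i < n" for i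
  proof
    assume iS: "i \<in> S"
    show "M i \<in> T"
    proof (rule ccontr)
      assume no: "M i \<notin> T"
      have "M i \<in> state_map S T M ` {..<n}" using bij Mn(1)[OF i] by (auto simp: bij_betw_def)
      then obtain k where k: "k < n" "state_map S T M k = M i" by auto
      show False
      proof (cases "k \<in> S")
        case True
        then have "state_map S T M k \<in> T" using lp by (auto simp: state_map_def bij_betw_def)
        then show ?thesis using no k by simp
      next
        case False
        then have "M k = M i" using k by (simp add: state_map_def)
        then have "k = i" using Mn(2)[OF k(1)] Mn(2)[OF i] by metis
        then show ?thesis using False iS by simp
      qed
    qed
  next
    assume iT: "M i \<in> T"
    show "i \<in> S"
    proof (rule ccontr)
      assume no: "i \<notin> S"
      have "M i \<in> label_pairing S T ` S" using lp iT by (auto simp: bij_betw_def)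
      then obtain k where k: "k \<in> S" "label_pairing S T k = M i" by auto
      then have "state_map S T M k = state_map S T M i" using no by (simp add: state_map_def)
      moreover have "k < n" using k st by auto
      ultimately have "k = i" using bij i by (auto simp: bij_betw_def dest: inj_onD)
      then show False using k no by simp
    qed
  qed
  have onU: "w' ! i = w ! i" if i: "i \<in> U" for i
  proof -
    have iu: "i < n" "M i = i" using i by (auto simp: U_def unmatched_def)
    obtain b where b: "w ! i = (b, b)" using m(2)[OF iu(1)] i by blast
    have "fst (w' ! i) = b" using l'(1)[OF iu(1)] SU[OF i] b by simp
    moreover have "snd (w' ! i) = b" using l'(1,2)[OF iu(1)] MT[OF iu(1)] iu calculation by simp
    ultimately show ?thesis using b by (simp add: prod_eq_iff)
  qed
  have MU: "M i \<notin> U" if "i < n" "i \<notin> U" for i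
    using that Mn[OF that(1)] by (auto simp: U_def unmatched_def)
  have onK: "w' ! i = (i \<in> S, i \<notin> S)" if i: "i < n" "i \<notin> U" for i
  proof -
    have "i \<in> T \<longleftrightarrow> M i \<in> S" using MT[OF Mn(1)[OF i(1)]] Mn(2)[OF i(1)] by simp
    then show ?thesis using SK[OF i] l'(1,2)[OF i(1)] by (simp add: prod_eq_iff)
  qed
  define O1 where "O1 = openers w"
  define O2 where "O2 = openers w'"
  have O1: "i \<in> O1 \<longleftrightarrow> i < n \<and> w ! i = (True, False)" for i by (simp add: O1_def openers_def n)
  have O1U: "i \<notin> U" if "i \<in> O1" for i using that m(2)[of i] by (auto simp: O1)
  have O2U: "i \<in> O2 \<longleftrightarrow> i < n \<and> i \<notin> U \<and> i \<in> S" for i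
  proof -
    have o: "i \<in> O2 \<longleftrightarrow> i < n \<and> w' ! i = (True, False)" by (simp add: O2_def openers_def n)
    show ?thesis
    proof (cases "i < n \<and> i \<notin> U")
      case True
      then show ?thesis using o onK[of i] by simp
    next
      case False
      have "w' ! i \<noteq> (True, False)" if "i < n" "i \<in> U"
      proof -
        obtain b where "w ! i = (b, b)" using m(2)[OF \<open>i < n\<close>] \<open>i \<in> U\<close> by blast
        then show ?thesis using onU[OF \<open>i \<in> U\<close>] by auto
      qed
      then show ?thesis using o False by blast
    qed
  qed
  have K_cases: "i \<in> O1 \<or> (w ! i = (False, True) \<and> M i \<in> O1)" if "i < n" "i \<notin> U" for i
  proof -
    have "\<not> (\<exists>b. w ! i = (b, b))" using that m(2) by blast
    then show ?thesis using l(3)[OF that(1)] m(4)[OF that(1)] Mn(1)[OF that(1)] that(1) by (auto simp: O1)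
  qed
  \<comment> \<open>Sends the opening letter of a pair of \<open>w\<close> to the opening letter of \<open>w'\<close> in that pair.\<close>
  define \<phi> where "\<phi> = (\<lambda>i. if i \<in> S then i else M i)"
  have ge: "i \<le> \<phi> i" if "i \<in> O1" for i using m(3)[of i] that by (auto simp: \<phi>_def O1)
  have \<phi>: "bij_betw \<phi> O1 O2"
  proof (rule bij_betw_imageI)
    show "inj_on \<phi> O1"
    proof (rule inj_onI)
      fix i k assume ik: "i \<in> O1" "k \<in> O1" "\<phi> i = \<phi> k"
      have nm: "M x \<notin> O1" if "x \<in> O1" for x using m(3)[of x] that by (auto simp: O1)
      have "M i = M k \<Longrightarrow> i = k" using Mn(2)[of i] Mn(2)[of k] ik by (metis O1)
      then show "i = k" using ik nm[OF ik(1)] nm[OF ik(2)] by (auto simp: \<phi>_def split: if_splits)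
    qed
    show "\<phi> ` O1 = O2"
    proof (intro subset_antisym subsetI)
      fix j assume "j \<in> \<phi> ` O1"
      then obtain i where i: "i \<in> O1" "j = \<phi> i" by auto
      have it: "i < n" "i \<notin> U" using i O1U by (auto simp: O1)
      show "j \<in> O2" using i(2) SK[OF it] it Mn(1)[OF it(1)] MU[OF it] by (auto simp: \<phi>_def O2U)
    next
      fix j assume "j \<in> O2"
      then have j: "j < n" "j \<notin> U" "j \<in> S" by (auto simp: O2U)
      show "j \<in> \<phi> ` O1"
      proof (cases "j \<in> O1")
        case True
        then show ?thesis using j by (intro image_eqI[of _ _ j]) (auto simp: \<phi>_def)
      next
        case False
        then have "M j \<in> O1" using K_cases[OF j(1,2)] by blast
        moreover have "\<phi> (M j) = j" using SK[OF j(1,2)] j Mn(2)[OF j(1)] by (simp add: \<phi>_def)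
        ultimately show ?thesis by (metis imageI)
      qed
    qed
  qed
  have finO: "finite O1" by (rule finite_subset[of _ "{..<n}"]) (auto simp: O1)
  have ex': "opener_sum w' = (\<Sum>i\<in>O1. \<phi> i)"
    using sum.reindex_bij_betw[OF \<phi>, of "\<lambda>x. x"] by (simp add: opener_sum_def O2_def)
  have ex: "opener_sum w = (\<Sum>i\<in>O1. i)" by (simp add: opener_sum_def O1_def)
  show "opener_sum w \<le> opener_sum w'" unfolding ex ex' by (rule sum_mono) (rule ge)
  show "w = w'" if eq: "opener_sum w = opener_sum w'"
  proof (rule nth_equalityI)
    have fixed: "\<phi> i = i" if "i \<in> O1" for i
    proof (rule ccontr)
      assume "\<phi> i \<noteq> i"
      then have "i < \<phi> i" using ge[OF that] by simp
      then have "(\<Sum>i\<in>O1. i) < (\<Sum>i\<in>O1. \<phi> i)" using ge that finO by (intro sum_strict_mono_ex1) auto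
      then show False using eq ex ex' by simp
    qed
    have O1S: "i \<in> S" if "i \<in> O1" for i
    proof (rule ccontr)
      assume "i \<notin> S"
      then have "M i = i" using fixed[OF that] by (simp add: \<phi>_def)
      then show False using O1U[OF that] that by (auto simp: U_def unmatched_def O1)
    qed
    fix i assume "i < length w"
    then have i: "i < n" using n by simp
    show "w ! i = w' ! i"
    proof (cases "i \<in> U")
      case True
      then show ?thesis using onU by simp
    next
      case False
      from K_cases[OF i False] show ?thesis
      proof
        assume "i \<in> O1"
        then show ?thesis using O1S[of i] onK[OF i False] by (simp add: O1)
      next
        assume a: "w ! i = (False, True) \<and> M i \<in> O1"
        then have "i \<notin> S" using O1S[of "M i"] SK[OF i False] by blast
        then show ?thesis using a onK[OF i False] by simp
      qed
    qed
  qed (simp add: n)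
qed

text \<open>
  Among the words with nonzero coefficient, one of least \<open>opener_sum\<close> is the only one whose vector is
  nonzero at its own state.
\<close>

lemma word_vectors_independent:
  assumes z: "\<And>s. s \<in> states n \<Longrightarrow> (\<Sum>w\<in>words n 0. y w * word_vector w s) = 0"
    and w: "w \<in> words n 0"
  shows "y w = 0"
proof (rule ccontr)
  assume "y w \<noteq> 0"
  then have "w \<in> words n 0 \<and> y w \<noteq> 0" using w by simp
  from ex_has_least_nat[of "\<lambda>w. w \<in> words n 0 \<and> y w \<noteq> 0", OF this, of opener_sum]
  obtain v where v: "v \<in> words n 0" "y v \<noteq> 0" and least: "\<And>x. x \<in> words n 0 \<Longrightarrow> y x \<noteq> 0 \<Longrightarrow> opener_sum v \<le> opener_sum x"
    by (elim exE conjE) simp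
  define s where "s = (word_S v, word_T v)"
  have "(\<Sum>w\<in>words n 0. y w * word_vector w s) = (\<Sum>w\<in>{v}. y w * word_vector w s)"
  proof (rule sum.mono_neutral_right[OF finite_words])
    show "{v} \<subseteq> words n 0" using v by simp
    show "\<forall>w\<in>words n 0 - {v}. y w * word_vector w s = 0"
    proof (intro ballI, rule ccontr)
      fix x assume x: "x \<in> words n 0 - {v}" "y x * word_vector x s \<noteq> 0"
      then have "y x \<noteq> 0" "word_vector x (word_S v, word_T v) \<noteq> 0" "x \<in> words n 0" by (auto simp: s_def)
      then have "opener_sum x \<le> opener_sum v" "opener_sum x = opener_sum v \<Longrightarrow> x = v"
        using word_vector_triangular[of x n v] v(1) by simp_all
      moreover have "opener_sum v \<le> opener_sum x" using least \<open>x \<in> words n 0\<close> \<open>y x \<noteq> 0\<close> by simp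
      ultimately show False using x(1) by simp
    qed
  qed
  also have "\<dots> \<noteq> 0" using v word_state(2)[OF v(1)] by (simp add: s_def)
  finally show False using z word_state(1)[OF v(1)] by (simp add: s_def)
qed

lemma spanned_word_vector:
  assumes w: "w \<in> words n 0"
  shows "spanned \<theta> n (word_vector w)"
  unfolding word_vector_def length_words[OF w]
proof (rule spanned_weighted[OF word_matching_partial(1)[OF w] subset_refl])
  show "word_matching w ` ({..<n} - unmatched n (word_matching w)) \<subseteq> {..<n} - unmatched n (word_matching w)"
  proof (rule image_subsetI)
    fix i assume "i \<in> {..<n} - unmatched n (word_matching w)"
    then have i: "i < n" "word_matching w i \<noteq> i" by (simp_all add: unmatched_def)
    then have "word_matching w i < n" "word_matching w (word_matching w i) = i"
      using word_matching_partial(1)[OF w] by (simp_all add: partial_matching_def)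
    then show "word_matching w i \<in> {..<n} - unmatched n (word_matching w)" using i by (simp add: unmatched_def)
  qed
qed

text \<open>
  In the basis of states the connection form is diagonal with entries \<open>\<plusminus>1\<close>, and each vector of a word
  is real and supported where the sign is constant. If \<open>z = \<Sum> y w \<cdot> word_vector w\<close> is orthogonal
  to all word vectors with respect to the form, then also with respect to the unsigned sum over states. The
  complex conjugate of \<open>z\<close> is again a combination of word vectors, so \<open>\<Sum> |z|\<^sup>2 = 0\<close>, and independence
  of the word vectors gives \<open>y = 0\<close>. So the Gram matrix of the word vectors is nonsingular and the rank is at least the
  number of words.
\<close>

lemma connection_rank_ge:
  "enat (card (words n 0)) \<le> connection_rank (partition_function 2 1 (h_theta \<theta>)) n"
proof -
  define W where "W = words n 0"
  define f where "f = partition_function 2 1 (h_theta \<theta>)"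
  have finW: "finite W" by (simp add: W_def finite_words)
  have "\<forall>w\<in>W. \<exists>A c. finite A \<and> A \<subseteq> fragments n \<and> (\<forall>s\<in>states n. word_vector w s = (\<Sum>F\<in>A. c F * state_value \<theta> F s))"
    using spanned_word_vector unfolding spanned_def W_def by blast
  from bchoice[OF this] obtain A where "\<forall>w\<in>W. \<exists>c. finite (A w) \<and> A w \<subseteq> fragments n \<and>
      (\<forall>s\<in>states n. word_vector w s = (\<Sum>F\<in>A w. c F * state_value \<theta> F s))" by (elim exE)
  from bchoice[OF this] obtain c where c: "\<forall>w\<in>W. finite (A w) \<and> A w \<subseteq> fragments n \<and>
      (\<forall>s\<in>states n. word_vector w s = (\<Sum>F\<in>A w. c w F * state_value \<theta> F s))" by (elim exE)
  define B where "B = (\<Union>w\<in>W. A w)"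
  have finB: "finite B" using c finW by (auto simp: B_def)
  obtain Fs where Fs: "set Fs = B" "distinct Fs" using finite_distinct_list[OF finB] by blast
  define N where "N = length Fs"
  define d where "d = (\<lambda>w j. if Fs ! j \<in> A w then c w (Fs ! j) else 0)"
  have FsB: "Fs ! j \<in> fragments n" if "j < N" for j
  proof -
    have "Fs ! j \<in> B" using that Fs by (metis N_def nth_mem)
    then show ?thesis using c by (auto simp: B_def)
  qed
  have expand: "word_vector w s = (\<Sum>j<N. d w j * state_value \<theta> (Fs ! j) s)" if "w \<in> W" "s \<in> states n" for w s
  proof -
    have "word_vector w s = (\<Sum>F\<in>A w. c w F * state_value \<theta> F s)" using c that by blast
    also have "\<dots> = (\<Sum>F\<in>B. (if F \<in> A w then c w F else 0) * state_value \<theta> F s)"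
      using that(1) finB by (intro sum.mono_neutral_cong_left) (auto simp: B_def)
    also have "\<dots> = (\<Sum>j<N. (if Fs ! j \<in> A w then c w (Fs ! j) else 0) * state_value \<theta> (Fs ! j) s)"
    proof -
      have "bij_betw ((!) Fs) {..<N} B" using bij_betw_nth[OF Fs(2)] Fs(1) by (simp add: N_def)
      from sum.reindex_bij_betw[OF this, of "\<lambda>F. (if F \<in> A w then c w F else 0) * state_value \<theta> F s"]
      show ?thesis by simp
    qed
    finally show ?thesis by (simp add: d_def)
  qed
  define e where "e = (\<lambda>i j. f (glue (Fs ! i) (Fs ! j)))"
  have e: "e i j = (-1) ^ n * (\<Sum>s\<in>states n. (-1) ^ card (fst s) * state_value \<theta> (Fs ! i) s * state_value \<theta> (Fs ! j) s)"
    if "i < N" "j < N" for i j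
    unfolding e_def f_def by (rule partition_function_glue[OF FsB[OF that(1)] FsB[OF that(2)]])
  have gram: "(\<Sum>i<N. \<Sum>j<N. d w i * e i j * d w' j) =
      (-1) ^ n * (\<Sum>s\<in>states n. (-1) ^ card (fst s) * word_vector w s * word_vector w' s)"
    if w: "w \<in> W" "w' \<in> W" for w w'
  proof -
    have "(\<Sum>i<N. \<Sum>j<N. d w i * e i j * d w' j) = (\<Sum>i<N. \<Sum>j<N. \<Sum>s\<in>states n.
        (-1) ^ n * (-1) ^ card (fst s) * (d w i * state_value \<theta> (Fs ! i) s) * (d w' j * state_value \<theta> (Fs ! j) s))"
      using e by (intro sum.cong refl) (simp add: sum_distrib_left sum_distrib_right mult_ac)
    also have "\<dots> = (\<Sum>i<N. \<Sum>s\<in>states n. \<Sum>j<N.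
        (-1) ^ n * (-1) ^ card (fst s) * (d w i * state_value \<theta> (Fs ! i) s) * (d w' j * state_value \<theta> (Fs ! j) s))"
      by (intro sum.cong refl sum.swap)
    also have "\<dots> = (\<Sum>s\<in>states n. \<Sum>i<N. \<Sum>j<N.
        (-1) ^ n * (-1) ^ card (fst s) * (d w i * state_value \<theta> (Fs ! i) s) * (d w' j * state_value \<theta> (Fs ! j) s))"
      by (rule sum.swap)
    also have "\<dots> = (\<Sum>s\<in>states n. (-1) ^ n * (-1) ^ card (fst s) * word_vector w s * word_vector w' s)"
    proof (rule sum.cong[OF refl])
      fix s assume s: "s \<in> states n"
      have "(-1) ^ n * (-1) ^ card (fst s) * word_vector w s * word_vector w' s =
        ((-1) ^ n * (-1) ^ card (fst s) * (\<Sum>i<N. d w i * state_value \<theta> (Fs ! i) s)) * (\<Sum>j<N. d w' j * state_value \<theta> (Fs ! j) s)"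
        unfolding expand[OF w(1) s] expand[OF w(2) s] by (rule refl)
      also have "\<dots> = (\<Sum>i<N. \<Sum>j<N. (-1) ^ n * (-1) ^ card (fst s) * (d w i * state_value \<theta> (Fs ! i) s) * (d w' j * state_value \<theta> (Fs ! j) s))"
        unfolding sum_distrib_left[of "(-1) ^ n * (-1) ^ card (fst s)"] sum_product by (rule refl)
      finally show "(\<Sum>i<N. \<Sum>j<N. (-1) ^ n * (-1) ^ card (fst s) * (d w i * state_value \<theta> (Fs ! i) s) * (d w' j * state_value \<theta> (Fs ! j) s)) =
        (-1) ^ n * (-1) ^ card (fst s) * word_vector w s * word_vector w' s" by simp
    qed
    finally show ?thesis by (simp add: sum_distrib_left mult.assoc)
  qed
  \<comment> \<open>The value of \<open>card S\<close> on the support of \<open>word_vector w\<close>.\<close>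
  define par where "par = (\<lambda>w. card {i \<in> unmatched n (word_matching w). fst (w ! i)} + card ({..<n} - unmatched n (word_matching w)) div 2)"
  have sgn: "(-1) ^ card (fst s) * word_vector w s = (-1) ^ par w * word_vector w s" if "w \<in> W" "s \<in> states n" for w s
  proof (cases "word_vector w s = 0")
    case False
    obtain S T where s: "s = (S, T)" by (cases s)
    have "even (card S) \<longleftrightarrow> even (par w)" unfolding par_def
      by (rule word_vector_parity[of w n S T]) (use that False in \<open>auto simp: W_def s\<close>)
    then have "(-1::complex) ^ card S = (-1) ^ par w" by (simp add: minus_one_power_iff)
    then show ?thesis by (simp add: s)
  qed simp
  have "card W \<le> vec_space.rank N (mat N N (\<lambda>(i, j). e i j))"
  proof (rule vec_space.card_le_rank_of_nonsingular_gram[OF finW, where c = d and e = e and d = d and nc = N and n = N])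
    fix y w assume y: "\<And>w'. w' \<in> W \<Longrightarrow> (\<Sum>w\<in>W. y w * (\<Sum>i<N. \<Sum>j<N. d w i * e i j * d w' j)) = 0" and w: "w \<in> W"
    define z where "z = (\<lambda>s. \<Sum>w\<in>W. y w * word_vector w s)"
    have orth: "(\<Sum>s\<in>states n. z s * word_vector w' s) = 0" if w': "w' \<in> W" for w'
    proof -
      have "0 = (\<Sum>w\<in>W. y w * ((-1) ^ n * (\<Sum>s\<in>states n. (-1) ^ card (fst s) * word_vector w s * word_vector w' s)))"
        using y[OF w'] gram[OF _ w'] by simp
      also have "\<dots> = (\<Sum>w\<in>W. \<Sum>s\<in>states n. (-1) ^ n * (y w * word_vector w s * ((-1) ^ card (fst s) * word_vector w' s)))"
        by (simp add: sum_distrib_left mult_ac)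
      also have "\<dots> = (\<Sum>w\<in>W. \<Sum>s\<in>states n. (-1) ^ n * (-1) ^ par w' * (y w * word_vector w s * word_vector w' s))"
        using sgn[OF w'] by (intro sum.cong refl) (simp add: mult_ac)
      also have "\<dots> = (\<Sum>s\<in>states n. (-1) ^ n * (-1) ^ par w' * (z s * word_vector w' s))"
        by (subst sum.swap) (simp add: z_def sum_distrib_left sum_distrib_right mult_ac)
      also have "\<dots> = (-1) ^ n * (-1) ^ par w' * (\<Sum>s\<in>states n. z s * word_vector w' s)"
        by (simp add: sum_distrib_left)
      finally show ?thesis by simp
    qed
    have "(\<Sum>s\<in>states n. z s * cnj (z s)) = (\<Sum>s\<in>states n. \<Sum>w'\<in>W. cnj (y w') * (z s * word_vector w' s))"
      by (simp add: z_def word_vector_real sum_distrib_left mult_ac)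
    also have "\<dots> = (\<Sum>w'\<in>W. cnj (y w') * (\<Sum>s\<in>states n. z s * word_vector w' s))"
      by (subst sum.swap) (simp add: sum_distrib_left)
    also have "\<dots> = 0" using orth by simp
    finally have "(\<Sum>s\<in>states n. z s * cnj (z s)) = 0" .
    then have "of_real (\<Sum>s\<in>states n. (cmod (z s))\<^sup>2) = (0::complex)"
      by (simp only: of_real_sum complex_norm_square)
    then have "(\<Sum>s\<in>states n. (cmod (z s))\<^sup>2) = 0" by (simp only: of_real_eq_0_iff)
    then have "z s = 0" if "s \<in> states n" for s
      using that card_states_le(1)[of n] by (simp add: sum_nonneg_eq_0_iff)
    then show "y w = 0" using word_vectors_independent[of n y w] w by (simp add: z_def W_def)
  qed
  also have "mat N N (\<lambda>(i, j). e i j) = connection_submatrix f Fs Fs"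
    by (simp add: connection_submatrix_def N_def e_def)
  finally have "enat (card W) \<le> enat (vec_space.rank (length Fs) (connection_submatrix f Fs Fs))"
    by (simp add: N_def)
  also have "\<dots> \<le> connection_rank f n"
    unfolding connection_rank_def
  proof (rule SUP_upper2[of "(Fs, Fs)"])
    show "(Fs, Fs) \<in> lists (fragments n) \<times> lists (fragments n)"
    proof -
      have "B \<subseteq> fragments n" using c unfolding B_def by blast
      then have "Fs \<in> lists (fragments n)" using Fs(1) by (simp add: lists_eq_set)
      then show ?thesis by simp
    qed
  qed simp
  finally show ?thesis by (simp add: W_def f_def)
qed

section \<open>Growth of the connection ranks\<close>

text \<open>
  From \<open>C(2n,n+1) = n/(n+1) C(2n,n)\<close> and \<open>C(2n,n+2) = (n-1)/(n+2) C(2n,n+1)\<close> the number of words is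
  \<open>(4n+2)/((n+1)(n+2)) C(2n,n)\<close>, and \<open>C(2n,n) \<ge> 4\<^sup>n/(2n)\<close>.
\<close>

lemma card_words_lower:
  assumes "n \<ge> 1"
  shows "4 ^ n / (2 * real n * (real n + 1) * (real n + 2)) \<le> real (card (words n 0))"
proof -
  define b where "b = real ((2 * n) choose n)"
  define c where "c = real ((2 * n) choose (n + 1))"
  define d where "d = real ((2 * n) choose (n + 2))"
  have s: "Suc k * (2 * n choose Suc k) = (2 * n - k) * (2 * n choose k)" for k
    by (rule trans[OF binomial_absorption binomial_absorb_comp[symmetric]])
  have cb: "(real n + 1) * c = real n * b"
    using arg_cong[OF s[of n], of real] assms by (simp add: b_def c_def algebra_simps)
  have "(real n + 2) * d = (real n - 1) * c"
    using arg_cong[OF s[of "n + 1"], of real] assms by (simp add: c_def d_def algebra_simps of_nat_diff)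
  then have "(real n + 1) * ((real n + 2) * d) = (real n - 1) * (real n * b)"
    using cb by (metis mult.left_commute)
  then have db: "(real n + 1) * (real n + 2) * (b - d) = (4 * real n + 2) * b"
    by (simp add: algebra_simps)
  have b0: "b \<ge> 0" by (simp add: b_def)
  have "4 ^ n / (2 * real n) \<le> b"
    unfolding b_def using central_binomial_lower_bound[of n] assms by simp
  also have "b \<le> (4 * real n + 2) * b" using b0 mult_right_mono[of 1 "4 * real n + 2" b] by simp
  finally have "4 ^ n / (2 * real n) \<le> (real n + 1) * (real n + 2) * (b - d)" using db by simp
  moreover have "real (card (words n 0)) = b - d"
  proof -
    have "of_int (int (card (words n 0))) = (of_int (int ((2 * n) choose (n + 0)) - int ((2 * n) choose (n + 0 + 2))) :: real)"
      by (subst card_words) (rule refl)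
    then show ?thesis by (simp add: b_def d_def)
  qed
  ultimately show ?thesis
    using assms by (simp add: divide_le_eq mult_ac) (simp add: field_simps)
qed

text \<open>
  The \<open>t\<close>-th root of the bound in \<open>card_words_lower\<close>.
\<close>

definition growth_lower :: "nat \<Rightarrow> real" where
  "growth_lower t = 4 / (2 * real t * (real t + 1) * (real t + 2)) powr (1 / real t)"

lemma connection_rank_root_bounds:
  assumes "t \<ge> 1"
  shows "ereal (growth_lower t) \<le> connection_rank_root (partition_function 2 1 (h_theta \<theta>)) t"
    "connection_rank_root (partition_function 2 1 (h_theta \<theta>)) t \<le> 4"
proof -
  define f where "f = partition_function 2 1 (h_theta \<theta>)"
  obtain m where m: "connection_rank f t = enat m"
    using connection_rank_le[of \<theta> t] by (cases "connection_rank f t") (auto simp: f_def)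
  have up: "m \<le> 4 ^ t" using connection_rank_le[of \<theta> t] m by (simp add: f_def)
  have lo: "card (words t 0) \<le> m" using connection_rank_ge[of t \<theta>] m by (simp add: f_def)
  have r: "connection_rank_root f t = ereal (root t (real m))" by (simp add: connection_rank_root_def m)
  have "real m \<le> 4 ^ t" using up by (metis of_nat_le_iff of_nat_numeral of_nat_power)
  then have "root t (real m) \<le> root t (4 ^ t)" using assms by simp
  also have "\<dots> = 4" using assms by (simp add: real_root_power_cancel)
  finally have "ereal (root t (real m)) \<le> ereal 4" by (simp only: ereal_less_eq)
  then show "connection_rank_root (partition_function 2 1 (h_theta \<theta>)) t \<le> 4"
    unfolding r[unfolded f_def] numeral_eq_ereal .
  define P where "P = 2 * real t * (real t + 1) * (real t + 2)"
  have P: "P > 0" using assms by (simp add: P_def)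
  have "root t P = P powr (1 / real t)" using assms P by (simp add: root_powr_inverse)
  moreover have "root t (4 ^ t) = 4" using assms by (simp add: real_root_power_cancel)
  ultimately have "growth_lower t = root t (4 ^ t) / root t P"
    by (simp add: growth_lower_def P_def)
  also have "\<dots> = root t (4 ^ t / P)" by (simp add: real_root_divide)
  also have "\<dots> \<le> root t (real m)"
    using card_words_lower[OF assms] lo assms by (simp add: P_def)
  finally show "ereal (growth_lower t) \<le> connection_rank_root (partition_function 2 1 (h_theta \<theta>)) t"
    using r by (simp add: f_def)
qed

lemma growth_lower_limit: "(\<lambda>n. growth_lower (2 * n)) \<longlonglongrightarrow> 4"
  unfolding growth_lower_def by real_asymp

section \<open>Dimensions of models\<close>

lemma partition_function_circle:
  "partition_function k l h \<lparr>verts = {}, halves = {}, inc = id, edges = {}, circles = 1\<rparr> = of_nat k - of_nat (2 * l)"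
proof -
  define G where "G = \<lparr>verts = {}, halves = {}, inc = id, edges = {}, circles = 1\<rparr>"
  have G: "is_graph G" by (simp add: G_def is_graph_def partition_on_def)
  have e: "eulerian G F \<longleftrightarrow> F = {}" for F by (auto simp: eulerian_def G_def)
  obtain I \<kappa> where IK: "chosen_pairing G {} = (I, \<kappa>)" by fastforce
  have "I = {}" using chosen_pairing(1)[OF G _ IK] e by (simp add: balanced_orientation_def)
  then show ?thesis unfolding G_def[symmetric] partition_function_def e
    by (simp add: IK num_circuits_def) (simp add: G_def)
qed

text \<open>
  Without colours there is no colouring of an edge, even or odd.
\<close>

lemma partition_function_no_colours:
  assumes "edges G \<noteq> {}" "is_graph G"
  shows "partition_function 0 0 h G = 0"
proof -
  have "(let (I, \<kappa>) = chosen_pairing G F in (-1) ^ num_circuits G I \<kappa> *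
       (\<Sum>\<psi> \<in> (edges G - F) \<rightarrow>\<^sub>E {1..0::nat}. \<Sum>\<phi> \<in> F \<rightarrow>\<^sub>E {1..2 * 0::nat}.
          \<Prod>v\<in>verts G. vertex_weight 0 h G F I \<kappa> \<psi> \<phi> v)) = 0" if "eulerian G F" for F
  proof (cases "edges G - F = {}")
    case True
    then have "F \<noteq> {}" using assms by auto
    then have "F \<rightarrow>\<^sub>E {1..2 * 0::nat} = {}" by (auto simp: PiE_eq_empty_iff)
    then show ?thesis by (simp add: case_prod_unfold Let_def)
  next
    case False
    then have "(edges G - F) \<rightarrow>\<^sub>E {1..0::nat} = {}" by (auto simp: PiE_eq_empty_iff)
    then show ?thesis by (simp add: case_prod_unfold Let_def)
  qed
  then show ?thesis unfolding partition_function_def by simp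
qed

definition loop_graph :: mgraph where
  "loop_graph = \<lparr>verts = {0}, halves = {0, 1}, inc = (\<lambda>_. 0), edges = {{0, 1}}, circles = 0\<rparr>"

definition edge_graph :: mgraph where
  "edge_graph = \<lparr>verts = {0, 1}, halves = {0, 1}, inc = id, edges = {{0, 1}}, circles = 0\<rparr>"

lemma loop_graph: "is_graph loop_graph" "char_det \<theta> loop_graph = \<theta> - 2"
proof -
  define \<mu> where "\<mu> = (\<lambda>a. 1 - a :: nat)"
  have *: "is_graph loop_graph" "\<And>a. a \<in> halves loop_graph \<Longrightarrow> mate loop_graph a = \<mu> a"
  proof -
    have v: "finite (verts G0)" "finite (halves G0)" "\<And>a. a \<in> halves G0 \<Longrightarrow> inc G0 a \<in> verts G0"
      if "G0 = loop_graph" for G0 using that by (auto simp: loop_graph_def)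
    have inv: "\<mu> a \<in> halves loop_graph \<and> \<mu> a \<noteq> a \<and> \<mu> (\<mu> a) = a" if "a \<in> halves loop_graph" for a
      using that by (auto simp: loop_graph_def \<mu>_def)
    have E: "edges loop_graph = (\<lambda>a. {a, \<mu> a}) ` halves loop_graph" by (auto simp: loop_graph_def \<mu>_def)
    show "is_graph loop_graph" "\<And>a. a \<in> halves loop_graph \<Longrightarrow> mate loop_graph a = \<mu> a"
      using graph_of_involution[OF v[OF refl] inv E] by simp_all
  qed
  show "is_graph loop_graph" by (rule *)
  have "{a \<in> halves loop_graph. inc loop_graph a = 0 \<and> inc loop_graph (mate loop_graph a) = 0} = {0, 1}"
    by (auto simp: loop_graph_def)
  then have "adj loop_graph 0 0 = 2" by (simp add: adj_def)
  moreover have "verts loop_graph = {0}" by (simp add: loop_graph_def)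
  ultimately show "char_det \<theta> loop_graph = \<theta> - 2" by (simp add: char_det_def det_on_def)
qed

lemma edge_graph: "is_graph edge_graph" "char_det \<theta> edge_graph = \<theta>\<^sup>2 - 1"
proof -
  define \<mu> where "\<mu> = (\<lambda>a. 1 - a :: nat)"
  have *: "is_graph edge_graph" "\<And>a. a \<in> halves edge_graph \<Longrightarrow> mate edge_graph a = \<mu> a"
  proof -
    have v: "finite (verts G0)" "finite (halves G0)" "\<And>a. a \<in> halves G0 \<Longrightarrow> inc G0 a \<in> verts G0"
      if "G0 = edge_graph" for G0 using that by (auto simp: edge_graph_def)
    have inv: "\<mu> a \<in> halves edge_graph \<and> \<mu> a \<noteq> a \<and> \<mu> (\<mu> a) = a" if "a \<in> halves edge_graph" for a
      using that by (auto simp: edge_graph_def \<mu>_def)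
    have E: "edges edge_graph = (\<lambda>a. {a, \<mu> a}) ` halves edge_graph" by (auto simp: edge_graph_def \<mu>_def)
    show "is_graph edge_graph" "\<And>a. a \<in> halves edge_graph \<Longrightarrow> mate edge_graph a = \<mu> a"
      using graph_of_involution[OF v[OF refl] inv E] by simp_all
  qed
  show "is_graph edge_graph" by (rule *)
  have i: "inc edge_graph = id" "verts edge_graph = {0, 1}" "halves edge_graph = {0, 1}" by (simp_all add: edge_graph_def)
  have m: "mate edge_graph 0 = 1" "mate edge_graph 1 = 0" using *(2) i by (auto simp: \<mu>_def)
  have "{a \<in> halves edge_graph. inc edge_graph a = 0 \<and> inc edge_graph (mate edge_graph a) = 0} = {}"
    "{a \<in> halves edge_graph. inc edge_graph a = 1 \<and> inc edge_graph (mate edge_graph a) = 1} = {}"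
    "{a \<in> halves edge_graph. inc edge_graph a = 0 \<and> inc edge_graph (mate edge_graph a) = 1} = {0}"
    "{a \<in> halves edge_graph. inc edge_graph a = 1 \<and> inc edge_graph (mate edge_graph a) = 0} = {1}"
    using m by (auto simp: i)
  then have a: "adj edge_graph 0 0 = 0" "adj edge_graph 1 1 = 0" "adj edge_graph 0 1 = 1" "adj edge_graph 1 0 = 1"
    by (simp_all only: adj_def card.empty card_1_singleton_iff) auto
  have p: "{p. p permutes {0, 1::nat}} = {id, transpose 0 1}" by (auto simp: permutes_doubleton_iff)
  have "id \<noteq> transpose 0 (1::nat)" by (metis id_apply transpose_apply_first zero_neq_one)
  then show "char_det \<theta> edge_graph = \<theta>\<^sup>2 - 1"
    unfolding char_det_def det_on_def i p using a
    by (simp add: sign_swap_id power2_eq_square)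
qed

text \<open>
  The free circle has value 0, which forces \<open>k = 2l\<close>. In the absence of all colours every graph with an
  edge would have value 0, but \<open>\<theta> - 2\<close> for a single loop and \<open>\<theta>\<^sup>2 - 1\<close> for a single edge have no common root.
\<close>

lemma model_dimensions:
  assumes "is_model (partition_function 2 1 (h_theta \<theta>)) k l h"
  shows "k = 2 * l" "l \<ge> 1"
proof -
  define f where "f = partition_function 2 1 (h_theta \<theta>)"
  have f: "f G = 0 ^ circles G * char_det \<theta> G" if "is_graph G" for G
    using partition_function_char_det[OF that, of 1 2 \<theta>] unfolding char_functional_1 f_def by simp
  have model: "f G = partition_function k l h G" if "is_graph G" for G
    using assms that by (simp add: is_model_def f_def)
  define C where "C = \<lparr>verts = {} :: nat set, halves = {} :: nat set, inc = id, edges = {} :: nat set set, circles = 1\<rparr>"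
  have C: "is_graph C" by (simp add: C_def is_graph_def partition_on_def)
  have "f C = 0" using f[OF C] by (simp add: C_def)
  then have "(of_nat k :: complex) = of_nat (2 * l)"
    using model[OF C] partition_function_circle[of k l h] by (simp add: C_def)
  then show kl: "k = 2 * l" by (simp only: of_nat_eq_iff)
  show "l \<ge> 1"
  proof (rule ccontr)
    assume "\<not> l \<ge> 1"
    then have "k = 0" "l = 0" using kl by auto
    then have z: "char_det \<theta> G = 0" if "is_graph G" "edges G \<noteq> {}" "circles G = 0" for G
      using f[OF that(1)] model[OF that(1)] partition_function_no_colours[OF that(2,1)] that(3) by simp
    have "\<theta> - 2 = 0" using z[OF loop_graph(1)] loop_graph(2) by (simp add: loop_graph_def)
    moreover have "\<theta>\<^sup>2 - 1 = 0" using z[OF edge_graph(1)] edge_graph(2) by (simp add: edge_graph_def)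
    ultimately show False by simp
  qed
qed

theorem corollary7p4:
  fixes \<theta> :: complex and f :: "mgraph \<Rightarrow> complex"
  assumes "f = partition_function 2 1 (h_theta \<theta>)"
  shows "dimension_pairs f = {(2 + 2 * r, 2 + 2 * r) | r. True} \<and>
         is_minimal_model f 2 1 (h_theta \<theta>) \<and>
         growth_base f = 4 \<and>
         (\<lambda>n. connection_rank_root f (2 * n)) \<longlonglongrightarrow> 4"
proof (intro conjI)
  have f: "f G = 0 ^ circles G * char_det \<theta> G" if "is_graph G" for G
    using partition_function_char_det[OF that, of 1 2 \<theta>] unfolding char_functional_1 assms by simp
  note dims = model_dimensions[of \<theta>, folded assms]
  show "dimension_pairs f = {(2 + 2 * r, 2 + 2 * r) | r. True}"
  proof (intro subset_antisym subsetI)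
    fix x assume "x \<in> dimension_pairs f"
    then obtain k l h where x: "x = (k, 2 * l)" and m: "is_model f k l h" by (auto simp: dimension_pairs_def)
    have "k = 2 * l" "l \<ge> 1" by (rule dims[OF m])+
    then have "x = (2 + 2 * (l - 1), 2 + 2 * (l - 1))" using x by simp
    then show "x \<in> {(2 + 2 * r, 2 + 2 * r) | r. True}" by blast
  next
    fix x assume "x \<in> {(2 + 2 * r, 2 + 2 * r) | r::nat. True}"
    then obtain r where x: "x = (2 + 2 * r, 2 + 2 * r)" by blast
    have "is_model f (2 + 2 * r) (1 + r) (char_functional (1 + r) \<theta>)"
      unfolding is_model_def
    proof (intro allI impI)
      fix G assume G: "is_graph G"
      show "f G = partition_function (2 + 2 * r) (1 + r) (char_functional (1 + r) \<theta>) G"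
        using partition_function_char_det[OF G, of "1 + r" "2 + 2 * r" \<theta>] f[OF G] by simp
    qed
    moreover have "x = (2 + 2 * r, 2 * (1 + r))" using x by simp
    ultimately show "x \<in> dimension_pairs f" unfolding dimension_pairs_def by blast
  qed
  show "is_minimal_model f 2 1 (h_theta \<theta>)"
    unfolding is_minimal_model_def
  proof (intro conjI allI impI)
    show "is_model f 2 1 (h_theta \<theta>)" by (simp add: is_model_def assms)
    show "2 + 2 * 1 \<le> k + 2 * l" if "is_model f k l h" for k l h
      using dims[OF that] by simp
  qed
  note bounds = connection_rank_root_bounds[of _ \<theta>, folded assms]
  show lim: "(\<lambda>n. connection_rank_root f (2 * n)) \<longlonglongrightarrow> 4"
  proof (rule tendsto_sandwich)
    show "\<forall>\<^sub>F n in sequentially. ereal (growth_lower (2 * n)) \<le> connection_rank_root f (2 * n)"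
      using eventually_ge_at_top[of 1] by eventually_elim (rule bounds, simp)
    show "\<forall>\<^sub>F n in sequentially. connection_rank_root f (2 * n) \<le> 4"
      using eventually_ge_at_top[of 1] by eventually_elim (rule bounds, simp)
    show "(\<lambda>n. ereal (growth_lower (2 * n))) \<longlonglongrightarrow> 4"
      using growth_lower_limit by (simp only: numeral_eq_ereal lim_ereal)
  qed simp
  show "growth_base f = 4"
  proof (rule antisym)
    show "growth_base f \<le> 4" unfolding growth_base_def by (rule SUP_least) (use bounds(2) in auto)
    show "4 \<le> growth_base f"
    proof (rule tendsto_upperbound[OF lim])
      show "\<forall>\<^sub>F n in sequentially. connection_rank_root f (2 * n) \<le> growth_base f"
        using eventually_ge_at_top[of 1]
      proof eventually_elim
        case (elim n)
        then show ?case unfolding growth_base_def by (intro SUP_upper) simp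
      qed
    qed simp
  qed
qed

end
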